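(* Let $\omega_1,\dots,\omega_k\in\mathbb{R}^n$, $\Omega=\{\omega_1,\dots,\omega_k\}$, $\theta\in\operatorname{conv}\Omega$, $q\in\mathbb{R}^k$ with all $q_i>0$, $\delta\in(0,1)$, and let $0<\varphi_0\le\varphi$ be a lower bound on the facet gap $\varphi$ of $\Omega$. Then there is an interior-point algorithm (the one described in the context) that, given $\omega_1,\dots,\omega_k$, $q$, $\theta$, $\delta$, $\varphi_0$ as input, returns $x_\delta\in\mathbb{R}^n$ such that $$F_\theta(x_\delta)\le F_\theta^*+\delta$$ within $$41\sqrt{k}\,\log\!\left(3600\,k^2n\,\frac{N}{\varphi_0}\,\frac1\delta\,\log^2\!\left(\frac{5k\beta}{\delta}\right)\right)=O\!\left(\sqrt{k}\,\log\!\left(kn\,\frac{N}{\varphi_0}\,\frac1\delta\,\log\!\left(\frac{k\beta}{\delta}\right)\right)\right)$$ iterations. The starting point is determined explicitly by the input, and every iteration is a Newton step with respect to a known function that depends on $\varphi_0$.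
   Context: Notation. $\log$ is the natural logarithm. $F_\theta(x)=\log\sum_{i=1}^k q_i e^{\langle \omega_i-\theta,x\rangle}$ for $x\in\mathbb{R}^n$, and $F_\theta^*=\inf_{x\in\mathbb{R}^n}F_\theta(x)$. $\Omega$ is assumed to consist of at least two points (so that the quantities below are well-defined). - The facet gap $\varphi>0$ of $\Omega$ is the smallest Euclidean distance $d(\omega,\operatorname{aff}\mathcal F)$ over all facets $\mathcal F$ of $\operatorname{conv}\Omega$ and all $\omega\in\Omega\setminus \mathcal F$ ($\operatorname{aff}$ = affine hull; facets are faces of codimension one relative to $\operatorname{aff}\Omega$). - $N=\max_{i\ne j}\|\omega_i-\omega_j\|_2$. - $\beta=\|q\|_1/\min_{i\in[k]}q_i$. The algorithm (exact real arithmetic). Let $W=\operatorname{span}\{\omega_1-\theta,\dots,\omega_k-\theta\}$, let $E=W\times\mathbb{R}^k\times\mathbb{R}$ with its Euclidean inner product, let $R=\frac{n}{\varphi_0}\log\bigl(\frac{2\beta}{\delta/2}\bigr)$, and let $$D_{\theta,R}=\Bigl\{(x,z,t)\in E:\ \textstyle\sum_{i} z_i\le 1,\ q_ie^{\langle\omega_i-\theta,x\rangle}\le z_ie^t\ \forall i,\ t\le\log(5k\|q\|_1),\ \|x\|_2\le R\Bigr\}.$$ On the interior of $D_{\theta,R}$ use the barrier $$\Psi(x,z,t)=-\sum_i\log z_i-\sum_i\log\bigl(\log z_i-\langle\omega_i-\theta,x\rangle+t-\log q_i\bigr)-\log\bigl(\log(5k\|q\|_1)-t\bigr)-\log\bigl(1-\textstyle\sum_iz_i\bigr)-\log(R^2-\|x\|_2^2),$$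 with gradient $g$, Hessian $H$, local norm $\|v\|_{(p)}=\sqrt{\langle v,H(p)v\rangle}$, and parameter $\nu=2k+3$. Let $c=(0;0;1)\in E$ and starting point $p_0'=(0;\frac1{2k},\dots,\frac1{2k};\log(4k\|q\|_1))$. Preliminary stage: set $\mu_0=1$, $g_0=g(p_0')$, $i=0$. While $\|H(p_i')^{-1}g(p_i')\|_{(p_i')}>\frac16$: increase $i$ by one, set $\mu_i=(1-\frac{1}{8\sqrt\nu})\mu_{i-1}$ and $p_i'=p_{i-1}'-H(p_{i-1}')^{-1}(-\mu_ig_0+g(p_{i-1}'))$. After the loop set $\eta_0=(12\|H(p_i')^{-1}c\|_{(p_i')})^{-1}$ and $p_0=p_i'-H(p_i')^{-1}(\eta_0c+g(p_i'))$. Main stage: let $T$ be the smallest non-negative integer with $T\ge10\sqrt\nu\log\bigl(\frac65\frac{\nu}{\eta_0\delta/2}\bigr)$. For $i=1,\dots,T$ set $\eta_i=(1+\frac1{8\sqrt\nu})\eta_{i-1}$ and $p_i=p_{i-1}-H(p_{i-1})^{-1}(\eta_ic+g(p_{i-1}))$. Output the $x$-component $x_\delta$ of $p_T=(x,z,t)$. The number of iterations is the total number of Newton steps (updates of $p'$ and $p$) performed in the two stages. *)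

theory Defs
  imports "HOL-Analysis.Analysis" "HOL-Library.Landau_Symbols"
begin

section \<open>Calculus on a linear subspace\<close>

text \<open>
  The optimization takes place in a subspace \<open>E\<close> of a Euclidean space.  Gradient and Hessian are
  those of the function restricted to \<open>E\<close>, with respect to the inner product inherited by \<open>E\<close>.
  A derivative within \<open>E\<close> is determined only on \<open>E\<close>, so \<open>hessian_on E f p\<close> is meaningful only as a
  map \<open>E \<Rightarrow> E\<close>; accordingly its inverse is taken as the inverse of this restricted map.
\<close>

definition gradient_on :: "'a::real_inner set \<Rightarrow> ('a \<Rightarrow> real) \<Rightarrow> 'a \<Rightarrow> 'a" where
  "gradient_on E f p =
     (THE v. v \<in> E \<and> (f has_derivative (\<lambda>h. v \<bullet> h)) (at p within E))"

definition hessian_on :: "'a::real_inner set \<Rightarrow> ('a \<Rightarrow> real) \<Rightarrow> 'a \<Rightarrow> 'a \<Rightarrow> 'a" where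
  "hessian_on E f p = frechet_derivative (gradient_on E f) (at p within E)"

definition hessian_inv_on :: "'a::real_inner set \<Rightarrow> ('a \<Rightarrow> real) \<Rightarrow> 'a \<Rightarrow> 'a \<Rightarrow> 'a" where
  "hessian_inv_on E f p = inv_into E (hessian_on E f p)"

definition newton_step :: "'a::real_inner set \<Rightarrow> ('a \<Rightarrow> real) \<Rightarrow> 'a \<Rightarrow> 'a" where
  "newton_step E f p = p - hessian_inv_on E f p (gradient_on E f p)"


section \<open>Condition measures of the instance\<close>

definition facet_gap :: "'a::euclidean_space set \<Rightarrow> real" where
  "facet_gap \<Omega> =
     Min {infdist w (affine hull F) | w F. F facet_of (convex hull \<Omega>) \<and> w \<in> \<Omega> - F}"

definition max_dist :: "('k \<Rightarrow> 'a::real_normed_vector) \<Rightarrow> real" where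
  "max_dist \<omega> = Max {norm (\<omega> i - \<omega> j) | i j. i \<noteq> j}"

definition norm1 :: "real ^ 'k \<Rightarrow> real" where
  "norm1 q = (\<Sum>i\<in>UNIV. \<bar>q $ i\<bar>)"

definition beta :: "real ^ 'k \<Rightarrow> real" where
  "beta q = norm1 q / Min (range (\<lambda>i. q $ i))"


section \<open>The objective function and the interior-point algorithm\<close>

type_synonym ('n, 'k) point = "(real ^ 'n) \<times> (real ^ 'k) \<times> real"

context
  fixes \<omega> :: "'k::finite \<Rightarrow> real ^ 'n::finite"
    and q :: "real ^ 'k"
    and \<theta> :: "real ^ 'n"
    and \<delta> :: real
    and \<phi>\<^sub>0 :: real
begin

definition F_obj :: "real ^ 'n \<Rightarrow> real" where
  "F_obj x = ln (\<Sum>i\<in>UNIV. q $ i * exp ((\<omega> i - \<theta>) \<bullet> x))"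

definition F_opt :: real where
  "F_opt = (INF x. F_obj x)"

definition W_space :: "(real ^ 'n) set" where
  "W_space = span (range (\<lambda>i. \<omega> i - \<theta>))"

definition E_space :: "('n, 'k) point set" where
  "E_space = W_space \<times> UNIV \<times> UNIV"

definition radius :: real where
  "radius = real CARD('n) / \<phi>\<^sub>0 * ln (2 * beta q / (\<delta> / 2))"

definition t_max :: real where
  "t_max = ln (5 * real CARD('k) * norm1 q)"

definition domain_D :: "('n, 'k) point set" where
  "domain_D = {(x, z, t) \<in> E_space.
     (\<Sum>i\<in>UNIV. z $ i) \<le> 1 \<and>
     (\<forall>i. q $ i * exp ((\<omega> i - \<theta>) \<bullet> x) \<le> z $ i * exp t) \<and>
     t \<le> t_max \<and>
     norm x \<le> radius}"

text \<open>The interior of \<open>domain_D\<close> relative to the ambient space \<open>E_space\<close> of the program.\<close>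

definition interior_D :: "('n, 'k) point set" where
  "interior_D = (top_of_set E_space) interior_of domain_D"

definition barrier :: "('n, 'k) point \<Rightarrow> real" where
  "barrier = (\<lambda>(x, z, t).
     - (\<Sum>i\<in>UNIV. ln (z $ i))
     - (\<Sum>i\<in>UNIV. ln (ln (z $ i) - (\<omega> i - \<theta>) \<bullet> x + t - ln (q $ i)))
     - ln (t_max - t)
     - ln (1 - (\<Sum>i\<in>UNIV. z $ i))
     - ln (radius\<^sup>2 - (norm x)\<^sup>2))"

definition grad :: "('n, 'k) point \<Rightarrow> ('n, 'k) point" where
  "grad p = gradient_on E_space barrier p"

definition hess ::
    "('n, 'k) point \<Rightarrow>
     ('n, 'k) point \<Rightarrow> ('n, 'k) point" where
  "hess p = hessian_on E_space barrier p"

definition hess_inv ::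
    "('n, 'k) point \<Rightarrow>
     ('n, 'k) point \<Rightarrow> ('n, 'k) point" where
  "hess_inv p = hessian_inv_on E_space barrier p"

definition local_norm ::
    "('n, 'k) point \<Rightarrow> ('n, 'k) point \<Rightarrow> real" where
  "local_norm p v = sqrt (v \<bullet> hess p v)"

definition nu :: real where
  "nu = 2 * real CARD('k) + 3"

definition cost :: "('n, 'k) point" where
  "cost = (0, 0, 1)"

definition start :: "('n, 'k) point" where
  "start = (0, (\<chi> i. 1 / (2 * real CARD('k))), ln (4 * real CARD('k) * norm1 q))"


subsection \<open>Preliminary stage\<close>

primrec mu :: "nat \<Rightarrow> real" where
  "mu 0 = 1"
| "mu (Suc i) = (1 - 1 / (8 * sqrt nu)) * mu i"

text \<open>The sequence of preliminary iterates, continued beyond the exit of the loop.\<close>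

primrec pre_iter :: "nat \<Rightarrow> ('n, 'k) point" where
  "pre_iter 0 = start"
| "pre_iter (Suc i) =
     pre_iter i - hess_inv (pre_iter i) (- (mu (Suc i) *\<^sub>R grad start) + grad (pre_iter i))"

definition pre_exit :: "nat \<Rightarrow> bool" where
  "pre_exit i \<longleftrightarrow> \<not> local_norm (pre_iter i) (hess_inv (pre_iter i) (grad (pre_iter i))) > 1 / 6"

text \<open>
  The number of passes through the loop.  It is the correct number only if the loop terminates,
  that is, if \<open>pre_exit i\<close> holds for some \<open>i\<close>.
\<close>

definition pre_count :: nat where
  "pre_count = (LEAST i. pre_exit i)"

definition eta0 :: real where
  "eta0 = inverse (12 * local_norm (pre_iter pre_count) (hess_inv (pre_iter pre_count) cost))"

definition main_start :: "('n, 'k) point" where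
  "main_start = pre_iter pre_count -
     hess_inv (pre_iter pre_count) (eta0 *\<^sub>R cost + grad (pre_iter pre_count))"


subsection \<open>Main stage\<close>

definition main_count :: nat where
  "main_count = (LEAST T::nat. real T \<ge> 10 * sqrt nu * ln (6 / 5 * (nu / (eta0 * (\<delta> / 2)))))"

primrec eta :: "nat \<Rightarrow> real" where
  "eta 0 = eta0"
| "eta (Suc i) = (1 + 1 / (8 * sqrt nu)) * eta i"

primrec main_iter :: "nat \<Rightarrow> ('n, 'k) point" where
  "main_iter 0 = main_start"
| "main_iter (Suc i) =
     main_iter i - hess_inv (main_iter i) (eta (Suc i) *\<^sub>R cost + grad (main_iter i))"

definition x_out :: "real ^ 'n" where
  "x_out = fst (main_iter main_count)"

text \<open>
  The summand 1 is the Newton step from the last preliminary iterate to \<open>main_start\<close>.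
\<close>

definition iterations :: nat where
  "iterations = pre_count + 1 + main_count"

definition pre_fun :: "nat \<Rightarrow> ('n, 'k) point \<Rightarrow> real" where
  "pre_fun i = (\<lambda>p. - mu i * (grad start \<bullet> p) + barrier p)"

definition main_fun :: "nat \<Rightarrow> ('n, 'k) point \<Rightarrow> real" where
  "main_fun i = (\<lambda>p. eta i * (cost \<bullet> p) + barrier p)"

end


section \<open>The iteration bound\<close>

definition iter_bound :: "nat \<times> nat \<times> real \<times> real \<times> real \<times> real \<Rightarrow> real" where
  "iter_bound = (\<lambda>(k, n, N, \<phi>\<^sub>0, \<delta>, \<beta>).
     41 * sqrt (real k) *
       ln (3600 * (real k)\<^sup>2 * real n * (N / \<phi>\<^sub>0) * (1 / \<delta>) *
           (ln (5 * real k * \<beta> / \<delta>))\<^sup>2))"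

definition iter_rate :: "nat \<times> nat \<times> real \<times> real \<times> real \<times> real \<Rightarrow> real" where
  "iter_rate = (\<lambda>(k, n, N, \<phi>\<^sub>0, \<delta>, \<beta>).
     sqrt (real k) *
       ln (real k * real n * (N / \<phi>\<^sub>0) * (1 / \<delta>) * ln (real k * \<beta> / \<delta>)))"

text \<open>
  The values that the numerical parameters take on problem instances.  The \<open>O\<close>-notation is understood
  uniformly in all of them, with one absolute constant; since the dimensions \<open>k\<close> and \<open>n\<close> are
  cardinalities of types in the algorithm, this has to be expressed through the numerical parameters.
\<close>

definition param_range :: "(nat \<times> nat \<times> real \<times> real \<times> real \<times> real) set" where
  "param_range = {(k, n, N, \<phi>\<^sub>0, \<delta>, \<beta>).
     2 \<le> k \<and> 1 \<le> n \<and> 0 < \<phi>\<^sub>0 \<and> \<phi>\<^sub>0 \<le> N \<and> 0 < \<delta> \<and> \<delta> < 1 \<and> real k \<le> \<beta>}"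

end

theory Submission
  imports Defs
begin

text \<open>
  An approximate minimizer of \<open>F_obj\<close> lies in the ball of the prescribed radius: at a vertex of
  \<open>convex hull \<Omega>\<close> that maximizes \<open>x\<close>, the vector \<open>x\<close> is a nonnegative combination of at most \<open>n\<close> unit
  facet normals, because the extreme points of a base of the normal cone are facet normals.  Truncating
  the coefficients changes the objective little, since a point off a facet is at distance at least the
  facet gap from it.

  The barrier is a sum of logarithms of slacks, of pairs \<open>- ln z - ln (ln z + u)\<close>, and of
  \<open>- ln (r\<^sup>2 - |x|\<^sup>2)\<close>.  For each of these pieces the trilinear form of third derivatives is
  bounded by \<open>2 \<parallel>h\<parallel> \<parallel>v\<parallel>\<^sup>2\<close>; so the sum is self-concordant, local norms vary slowly along a step,
  and Newton's method contracts quadratically.  The central path itself is never needed: instead of comparing an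
  iterate with an analytic centre, one shows piece by piece that every feasible \<open>y\<close> satisfies
  \<open>\<langle>g, y - p\<rangle> + \<parallel>y - p\<parallel> / 9 \<le> 6/5 \<nu>\<close>, so a dual norm of at most \<open>1/9\<close> bounds the gap by \<open>6/5 \<nu>/\<eta>\<close>.
\<close>

section \<open>Facet gap and approximate minimizers\<close>

text \<open>The error \<delta> is split as \<delta>/4 for a near-minimizer (the infimum need not be
  attained), \<delta>/4 for moving it into the ball, and \<delta>/2 for the final gap; the radius is
  the one for which the truncation loss is \<delta>/4. The Newton constants hang on one identity: a
  dual norm of 1/4 becomes (1/3)^2 = 1/9 after a step. Hence the tolerance 1/9 along both paths, and
  at the switch of stages 1/6 + 1/12 = 1/4, which is the 12 in \<open>eta0\<close>. The loop exits
  once the start gradient, scaled by \<open>mu\<close>, weighs at most 1/6 - 1/9 = 1/18. The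
  iteration counts depend on the data through the dual norms of the start gradient and of the cost
  vector at an arbitrary point of the domain. Both are bounded because the domain is: in x by the
  ball, in t by \<open>t_max\<close> from above and by the minimum weight from below. The bound on
  third derivatives is proved in its mixed form, one direction \<open>h\<close> against two
  directions \<open>v\<close>, so there is no passage from the cubic form to the trilinear
  one.\<close>

lemma finite_facet_distances:
  fixes \<Omega> :: "'a::euclidean_space set"
  assumes "finite \<Omega>"
  shows "finite {infdist w (affine hull F) | w F. F facet_of (convex hull \<Omega>) \<and> w \<in> \<Omega> - F}"
proof -
  have "finite {F. F facet_of (convex hull \<Omega>)}"
    using assms by (simp add: finite_polytope_facets polytope_convex_hull finite_imp_compact)
  then have "finite ((\<lambda>(w, F). infdist w (affine hull F)) ` (\<Omega> \<times> {F. F facet_of (convex hull \<Omega>)}))"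
    using assms by blast
  then show ?thesis
    by (rule rev_finite_subset) auto
qed

section \<open>Facet normals and the normal cone of a vertex\<close>

lemma facet_gap_le:
  fixes \<Omega> :: "'a::euclidean_space set"
  assumes "finite \<Omega>" "F facet_of (convex hull \<Omega>)" "w \<in> \<Omega>" "w \<notin> F" "p \<in> affine hull F"
  shows "facet_gap \<Omega> \<le> dist w p"
proof -
  have "facet_gap \<Omega> \<le> infdist w (affine hull F)"
    unfolding facet_gap_def using assms finite_facet_distances by (intro Min_le) auto
  then show ?thesis
    using infdist_le[OF assms(5), of w] by linarith
qed

text \<open>The hyperplane through \<open>w0\<close> with normal \<open>y\<close> supports the hull
  and cuts out a face. The hypothesis \<open>tight\<close> says that the points of \<Omega> on it
  span every direction of \<open>W\<close> orthogonal to \<open>y\<close>, so the face has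
  codimension one and is a facet. A point \<open>w\<close> off it has height
  \<open>(w0 - w) \<bullet> y\<close> over its affine hull, since \<open>y\<close> is a unit vector,
  and the facet gap is a lower bound for that height.\<close>

lemma facet_normal_gap:
  fixes \<Omega> :: "'a::euclidean_space set" and w0 y :: 'a
  defines "W \<equiv> span ((\<lambda>w. w - w0) ` \<Omega>)"
  assumes fin: "finite \<Omega>" and w0: "w0 \<in> \<Omega>" and y: "y \<in> W" "norm y = 1"
    and le: "\<And>w. w \<in> \<Omega> \<Longrightarrow> (w - w0) \<bullet> y \<le> 0"
    and tight: "W \<inter> {v. y \<bullet> v = 0} \<subseteq> span ((\<lambda>w. w - w0) ` {w \<in> \<Omega>. (w - w0) \<bullet> y = 0})"
    and w: "w \<in> \<Omega>"
  shows "(w - w0) \<bullet> y = 0 \<or> facet_gap \<Omega> \<le> (w0 - w) \<bullet> y"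
proof (cases "(w - w0) \<bullet> y = 0")
  case False
  define F where "F = convex hull \<Omega> \<inter> {p. y \<bullet> p = y \<bullet> w0}"
  define U where "U = W \<inter> {v. y \<bullet> v = 0}"
  have yy: "y \<bullet> y = 1"
    using y by (simp add: norm_eq_1)
  have w0F: "w0 \<in> F"
    unfolding F_def using w0 by (simp add: hull_inc)
  have "convex hull \<Omega> \<subseteq> {p. y \<bullet> p \<le> y \<bullet> w0}"
  proof (rule hull_minimal)
    show "\<Omega> \<subseteq> {p. y \<bullet> p \<le> y \<bullet> w0}"
    proof
      fix w assume "w \<in> \<Omega>"
      then show "w \<in> {p. y \<bullet> p \<le> y \<bullet> w0}"
        using le[of w] by (simp add: inner_diff_left inner_commute[of y])
    qed
  qed (simp add: convex_halfspace_le)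
  then have face: "F face_of (convex hull \<Omega>)"
    unfolding F_def by (intro face_of_Int_supporting_hyperplane_le) auto
  have subU: "subspace U"
    unfolding U_def W_def by (intro subspace_inter subspace_span subspace_hyperplane)
  have affW: "affine hull \<Omega> = (+) w0 ` W"
    unfolding W_def using affine_hull_span_gen[OF hull_inc[OF w0]] by (simp add: add.commute image_def)
  have tF: "span ((\<lambda>x. - w0 + x) ` F) = U"
  proof
    have "p - w0 \<in> U" if "p \<in> F" for p
    proof -
      have "p \<in> affine hull \<Omega>"
        using that convex_hull_subset_affine_hull unfolding F_def by blast
      then have "p - w0 \<in> W"
        unfolding affW by auto
      then show ?thesis
        using that unfolding U_def F_def by (simp add: inner_diff_right)
    qed
    then show "span ((\<lambda>x. - w0 + x) ` F) \<subseteq> U"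
      by (intro span_minimal subU) auto
    have "(\<lambda>w. w - w0) ` {w \<in> \<Omega>. (w - w0) \<bullet> y = 0} \<subseteq> (\<lambda>x. - w0 + x) ` F"
    proof (rule image_subsetI)
      fix w assume "w \<in> {w \<in> \<Omega>. (w - w0) \<bullet> y = 0}"
      then have "w \<in> F"
        unfolding F_def by (auto simp: hull_inc inner_diff_left inner_commute[of y])
      then show "w - w0 \<in> (\<lambda>x. - w0 + x) ` F"
        by (intro image_eqI[of _ _ w]) auto
    qed
    then show "U \<subseteq> span ((\<lambda>x. - w0 + x) ` F)"
      using tight span_mono unfolding U_def by blast
  qed
  have affF: "affine hull F = (+) w0 ` U"
    using affine_hull_span_gen[OF hull_inc[OF w0F]] tF by simp
  have dimF: "aff_dim F = int (dim U)"
    using aff_dim_eq_dim[OF hull_inc[OF w0F]] tF by (metis dim_span)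
  have dimP: "aff_dim (convex hull \<Omega>) = int (dim W)"
    using aff_dim_eq_dim[OF hull_inc[OF w0]] unfolding W_def by (simp add: aff_dim_convex_hull)
  have "dim {v \<in> W. \<forall>x \<in> span {y}. orthogonal x v} + dim (span {y}) = dim W"
    using y unfolding W_def by (intro dim_subspace_orthogonal_to_vectors) (auto simp: span_minimal)
  moreover have "{v \<in> W. \<forall>x \<in> span {y}. orthogonal x v} = U"
    unfolding U_def by (auto simp: orthogonal_def span_singleton)
  moreover have "dim (span {y}) = 1"
    using y by (auto simp: dim_singleton)
  ultimately have "dim U + 1 = dim W" by simp
  then have facet: "F facet_of (convex hull \<Omega>)"
    unfolding facet_of_def using face w0F dimF dimP by auto
  \<comment> \<open>\<open>w + d y\<close> is the orthogonal projection of \<open>w\<close> onto the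
    affine hull of the facet.\<close>
  define d where "d = (w0 - w) \<bullet> y"
  have "w \<notin> F"
    using False unfolding F_def by (auto simp: inner_diff_left inner_commute[of y])
  moreover have "w + d *\<^sub>R y \<in> affine hull F"
  proof -
    have "w - w0 \<in> W"
      unfolding W_def using w by (intro span_base) auto
    then have "w - w0 + d *\<^sub>R y \<in> W"
      using y unfolding W_def by (intro span_add span_scale) auto
    moreover have "y \<bullet> (w - w0 + d *\<^sub>R y) = 0"
      using yy unfolding d_def by (simp add: inner_add_right inner_diff_left inner_diff_right inner_commute)
    ultimately have "w - w0 + d *\<^sub>R y \<in> U"
      unfolding U_def by auto
    then show ?thesis
      unfolding affF by (intro image_eqI[of _ _ "w - w0 + d *\<^sub>R y"]) auto
  qed
  ultimately have "facet_gap \<Omega> \<le> dist w (w + d *\<^sub>R y)"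
    using facet_gap_le[OF fin facet w] by blast
  also have "\<dots> = \<bar>d\<bar>"
    using y by (simp add: dist_norm)
  also have "\<dots> = d"
    using le[OF w] unfolding d_def by (simp add: inner_diff_left)
  finally show ?thesis
    unfolding d_def by simp
qed simp

text \<open>If the tight constraints at \<open>y\<close> left a direction of \<open>W\<close>
  orthogonal to \<open>y\<close> uncontrolled, then the base \<open>B\<close> would contain a
  segment with \<open>y\<close> in its interior: tight constraints stay tight along the direction,
  and the finitely many others have slack. This supplies the hypothesis \<open>tight\<close> of
  \<open>facet_normal_gap\<close>.\<close>

lemma normal_cone_base_extreme_point:
  fixes \<Omega> :: "'a::euclidean_space set" and w0 y a :: 'a
  defines "W \<equiv> span ((\<lambda>w. w - w0) ` \<Omega>)"
  defines "B \<equiv> {y \<in> W. (\<forall>w\<in>\<Omega>. (w - w0) \<bullet> y \<le> 0) \<and> a \<bullet> y = 1}"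
  assumes fin: "finite \<Omega>" and ext: "y extreme_point_of B"
  shows "W \<inter> {v. y \<bullet> v = 0} \<subseteq> span ((\<lambda>w. w - w0) ` {w \<in> \<Omega>. (w - w0) \<bullet> y = 0})"
proof (rule ccontr)
  define S where "S = span ((\<lambda>w. w - w0) ` {w \<in> \<Omega>. (w - w0) \<bullet> y = 0})"
  assume "\<not> ?thesis"
  then obtain v where v: "v \<in> W" "y \<bullet> v = 0" "v \<notin> S"
    unfolding S_def by auto
  obtain v1 v2 where v1: "v1 \<in> span S" and v2: "\<And>w. w \<in> span S \<Longrightarrow> orthogonal v2 w" and v12: "v = v1 + v2"
    using orthogonal_subspace_decomp_exists[of S v] by blast
  have SS: "span S = S"
    unfolding S_def by simp
  have "S \<subseteq> W"
    unfolding S_def W_def by (intro span_mono) auto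
  then have v2W: "v2 \<in> W"
  proof -
    have "v2 = v - v1" "v1 \<in> W" using v12 v1 SS \<open>S \<subseteq> W\<close> by auto
    then show ?thesis using v unfolding W_def by (auto intro: span_diff)
  qed
  have yB: "y \<in> W" "\<And>w. w \<in> \<Omega> \<Longrightarrow> (w - w0) \<bullet> y \<le> 0" "a \<bullet> y = 1"
    using ext unfolding extreme_point_of_def B_def by auto
  have yS: "y \<bullet> s = 0" if "s \<in> S" for s
  proof -
    have "S \<subseteq> {v. y \<bullet> v = 0}"
      unfolding S_def by (intro span_minimal subspace_hyperplane) (auto simp: inner_commute)
    then show ?thesis using that by auto
  qed
  have yv2: "y \<bullet> v2 = 0"
    using v v1 v12 yS SS by (simp add: inner_add_right)
  have v20: "v2 \<noteq> 0"
    using v v1 v12 SS by auto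
  text \<open>The extreme point \<open>y\<close> can be moved both ways along the part of \<open>v2\<close> tangent to \<open>a \<bullet> x = 1\<close>.\<close>
  define u where "u = v2 - (a \<bullet> v2) *\<^sub>R y"
  have uW: "u \<in> W"
    unfolding u_def using v2W yB unfolding W_def by (intro span_diff span_scale) auto
  have au: "a \<bullet> u = 0"
    unfolding u_def using yB by (simp add: inner_diff_right)
  have u0: "u \<noteq> 0"
  proof
    assume "u = 0"
    then have "v2 = (a \<bullet> v2) *\<^sub>R y" unfolding u_def by simp
    then have "v2 \<bullet> v2 = 0" using yv2 by (metis inner_scaleR_left mult_zero_right)
    then show False using v20 by simp
  qed
  have tu: "(w - w0) \<bullet> u = 0" if "w \<in> \<Omega>" "(w - w0) \<bullet> y = 0" for w
  proof -
    have "w - w0 \<in> S" unfolding S_def using that by (intro span_base) auto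
    then have "v2 \<bullet> (w - w0) = 0" using v2 SS by (auto simp: orthogonal_def)
    then show ?thesis unfolding u_def using that by (simp add: inner_diff_right inner_commute)
  qed
  have "\<exists>e>0. \<forall>s. \<bar>s\<bar> \<le> e \<longrightarrow> (\<forall>w\<in>\<Omega>. (w - w0) \<bullet> (y + s *\<^sub>R u) \<le> 0)"
  proof -
    have "\<forall>w\<in>\<Omega>. \<exists>e>0. \<forall>s. \<bar>s\<bar> \<le> e \<longrightarrow> (w - w0) \<bullet> (y + s *\<^sub>R u) \<le> 0"
    proof
      fix w assume w: "w \<in> \<Omega>"
      show "\<exists>e>0. \<forall>s. \<bar>s\<bar> \<le> e \<longrightarrow> (w - w0) \<bullet> (y + s *\<^sub>R u) \<le> 0"
      proof (cases "(w - w0) \<bullet> y = 0")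
        case True
        then show ?thesis using tu[OF w True] by (intro exI[of _ 1]) (simp add: inner_add_right)
      next
        case False
        then have neg: "(w - w0) \<bullet> y < 0" using yB(2)[OF w] by simp
        \<comment> \<open>Slack divided by the rate of change; the added 1 keeps the denominator
          positive when the rate is zero.\<close>
        define e where "e = - ((w - w0) \<bullet> y) / (1 + \<bar>(w - w0) \<bullet> u\<bar>)"
        have "(w - w0) \<bullet> (y + s *\<^sub>R u) \<le> 0" if "\<bar>s\<bar> \<le> e" for s
        proof -
          have "s * ((w - w0) \<bullet> u) \<le> \<bar>s\<bar> * \<bar>(w - w0) \<bullet> u\<bar>"
            by (metis abs_ge_self abs_mult)
          also have "\<dots> \<le> e * (1 + \<bar>(w - w0) \<bullet> u\<bar>)"
            using that by (intro mult_mono) auto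
          also have "\<dots> = - ((w - w0) \<bullet> y)"
            unfolding e_def by (simp add: field_simps)
          finally show ?thesis by (simp add: inner_add_right)
        qed
        moreover have "e > 0" unfolding e_def using neg by (intro divide_pos_pos) auto
        ultimately show ?thesis by blast
      qed
    qed
    then obtain e where e: "\<forall>w\<in>\<Omega>. e w > 0 \<and> (\<forall>s. \<bar>s\<bar> \<le> e w \<longrightarrow> (w - w0) \<bullet> (y + s *\<^sub>R u) \<le> 0)"
      by metis
    define e' where "e' = Min (insert 1 (e ` \<Omega>))"
    have "e' > 0" unfolding e'_def using fin e by (subst Min_gr_iff) auto
    moreover have "e' \<le> e w" if "w \<in> \<Omega>" for w
      unfolding e'_def using fin that by (intro Min_le) auto
    ultimately show ?thesis using e by (intro exI[of _ e']) force
  qed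
  then obtain e where e: "e > 0" "\<And>s w. \<bar>s\<bar> \<le> e \<Longrightarrow> w \<in> \<Omega> \<Longrightarrow> (w - w0) \<bullet> (y + s *\<^sub>R u) \<le> 0"
    by blast
  have inB: "y + s *\<^sub>R u \<in> B" if "\<bar>s\<bar> \<le> e" for s
  proof -
    have "y + s *\<^sub>R u \<in> W" using yB uW unfolding W_def by (intro span_add span_scale)
    moreover have "a \<bullet> (y + s *\<^sub>R u) = 1" using yB au by (simp add: inner_add_right)
    ultimately show ?thesis unfolding B_def using e(2)[OF that] by blast
  qed
  have "y + e *\<^sub>R u \<in> B" "y + (- e) *\<^sub>R u \<in> B"
    using inB[of e] inB[of "- e"] e by auto
  moreover have "y \<in> open_segment (y + e *\<^sub>R u) (y + (- e) *\<^sub>R u)"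
  proof -
    have "midpoint (y + e *\<^sub>R u) (y + (- e) *\<^sub>R u) = y"
      by (simp add: midpoint_def scaleR_add_right[symmetric] mult_2[symmetric] scaleR_2[symmetric])
    moreover have "y + e *\<^sub>R u \<noteq> y + (- e) *\<^sub>R u"
    proof
      assume "y + e *\<^sub>R u = y + (- e) *\<^sub>R u"
      then have "(2 * e) *\<^sub>R u = 0" by (simp add: scaleR_2[symmetric] algebra_simps flip: scaleR_left.add)
      then show False using e u0 by simp
    qed
    ultimately show ?thesis
      by (metis midpoint_in_open_segment)
  qed
  ultimately show False
    using ext unfolding extreme_point_of_def by blast
qed

text \<open>Normalizing by the sum of all \<open>w0 - w\<close> forces each nonnegative number
  \<open>(w0 - w) \<bullet> y\<close> into the interval from 0 to 1. These numbers determine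
  \<open>y\<close> on \<open>W\<close>: the linear map \<open>f\<close> satisfies
  \<open>f y \<bullet> y\<close> = sum of their squares, so it is injective on \<open>W\<close> and
  bounded below by a multiple of the norm. Compactness is what allows the Krein-Milman
  theorem.\<close>

lemma compact_normal_cone_base:
  fixes \<Omega> :: "'a::euclidean_space set" and w0 :: 'a
  defines "W \<equiv> span ((\<lambda>w. w - w0) ` \<Omega>)"
  defines "B \<equiv> {y \<in> W. (\<forall>w\<in>\<Omega>. (w - w0) \<bullet> y \<le> 0) \<and> (\<Sum>w\<in>\<Omega>. w0 - w) \<bullet> y = 1}"
  assumes fin: "finite \<Omega>"
  shows "compact B"
proof -
  define f where "f = (\<lambda>y. \<Sum>w\<in>\<Omega>. ((w - w0) \<bullet> y) *\<^sub>R (w - w0))"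
  have lin: "bounded_linear f"
    unfolding f_def by (intro bounded_linear_sum bounded_linear_scaleR_left[THEN bounded_linear_compose] bounded_linear_inner_right)
  have inj: "y = 0" if "y \<in> W" "f y = 0" for y
  proof -
    have "(\<Sum>w\<in>\<Omega>. ((w - w0) \<bullet> y)\<^sup>2) = f y \<bullet> y"
      unfolding f_def by (simp add: inner_sum_left power2_eq_square)
    also have "\<dots> = 0" using that by simp
    finally have "\<forall>w\<in>\<Omega>. ((w - w0) \<bullet> y)\<^sup>2 = 0"
      by (subst (asm) sum_nonneg_eq_0_iff) (use fin in auto)
    then have "(\<lambda>w. w - w0) ` \<Omega> \<subseteq> {v. y \<bullet> v = 0}"
      by (auto simp: inner_commute)
    then have "W \<subseteq> {v. y \<bullet> v = 0}"
      unfolding W_def by (intro span_minimal subspace_hyperplane)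
    then have "y \<bullet> y = 0" using that(1) by blast
    then show ?thesis by simp
  qed
  obtain e where e: "e > 0" "\<And>y. y \<in> W \<Longrightarrow> norm (f y) \<ge> e * norm y"
    using injective_imp_isometric[OF closed_subspace subspace_span, of _ f] lin inj
    unfolding W_def by (metis subspace_span)
  have bd: "norm y \<le> (\<Sum>w\<in>\<Omega>. norm (w - w0)) / e" if y: "y \<in> B" for y
  proof -
    have s: "(\<Sum>w\<in>\<Omega>. (w0 - w) \<bullet> y) = 1"
      using y unfolding B_def by (simp add: inner_sum_left)
    have pos: "(w0 - w) \<bullet> y \<ge> 0" if "w \<in> \<Omega>" for w
      using y that unfolding B_def by (auto simp: inner_diff_left)
    have le1: "(w0 - w) \<bullet> y \<le> 1" if "w \<in> \<Omega>" for w
      using member_le_sum[of w \<Omega> "\<lambda>w. (w0 - w) \<bullet> y"] that pos fin s by auto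
    have "e * norm y \<le> norm (f y)" using e(2) y unfolding B_def by auto
    also have "\<dots> \<le> (\<Sum>w\<in>\<Omega>. norm (((w - w0) \<bullet> y) *\<^sub>R (w - w0)))"
      unfolding f_def by (rule norm_sum)
    also have "\<dots> \<le> (\<Sum>w\<in>\<Omega>. norm (w - w0))"
    proof (rule sum_mono)
      fix w assume w: "w \<in> \<Omega>"
      have "\<bar>(w - w0) \<bullet> y\<bar> \<le> 1"
        using pos[OF w] le1[OF w] by (auto simp: inner_diff_left abs_if)
      then show "norm (((w - w0) \<bullet> y) *\<^sub>R (w - w0)) \<le> norm (w - w0)"
        by (simp add: mult_left_le_one_le)
    qed
    finally show ?thesis using e by (simp add: field_simps)
  qed
  have "bounded B"
    using bd by (meson bounded_iff)
  moreover have "closed B"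
  proof -
    have "B = W \<inter> (\<Inter>w\<in>\<Omega>. {y. (w - w0) \<bullet> y \<le> 0}) \<inter> {y. (\<Sum>w\<in>\<Omega>. w0 - w) \<bullet> y = 1}"
      unfolding B_def by auto
    moreover have "closed \<dots>"
      unfolding W_def by (intro closed_Int closed_INT ballI closed_subspace subspace_span closed_halfspace_le closed_hyperplane)
    ultimately show ?thesis by simp
  qed
  ultimately show ?thesis
    by (simp add: compact_eq_bounded_closed)
qed

text \<open>Scale \<open>x\<close> into the base of the normal cone, write it there as a convex
  combination of extreme points, and rescale those to unit length. Extreme points are facet normals
  by the previous lemmas, which gives the alternative in the last conclusion.\<close>

lemma normal_cone_decomposition:
  fixes \<Omega> :: "'a::euclidean_space set" and w0 x :: 'a
  defines "W \<equiv> span ((\<lambda>w. w - w0) ` \<Omega>)"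
  assumes fin: "finite \<Omega>" and w0: "w0 \<in> \<Omega>" and x: "x \<in> W"
    and le: "\<And>w. w \<in> \<Omega> \<Longrightarrow> (w - w0) \<bullet> x \<le> 0"
  obtains S :: "'a set" and c :: "'a \<Rightarrow> real" and e :: "'a \<Rightarrow> 'a"
  where "finite S" "card S \<le> DIM('a)" "x = (\<Sum>y\<in>S. c y *\<^sub>R e y)"
    and "\<And>y. y \<in> S \<Longrightarrow> c y \<ge> 0" "\<And>y. y \<in> S \<Longrightarrow> e y \<in> W" "\<And>y. y \<in> S \<Longrightarrow> norm (e y) = 1"
    and "\<And>y w. y \<in> S \<Longrightarrow> w \<in> \<Omega> \<Longrightarrow> (w - w0) \<bullet> e y \<le> 0"
    and "\<And>y w. y \<in> S \<Longrightarrow> w \<in> \<Omega> \<Longrightarrow> (w - w0) \<bullet> e y = 0 \<or> facet_gap \<Omega> \<le> (w0 - w) \<bullet> e y"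
proof (cases "x = 0")
  case True
  then show ?thesis using that[of "{}"] by simp
next
  case x0: False
  define a where "a = (\<Sum>w\<in>\<Omega>. w0 - w)"
  define B where "B = {y \<in> W. (\<forall>w\<in>\<Omega>. (w - w0) \<bullet> y \<le> 0) \<and> a \<bullet> y = 1}"
  have ax: "a \<bullet> x > 0"
  proof -
    have pos: "(w0 - w) \<bullet> x \<ge> 0" if "w \<in> \<Omega>" for w
      using le[OF that] by (simp add: inner_diff_left)
    have eq: "a \<bullet> x = (\<Sum>w\<in>\<Omega>. (w0 - w) \<bullet> x)"
      unfolding a_def by (simp add: inner_sum_left)
    have "a \<bullet> x \<noteq> 0"
    proof
      assume "a \<bullet> x = 0"
      then have z: "\<forall>w\<in>\<Omega>. (w0 - w) \<bullet> x = 0"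
        unfolding eq using pos by (subst (asm) sum_nonneg_eq_0_iff) (use fin in auto)
      have "(\<lambda>w. w - w0) ` \<Omega> \<subseteq> {v. x \<bullet> v = 0}"
      proof (rule image_subsetI)
        fix w assume "w \<in> \<Omega>"
        then show "w - w0 \<in> {v. x \<bullet> v = 0}"
          using z by (simp add: inner_commute[of x] inner_diff_left)
      qed
      then have "W \<subseteq> {v. x \<bullet> v = 0}"
        unfolding W_def by (intro span_minimal subspace_hyperplane)
      then have "x \<bullet> x = 0" using x by blast
      then show False using x0 by simp
    qed
    moreover have "a \<bullet> x \<ge> 0" unfolding eq using pos by (rule sum_nonneg)
    ultimately show ?thesis by simp
  qed
  define X where "X = {y. y extreme_point_of B}"
  define b where "b = (1 / (a \<bullet> x)) *\<^sub>R x"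
  have "b \<in> W"
    unfolding b_def using x unfolding W_def by (rule span_scale)
  then have "b \<in> B"
    unfolding B_def b_def using ax le by (auto simp: divide_nonpos_pos)
  moreover have "compact B"
    using compact_normal_cone_base[OF fin, of w0] unfolding B_def W_def a_def by simp
  moreover have "convex B"
  proof -
    have "B = W \<inter> (\<Inter>w\<in>\<Omega>. {y. (w - w0) \<bullet> y \<le> 0}) \<inter> {y. a \<bullet> y = 1}"
      unfolding B_def by auto
    moreover have "convex \<dots>"
      unfolding W_def
      by (intro convex_Int convex_INT subspace_imp_convex subspace_span convex_halfspace_le convex_hyperplane)
    ultimately show ?thesis by simp
  qed
  ultimately have "b \<in> convex hull X"
    unfolding X_def using Krein_Milman_Minkowski by blast
  then have "\<exists>S u. finite S \<and> S \<subseteq> X \<and> card S \<le> aff_dim X + 1 \<and>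
      (\<forall>y\<in>S. 0 \<le> u y) \<and> sum u S = 1 \<and> (\<Sum>y\<in>S. u y *\<^sub>R y) = b"
    unfolding convex_hull_caratheodory_aff_dim[of X] by simp
  then obtain S u where S: "finite S" "S \<subseteq> X" "card S \<le> aff_dim X + 1" "\<forall>y\<in>S. 0 \<le> u y"
      "(\<Sum>y\<in>S. u y *\<^sub>R y) = b"
    by blast
  have a0: "a \<noteq> 0" using ax by auto
  \<comment> \<open>The extreme points lie in a hyperplane, so Caratheodory needs only n points
    instead of n + 1; this is the factor n in the radius.\<close>
  have "X \<subseteq> {y. a \<bullet> y = 1}"
    unfolding X_def B_def extreme_point_of_def by auto
  then have "aff_dim X \<le> int DIM('a) - 1"
    using aff_dim_subset[of X "{y. a \<bullet> y = 1}"] aff_dim_hyperplane[OF a0, of 1] by simp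
  then have card: "card S \<le> DIM('a)" using S(3) by linarith
  have SB: "y \<in> B" "y \<noteq> 0" if "y \<in> S" for y
    using that S(2) unfolding X_def B_def extreme_point_of_def by auto
  show ?thesis
  proof (rule that[of S "\<lambda>y. (a \<bullet> x) * u y * norm y" "\<lambda>y. (1 / norm y) *\<^sub>R y"])
    show "finite S" "card S \<le> DIM('a)" by fact+
    have "x = (a \<bullet> x) *\<^sub>R b" unfolding b_def using ax by simp
    also have "\<dots> = (\<Sum>y\<in>S. ((a \<bullet> x) * u y) *\<^sub>R y)"
      by (simp add: S(5)[symmetric] scaleR_sum_right)
    also have "\<dots> = (\<Sum>y\<in>S. ((a \<bullet> x) * u y * norm y) *\<^sub>R (1 / norm y) *\<^sub>R y)"
      by (intro sum.cong refl) (use SB in auto)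
    finally show "x = \<dots>" .
    fix y assume y: "y \<in> S"
    show "(a \<bullet> x) * u y * norm y \<ge> 0" using y S(4) ax by auto
    have yW: "y \<in> W" using SB[OF y] unfolding B_def by auto
    then show eW: "(1 / norm y) *\<^sub>R y \<in> W" unfolding W_def by (rule span_scale)
    show e1: "norm ((1 / norm y) *\<^sub>R y) = 1" using SB[OF y] by simp
    show le': "(w - w0) \<bullet> ((1 / norm y) *\<^sub>R y) \<le> 0" if "w \<in> \<Omega>" for w
    proof -
      have "(w - w0) \<bullet> y \<le> 0" using SB[OF y] that unfolding B_def by auto
      then show ?thesis by (simp add: divide_nonpos_nonneg)
    qed
    have ext: "y extreme_point_of {y \<in> span ((\<lambda>w. w - w0) ` \<Omega>). (\<forall>w\<in>\<Omega>. (w - w0) \<bullet> y \<le> 0) \<and> a \<bullet> y = 1}"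
      using y S(2) unfolding X_def B_def W_def by auto
    have z: "r / norm y = 0 \<longleftrightarrow> r = 0" for r
      using SB[OF y] by simp
    have tight: "span ((\<lambda>w. w - w0) ` \<Omega>) \<inter> {v. ((1 / norm y) *\<^sub>R y) \<bullet> v = 0}
        \<subseteq> span ((\<lambda>w. w - w0) ` {w \<in> \<Omega>. (w - w0) \<bullet> ((1 / norm y) *\<^sub>R y) = 0})"
      using normal_cone_base_extreme_point[OF fin ext] z by simp
    show "(w - w0) \<bullet> ((1 / norm y) *\<^sub>R y) = 0 \<or> facet_gap \<Omega> \<le> (w0 - w) \<bullet> ((1 / norm y) *\<^sub>R y)"
      if "w \<in> \<Omega>" for w
      using facet_normal_gap[OF fin w0 _ e1 le' tight that] eW unfolding W_def by blast
  qed
qed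

lemma exists_linear_maximizer:
  fixes \<Omega> :: "'a::real_inner set"
  assumes "finite \<Omega>" "\<Omega> \<noteq> {}"
  obtains w0 where "w0 \<in> \<Omega>" "\<And>w. w \<in> \<Omega> \<Longrightarrow> w \<bullet> x \<le> w0 \<bullet> x"
proof -
  have "Max ((\<lambda>w. w \<bullet> x) ` \<Omega>) \<in> (\<lambda>w. w \<bullet> x) ` \<Omega>"
    using assms by (intro Max_in) auto
  then obtain w0 where w0: "w0 \<in> \<Omega>" "Max ((\<lambda>w. w \<bullet> x) ` \<Omega>) = w0 \<bullet> x"
    by auto
  have "w \<bullet> x \<le> w0 \<bullet> x" if "w \<in> \<Omega>" for w
    unfolding w0(2)[symmetric] using assms that by (intro Max_ge) auto
  with w0 that show ?thesis by blast
qed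

text \<open>A nonzero difference of two points has at least one facet normal in its decomposition,
  and some point lies off that facet; its distance to the vertex is at least its height. The
  consequence wanted later is \<open>\<phi>\<^sub>0 \<le> N\<close>, which keeps the argument of the
  logarithm in the iteration bound large.\<close>

lemma facet_gap_le_dist:
  fixes \<Omega> :: "'a::euclidean_space set"
  assumes fin: "finite \<Omega>" and w: "w1 \<in> \<Omega>" "w2 \<in> \<Omega>" "w1 \<noteq> w2"
  obtains u v where "u \<in> \<Omega>" "v \<in> \<Omega>" "u \<noteq> v" "facet_gap \<Omega> \<le> dist u v"
proof -
  define x where "x = w1 - w2"
  obtain w0 where w0: "w0 \<in> \<Omega>" "\<And>w. w \<in> \<Omega> \<Longrightarrow> w \<bullet> x \<le> w0 \<bullet> x"
    using exists_linear_maximizer[OF fin] w(1) by blast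
  define W where "W = span ((\<lambda>w. w - w0) ` \<Omega>)"
  have "w1 - w0 \<in> W" "w2 - w0 \<in> W"
    unfolding W_def using w by (auto intro: span_base)
  then have "(w1 - w0) - (w2 - w0) \<in> W"
    unfolding W_def by (rule span_diff)
  then have xW: "x \<in> W"
    unfolding x_def by simp
  have le: "(w - w0) \<bullet> x \<le> 0" if "w \<in> \<Omega>" for w
    using w0(2)[OF that] by (simp add: inner_diff_left)
  obtain S :: "'a set" and c :: "'a \<Rightarrow> real" and e :: "'a \<Rightarrow> 'a"
    where S: "finite S" "card S \<le> DIM('a)" "x = (\<Sum>y\<in>S. c y *\<^sub>R e y)"
      "\<And>y. y \<in> S \<Longrightarrow> c y \<ge> 0" "\<And>y. y \<in> S \<Longrightarrow> e y \<in> span ((\<lambda>w. w - w0) ` \<Omega>)"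
      "\<And>y. y \<in> S \<Longrightarrow> norm (e y) = 1"
      "\<And>y w. y \<in> S \<Longrightarrow> w \<in> \<Omega> \<Longrightarrow> (w - w0) \<bullet> e y \<le> 0"
      "\<And>y w. y \<in> S \<Longrightarrow> w \<in> \<Omega> \<Longrightarrow> (w - w0) \<bullet> e y = 0 \<or> facet_gap \<Omega> \<le> (w0 - w) \<bullet> e y"
    by (rule normal_cone_decomposition[OF fin w0(1) xW[unfolded W_def] le], assumption) (rule that)
  have "S \<noteq> {}" using S(3) w(3) unfolding x_def by auto
  then obtain y where y: "y \<in> S" by blast
  have "\<exists>w\<in>\<Omega>. (w - w0) \<bullet> e y \<noteq> 0"
  proof (rule ccontr)
    assume "\<not> ?thesis"
    then have "(\<lambda>w. w - w0) ` \<Omega> \<subseteq> {v. e y \<bullet> v = 0}"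
      by (auto simp: inner_commute)
    then have "W \<subseteq> {v. e y \<bullet> v = 0}"
      unfolding W_def by (intro span_minimal subspace_hyperplane)
    then have "e y \<bullet> e y = 0" using S(5)[OF y] unfolding W_def by blast
    then show False using S(6)[OF y] by auto
  qed
  then obtain u where u: "u \<in> \<Omega>" "(u - w0) \<bullet> e y \<noteq> 0" by blast
  then have "facet_gap \<Omega> \<le> (w0 - u) \<bullet> e y" using S(8)[OF y u(1)] u(2) by blast
  also have "\<dots> \<le> norm (w0 - u) * norm (e y)" by (rule norm_cauchy_schwarz)
  finally have "facet_gap \<Omega> \<le> dist w0 u" using S(6)[OF y] by (simp add: dist_norm)
  moreover have "w0 \<noteq> u" using u by auto
  ultimately show ?thesis using that w0(1) u(1) by blast
qed

text \<open>Both spans are the direction space of the affine hull of \<Omega>. The program is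
  centred at \<theta>, the normal cone at a vertex; this identifies their spaces.\<close>

lemma span_diff_convex_hull:
  fixes \<Omega> :: "'a::euclidean_space set"
  assumes "\<theta> \<in> convex hull \<Omega>" "w0 \<in> \<Omega>"
  shows "span ((\<lambda>w. w - \<theta>) ` \<Omega>) = span ((\<lambda>w. w - w0) ` \<Omega>)"
proof -
  have th: "\<theta> \<in> affine hull \<Omega>"
    using assms convex_hull_subset_affine_hull by blast
  have eq: "(\<lambda>w. w - p) ` \<Omega> = (\<lambda>w. - p + w) ` \<Omega>" for p by simp
  have a1: "affine hull \<Omega> = (+) \<theta> ` span ((\<lambda>w. w - \<theta>) ` \<Omega>)"
    using affine_hull_span_gen[OF th] by simp
  have a2: "affine hull \<Omega> = (+) w0 ` span ((\<lambda>w. w - w0) ` \<Omega>)"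
    using affine_hull_span_gen[OF hull_inc[OF assms(2)]] by simp
  show ?thesis
  proof
    have "w - \<theta> \<in> span ((\<lambda>w. w - w0) ` \<Omega>)" if "w \<in> \<Omega>" for w
    proof -
      have "\<theta> - w0 \<in> span ((\<lambda>w. w - w0) ` \<Omega>)"
        using th unfolding a2 by auto
      moreover have "w - w0 \<in> span ((\<lambda>w. w - w0) ` \<Omega>)"
        using that by (intro span_base) auto
      ultimately have "(w - w0) - (\<theta> - w0) \<in> span ((\<lambda>w. w - w0) ` \<Omega>)" by (rule span_diff[rotated])
      then show ?thesis by simp
    qed
    then show "span ((\<lambda>w. w - \<theta>) ` \<Omega>) \<subseteq> span ((\<lambda>w. w - w0) ` \<Omega>)"
      by (intro span_minimal) auto
    have "w - w0 \<in> span ((\<lambda>w. w - \<theta>) ` \<Omega>)" if "w \<in> \<Omega>" for w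
    proof -
      have "w - \<theta> \<in> span ((\<lambda>w. w - \<theta>) ` \<Omega>)" "w0 - \<theta> \<in> span ((\<lambda>w. w - \<theta>) ` \<Omega>)"
        using that assms by (auto intro: span_base)
      then have "(w - \<theta>) - (w0 - \<theta>) \<in> span ((\<lambda>w. w - \<theta>) ` \<Omega>)" by (rule span_diff)
      then show ?thesis by simp
    qed
    then show "span ((\<lambda>w. w - w0) ` \<Omega>) \<subseteq> span ((\<lambda>w. w - \<theta>) ` \<Omega>)"
      by (intro span_minimal) auto
  qed
qed

section \<open>Lower bounds and truncation for the objective\<close>

lemma norm1_pos_weights:
  fixes q :: "real ^ 'k"
  assumes "\<forall>i. q $ i > 0"
  shows "norm1 q = (\<Sum>i\<in>UNIV. q $ i)"
  unfolding norm1_def using assms by (intro sum.cong) (auto simp: less_imp_le)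

lemma beta_ge:
  fixes q :: "real ^ 'k"
  assumes "\<forall>i. q $ i > 0"
  shows "norm1 q \<le> beta q * q $ i" and "beta q \<ge> real CARD('k)"
proof -
  define m where "m = Min (range (\<lambda>i. q $ i))"
  have le: "m \<le> q $ i" for i
    unfolding m_def by (intro Min_le) auto
  have pos: "m > 0"
    unfolding m_def using assms by (subst Min_gr_iff) auto
  have n: "norm1 q = (\<Sum>i\<in>UNIV. q $ i)"
    using assms by (rule norm1_pos_weights)
  have b: "beta q = norm1 q / m"
    unfolding beta_def m_def by simp
  have "norm1 q \<ge> 0"
    unfolding n using assms by (intro sum_nonneg) (auto simp: less_imp_le)
  then have "norm1 q * m \<le> norm1 q * q $ i"
    using le by (intro mult_left_mono) auto
  then show "norm1 q \<le> beta q * q $ i"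
    unfolding b using pos by (simp add: field_simps)
  have "(\<Sum>i\<in>(UNIV::'k set). m) \<le> norm1 q"
    unfolding n using le by (intro sum_mono)
  then show "beta q \<ge> real CARD('k)"
    unfolding b using pos by (simp add: field_simps)
qed

lemma inner_le_convex_hull:
  fixes \<Omega> :: "'a::real_inner set"
  assumes "\<theta> \<in> convex hull \<Omega>" "\<And>w. w \<in> \<Omega> \<Longrightarrow> w \<bullet> y \<le> b"
  shows "\<theta> \<bullet> y \<le> b"
proof -
  have "convex hull \<Omega> \<subseteq> {p. y \<bullet> p \<le> b}"
    using assms(2) by (intro hull_minimal convex_halfspace_le) (auto simp: inner_commute)
  then show ?thesis using assms(1) by (auto simp: inner_commute)
qed

text \<open>Write \<open>x\<close> as a nonnegative combination of at most \<open>n\<close> unit facet normals at a vertex maximizing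
  \<open>x\<close> and truncate the coefficients at \<open>C\<close>: exponents of points on all truncated facets do not grow,
  and every other point falls behind the vertex by at least \<open>C \<phi>\<^sub>0\<close>.\<close>

lemma F_obj_truncation:
  fixes \<omega> :: "'k::finite \<Rightarrow> real ^ 'n::finite" and q :: "real ^ 'k"
  assumes th: "\<theta> \<in> convex hull (range \<omega>)" and q: "\<forall>i. q $ i > 0"
    and gap: "\<phi> \<le> facet_gap (range \<omega>)" "0 < \<phi>" and C: "C \<ge> 0" and x: "x \<in> W_space \<omega> \<theta>"
  shows "\<exists>x'\<in>W_space \<omega> \<theta>. norm x' \<le> real CARD('n) * C \<and>
    F_obj \<omega> q \<theta> x' \<le> F_obj \<omega> q \<theta> x + beta q * exp (- (C * \<phi>))"
proof -
  have fin: "finite (range \<omega>)" by simp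
  obtain w0 where w0: "w0 \<in> range \<omega>" "\<And>w. w \<in> range \<omega> \<Longrightarrow> w \<bullet> x \<le> w0 \<bullet> x"
    using exists_linear_maximizer[OF fin] by blast
  then obtain i0 where i0: "w0 = \<omega> i0" by blast
  define W where "W = span ((\<lambda>w. w - w0) ` range \<omega>)"
  have WW: "W_space \<omega> \<theta> = W"
    unfolding W_space_def W_def using span_diff_convex_hull[OF th w0(1)] by (simp add: image_image)
  have le: "(w - w0) \<bullet> x \<le> 0" if "w \<in> range \<omega>" for w
    using w0(2)[OF that] by (simp add: inner_diff_left)
  have xW: "x \<in> span ((\<lambda>w. w - w0) ` range \<omega>)"
    using x unfolding WW W_def .
  obtain S :: "(real ^ 'n) set" and c :: "real ^ 'n \<Rightarrow> real" and e :: "real ^ 'n \<Rightarrow> real ^ 'n"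
    where S: "finite S" "card S \<le> DIM(real ^ 'n)" "x = (\<Sum>y\<in>S. c y *\<^sub>R e y)"
      and c: "\<And>y. y \<in> S \<Longrightarrow> c y \<ge> 0"
      and e: "\<And>y. y \<in> S \<Longrightarrow> e y \<in> span ((\<lambda>w. w - w0) ` range \<omega>)" "\<And>y. y \<in> S \<Longrightarrow> norm (e y) = 1"
      and neg: "\<And>y w. y \<in> S \<Longrightarrow> w \<in> range \<omega> \<Longrightarrow> (w - w0) \<bullet> e y \<le> 0"
      and fg: "\<And>y w. y \<in> S \<Longrightarrow> w \<in> range \<omega> \<Longrightarrow>
        (w - w0) \<bullet> e y = 0 \<or> facet_gap (range \<omega>) \<le> (w0 - w) \<bullet> e y"
    by (rule normal_cone_decomposition[OF fin w0(1) xW le], assumption) (rule that)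
  define m where "m y = min (c y) C" for y
  define x' where "x' = (\<Sum>y\<in>S. m y *\<^sub>R e y)"
  have m0: "m y \<ge> 0" if "y \<in> S" for y
    using c[OF that] C unfolding m_def by simp
  have x'W: "x' \<in> W"
    unfolding x'_def W_def using e(1) unfolding W_def by (intro span_sum span_scale) auto
  have "norm x' \<le> (\<Sum>y\<in>S. norm (m y *\<^sub>R e y))"
    unfolding x'_def by (rule norm_sum)
  also have "\<dots> \<le> (\<Sum>y\<in>S. C)"
    using e(2) m0 by (intro sum_mono) (auto simp: m_def)
  also have "\<dots> \<le> real CARD('n) * C"
    using S(2) C by (auto intro!: mult_right_mono)
  finally have nx': "norm x' \<le> real CARD('n) * C" .
  \<comment> \<open>The indices lying off some facet whose coefficient was actually cut. All others
    see a truncated coefficient only against \<open>(w0 - \<theta>) \<bullet> e y\<close>, which is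
    nonnegative because \<theta> is in the hull.\<close>
  define bad where "bad = {i. \<exists>y\<in>S. c y > C \<and> (\<omega> i - w0) \<bullet> e y \<noteq> 0}"
  have th0: "(w0 - \<theta>) \<bullet> e y \<ge> 0" if "y \<in> S" for y
    using inner_le_convex_hull[OF th, of "e y" "w0 \<bullet> e y"] neg[OF that] by (simp add: inner_diff_left)
  have good: "(\<omega> i - \<theta>) \<bullet> x' \<le> (\<omega> i - \<theta>) \<bullet> x" if i: "i \<notin> bad" for i
  proof -
    have "m y * ((\<omega> i - \<theta>) \<bullet> e y) \<le> c y * ((\<omega> i - \<theta>) \<bullet> e y)" if y: "y \<in> S" for y
    proof (cases "c y > C")
      case True
      then have "(\<omega> i - w0) \<bullet> e y = 0" using i y unfolding bad_def by blast
      then have "(\<omega> i - \<theta>) \<bullet> e y \<ge> 0" using th0[OF y] by (simp add: inner_diff_left)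
      then show ?thesis by (intro mult_right_mono) (auto simp: m_def)
    qed (simp add: m_def)
    then show ?thesis
      unfolding x'_def S(3) by (simp add: inner_sum_right sum_mono)
  qed
  have bad: "(\<omega> i - \<theta>) \<bullet> x' \<le> (w0 - \<theta>) \<bullet> x' - C * \<phi>" if i: "i \<in> bad" for i
  proof -
    obtain y where y: "y \<in> S" "c y > C" "(\<omega> i - w0) \<bullet> e y \<noteq> 0"
      using i unfolding bad_def by blast
    have t: "0 \<le> m z * ((w0 - \<omega> i) \<bullet> e z)" if "z \<in> S" for z
      using neg[OF that, of "\<omega> i"] m0[OF that] by (intro mult_nonneg_nonneg) (auto simp: inner_diff_left)
    \<comment> \<open>One truncated facet that misses \<open>\<omega> i\<close> already yields the
      drop \<open>C * \<phi>\<close>; the remaining facets only add to it.\<close>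
    have "C * \<phi> \<le> m y * ((w0 - \<omega> i) \<bullet> e y)"
      using fg[OF y(1), of "\<omega> i"] y gap C unfolding m_def by (intro mult_mono) auto
    also have "\<dots> \<le> (\<Sum>z\<in>S. m z * ((w0 - \<omega> i) \<bullet> e z))"
      using y S(1) t by (intro member_le_sum) auto
    also have "\<dots> = (w0 - \<omega> i) \<bullet> x'"
      unfolding x'_def by (simp add: inner_sum_right)
    finally show ?thesis by (simp add: inner_diff_left)
  qed
  define f where "f i = q $ i * exp ((\<omega> i - \<theta>) \<bullet> x')" for i
  define g where "g i = q $ i * exp ((\<omega> i - \<theta>) \<bullet> x)" for i
  define v where "v = exp ((w0 - \<theta>) \<bullet> x')"
  define s where "s = beta q * exp (- (C * \<phi>))"
  have f0: "f i > 0" and g0: "g i > 0" for i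
    unfolding f_def g_def using q by auto
  have b0: "beta q \<ge> 0"
    using beta_ge(2)[OF q] by linarith
  have "(\<Sum>i\<in>bad. f i) \<le> (\<Sum>i\<in>bad. q $ i * (v * exp (- (C * \<phi>))))"
    unfolding f_def v_def exp_add[symmetric] using bad q by (intro sum_mono mult_left_mono) (auto simp: less_imp_le)
  also have "\<dots> \<le> (\<Sum>i\<in>UNIV. q $ i * (v * exp (- (C * \<phi>))))"
    using q by (intro sum_mono2) (auto simp: v_def less_imp_le)
  also have "\<dots> = norm1 q * (v * exp (- (C * \<phi>)))"
    by (simp add: norm1_pos_weights[OF q] sum_distrib_right)
  \<comment> \<open>\<open>beta\<close> trades the total weight for the weight of the vertex index
    \<open>i0\<close>. That index is not in \<open>bad\<close>, so the bad terms are charged to the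
    good ones.\<close>
  also have "\<dots> \<le> (beta q * q $ i0) * (v * exp (- (C * \<phi>)))"
    using beta_ge(1)[OF q] by (intro mult_right_mono) (auto simp: v_def)
  also have "\<dots> = s * f i0"
    unfolding s_def f_def v_def i0 by simp
  also have "\<dots> \<le> s * (\<Sum>i\<in>-bad. f i)"
  proof -
    have "i0 \<in> - bad" unfolding bad_def i0 by simp
    then have "f i0 \<le> (\<Sum>i\<in>-bad. f i)" using f0 by (intro member_le_sum) (auto simp: less_imp_le)
    then show ?thesis using b0 unfolding s_def by (intro mult_left_mono) auto
  qed
  finally have "(\<Sum>i\<in>UNIV. f i) \<le> (1 + s) * (\<Sum>i\<in>-bad. f i)"
    using sum.subset_diff[of bad UNIV f] by (simp add: Compl_eq_Diff_UNIV algebra_simps)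
  also have "\<dots> \<le> (1 + s) * (\<Sum>i\<in>-bad. g i)"
    unfolding f_def g_def using good q b0
    by (intro mult_left_mono sum_mono) (auto simp: less_imp_le s_def)
  also have "\<dots> \<le> (1 + s) * (\<Sum>i\<in>UNIV. g i)"
    using g0 b0 by (intro mult_left_mono sum_mono2) (auto simp: less_imp_le s_def)
  finally have le: "(\<Sum>i\<in>UNIV. f i) \<le> (1 + s) * (\<Sum>i\<in>UNIV. g i)" .
  have pos: "(\<Sum>i\<in>UNIV. f i) > 0" "(\<Sum>i\<in>UNIV. g i) > 0"
    using f0 g0 by (auto intro!: sum_pos)
  have s0: "s \<ge> 0" unfolding s_def using b0 by simp
  have "ln (\<Sum>i\<in>UNIV. f i) \<le> ln ((1 + s) * (\<Sum>i\<in>UNIV. g i))"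
    using le pos by (subst ln_le_cancel_iff) auto
  also have "\<dots> = ln (1 + s) + ln (\<Sum>i\<in>UNIV. g i)"
    using pos s0 by (subst ln_mult) auto
  also have "\<dots> \<le> s + ln (\<Sum>i\<in>UNIV. g i)"
    using ln_add_one_self_le_self[OF s0] by simp
  finally have "F_obj \<omega> q \<theta> x' \<le> F_obj \<omega> q \<theta> x + s"
    unfolding F_obj_def f_def g_def by simp
  then show ?thesis
    using nx' x'W unfolding WW s_def by blast
qed

text \<open>Since \<theta> is in the hull, some exponent is nonnegative, and that single term is
  already at least the smallest weight. The quotient of \<open>norm1\<close> by \<open>beta\<close>
  is that smallest weight.\<close>

lemma F_obj_lower_bound:
  fixes \<omega> :: "'k::finite \<Rightarrow> real ^ 'n::finite" and q :: "real ^ 'k"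
  assumes th: "\<theta> \<in> convex hull (range \<omega>)" and q: "\<forall>i. q $ i > 0"
  shows "ln (norm1 q / beta q) \<le> F_obj \<omega> q \<theta> x"
proof -
  obtain i where i: "\<theta> \<bullet> x \<le> \<omega> i \<bullet> x"
  proof -
    obtain w0 where w0: "w0 \<in> range \<omega>" "\<And>w. w \<in> range \<omega> \<Longrightarrow> w \<bullet> x \<le> w0 \<bullet> x"
      using exists_linear_maximizer[of "range \<omega>" x] by auto
    then show ?thesis
      using that inner_le_convex_hull[OF th w0(2)] by auto
  qed
  have n: "norm1 q > 0"
    unfolding norm1_pos_weights[OF q] using q by (intro sum_pos) auto
  have b: "beta q > 0"
    using beta_ge(2)[OF q] zero_less_card_finite[where 'a='k] by linarith
  have "norm1 q / beta q \<le> q $ i"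
    using beta_ge(1)[OF q, of i] b by (simp add: field_simps)
  also have "\<dots> \<le> q $ i * exp ((\<omega> i - \<theta>) \<bullet> x)"
    using i q by (auto simp: inner_diff_left less_imp_le)
  also have "\<dots> \<le> (\<Sum>i\<in>UNIV. q $ i * exp ((\<omega> i - \<theta>) \<bullet> x))"
    using q by (intro member_le_sum[of i UNIV "\<lambda>i. q $ i * exp ((\<omega> i - \<theta>) \<bullet> x)"]) (auto simp: less_imp_le)
  finally show ?thesis
    unfolding F_obj_def using n b by (smt (verit) divide_pos_pos ln_le_cancel_iff)
qed

text \<open>The objective depends only on the component of \<open>x\<close> in
  \<open>W_space\<close>, so a \<delta>/4-minimizer may be projected there and truncated. The choice
  \<open>C = ln (4 * beta q / \<delta>) / \<phi>\<close> makes the loss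
  \<open>beta q * exp (- (C * \<phi>))\<close> equal to \<delta>/4 and n times \<open>C\<close>
  equal to the radius.\<close>

lemma near_minimizer_in_ball:
  fixes \<omega> :: "'k::finite \<Rightarrow> real ^ 'n::finite" and q :: "real ^ 'k"
  assumes th: "\<theta> \<in> convex hull (range \<omega>)" and q: "\<forall>i. q $ i > 0"
    and gap: "\<phi> \<le> facet_gap (range \<omega>)" "0 < \<phi>" and d: "0 < \<delta>" "\<delta> < 1"
  obtains x where "x \<in> W_space \<omega> \<theta>" "norm x \<le> radius TYPE('n) q \<delta> \<phi>"
    "F_obj \<omega> q \<theta> x \<le> F_opt \<omega> q \<theta> + \<delta> / 2"
proof -
  have bdd: "bdd_below (range (F_obj \<omega> q \<theta>))"
    using F_obj_lower_bound[OF th q] by (auto intro!: bdd_belowI)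
  have "\<exists>x. F_obj \<omega> q \<theta> x < F_opt \<omega> q \<theta> + \<delta> / 4"
    using cINF_less_iff[OF _ bdd, of "F_opt \<omega> q \<theta> + \<delta> / 4"] d unfolding F_opt_def by auto
  then obtain x0 where x0: "F_obj \<omega> q \<theta> x0 < F_opt \<omega> q \<theta> + \<delta> / 4" by blast
  obtain x z where xz: "x \<in> span (W_space \<omega> \<theta>)" "\<And>w. w \<in> span (W_space \<omega> \<theta>) \<Longrightarrow> orthogonal z w" "x0 = x + z"
    using orthogonal_subspace_decomp_exists[of "W_space \<omega> \<theta>" x0] by blast
  have sW: "span (W_space \<omega> \<theta>) = W_space \<omega> \<theta>"
    unfolding W_space_def by simp
  have "(\<omega> i - \<theta>) \<bullet> x0 = (\<omega> i - \<theta>) \<bullet> x" for i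
  proof -
    have "\<omega> i - \<theta> \<in> span (W_space \<omega> \<theta>)"
      unfolding sW unfolding W_space_def by (intro span_base) auto
    then have "z \<bullet> (\<omega> i - \<theta>) = 0" using xz(2) by (simp add: orthogonal_def)
    then show ?thesis unfolding xz(3) by (simp add: inner_add_right inner_commute[of _ z])
  qed
  then have Fx: "F_obj \<omega> q \<theta> x = F_obj \<omega> q \<theta> x0"
    unfolding F_obj_def by simp
  define C where "C = ln (4 * beta q / \<delta>) / \<phi>"
  have b: "beta q \<ge> 1"
    using beta_ge(2)[OF q] zero_less_card_finite[where 'a='k] by linarith
  have r: "4 * beta q / \<delta> \<ge> 1" "4 * beta q / \<delta> > 0"
    using b d by (auto simp: field_simps)
  have C0: "C \<ge> 0" unfolding C_def using r gap by auto
  have "exp (- (C * \<phi>)) = \<delta> / (4 * beta q)"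
    unfolding C_def using r gap by (simp add: exp_minus)
  then have "beta q * exp (- (C * \<phi>)) = \<delta> / 4" using b by simp
  moreover have "real CARD('n) * C = radius TYPE('n) q \<delta> \<phi>"
    unfolding C_def radius_def by simp
  ultimately show ?thesis
    using F_obj_truncation[OF th q gap C0, of x] xz(1) sW Fx x0 that by force
qed

section \<open>Self-concordance and Newton's method on a subspace\<close>

lemma has_derivative_line:
  fixes f :: "'a::real_normed_vector \<Rightarrow> 'b::real_normed_vector"
  assumes E: "subspace E" and ph: "p \<in> E" "h \<in> E"
    and d: "(f has_derivative f') (at (p + s *\<^sub>R h) within E)"
  shows "((\<lambda>t. f (p + t *\<^sub>R h)) has_vector_derivative f' h) (at s)"
proof -
  have img: "(\<lambda>t. p + t *\<^sub>R h) ` UNIV \<subseteq> E"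
    using E ph by (auto intro: subspace_add subspace_scale)
  have 1: "((\<lambda>t. p + t *\<^sub>R h) has_derivative (\<lambda>t. t *\<^sub>R h)) (at s)"
    by (auto intro!: derivative_eq_intros)
  have 2: "(f has_derivative f') (at (p + s *\<^sub>R h) within (\<lambda>t. p + t *\<^sub>R h) ` UNIV)"
    using d img by (rule has_derivative_subset)
  have "((\<lambda>t. f (p + t *\<^sub>R h)) has_derivative (\<lambda>t. f' (t *\<^sub>R h))) (at s)"
    using has_derivative_in_compose[OF 1 2] .
  then show ?thesis
    using has_derivative_bounded_linear[OF d]
    by (simp add: has_vector_derivative_def linear_simps)
qed

lemma derivative_within_subspace_unique:
  fixes f :: "'a::real_normed_vector \<Rightarrow> 'b::real_normed_vector"
  assumes E: "subspace E" and p: "p \<in> E" "h \<in> E"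
    and d: "(f has_derivative f') (at p within E)" "(f has_derivative f'') (at p within E)"
  shows "f' h = f'' h"
proof -
  have "((\<lambda>t. f (p + t *\<^sub>R h)) has_vector_derivative f' h) (at 0)"
       "((\<lambda>t. f (p + t *\<^sub>R h)) has_vector_derivative f'' h) (at 0)"
    using has_derivative_line[OF E p, of f _ 0] d by auto
  then show ?thesis by (rule vector_derivative_unique_at)
qed

lemma gradient_on_eqI:
  fixes f :: "'a::real_inner \<Rightarrow> real"
  assumes E: "subspace E" and p: "p \<in> E" and v: "v \<in> E"
    and d: "(f has_derivative (\<lambda>h. v \<bullet> h)) (at p within E)"
  shows "gradient_on E f p = v"
  unfolding gradient_on_def
proof (rule the_equality)
  show "v \<in> E \<and> (f has_derivative (\<lambda>h. v \<bullet> h)) (at p within E)"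
    using v d by blast
  fix u assume u: "u \<in> E \<and> (f has_derivative (\<lambda>h. u \<bullet> h)) (at p within E)"
  have uv: "u - v \<in> E"
    using u v E by (auto intro: subspace_diff)
  have "u \<bullet> (u - v) = v \<bullet> (u - v)"
    using derivative_within_subspace_unique[OF E p uv, of f "\<lambda>h. u \<bullet> h" "\<lambda>h. v \<bullet> h"] u d by blast
  then have "(u - v) \<bullet> (u - v) = 0"
    by (simp add: inner_diff_left)
  then show "u = v" by simp
qed

text \<open>The gradient is known to be \<open>g\<close> only on the relatively open set
  \<open>D\<close>, which suffices for a derivative at \<open>p\<close>.
  \<open>frechet_derivative\<close> then selects some derivative within \<open>E\<close>, and any
  two of them agree on \<open>E\<close>, though possibly not outside; hence the assumption on
  \<open>h\<close>.\<close>

lemma hessian_on_eq: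
  fixes g :: "'a::real_inner \<Rightarrow> 'a"
  assumes E: "subspace E" and D: "openin (top_of_set E) D" "p \<in> D" and h: "h \<in> E"
    and g: "\<And>x. x \<in> D \<Longrightarrow> gradient_on E f x = g x"
    and d: "(g has_derivative H) (at p within E)"
  shows "hessian_on E f p h = H h"
proof -
  have DE: "D \<subseteq> E" using D(1) openin_imp_subset by blast
  have ev: "eventually (\<lambda>x. g x = gradient_on E f x) (at p within E)"
  proof -
    have "eventually (\<lambda>x. x \<in> D) (at p within E)"
    proof -
      obtain U where "open U" "D = E \<inter> U" using D(1) unfolding openin_open by blast
      then show ?thesis using D(2) unfolding eventually_at_topological by (intro exI[of _ U]) auto
    qed
    then show ?thesis by eventually_elim (simp add: g)
  qed
  have "(gradient_on E f has_derivative H) (at p within E)"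
    by (rule has_derivative_transform_eventually[OF d ev]) (use D DE g in auto)
  then have "(gradient_on E f has_derivative (frechet_derivative (gradient_on E f) (at p within E))) (at p within E)"
    using frechet_derivative_works differentiable_def by blast
  then show ?thesis
    unfolding hessian_on_def
    using derivative_within_subspace_unique[OF E] D DE h \<open>(gradient_on E f has_derivative H) (at p within E)\<close>
    by blast
qed

text \<open>Polarization of \<open>M\<close> and the parallelogram law for \<open>B\<close> give
  \<open>\<bar>M u v\<bar> \<le> m / 2 * (B u u + B v v)\<close>; normalizing \<open>u\<close> and
  \<open>v\<close> in \<open>B\<close> turns the arithmetic mean into the geometric one. It is
  applied with \<open>M = B\<close> for Cauchy-Schwarz and with a difference of two Hessians in the
  analysis of Newton's method.\<close>

lemma symmetric_form_bound:
  fixes B M :: "'a::real_vector \<Rightarrow> 'a \<Rightarrow> real"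
  assumes Mb: "\<And>u v w. M (u + v) w = M u w + M v w" "\<And>u v w. M w (u + v) = M w u + M w v"
    "\<And>c u v. M (c *\<^sub>R u) v = c * M u v" "\<And>c u v. M u (c *\<^sub>R v) = c * M u v" "\<And>u v. M u v = M v u"
    and Bb: "\<And>u v w. B (u + v) w = B u w + B v w" "\<And>u v w. B w (u + v) = B w u + B w v"
    "\<And>c u v. B (c *\<^sub>R u) v = c * B u v" "\<And>c u v. B u (c *\<^sub>R v) = c * B u v"
    and E: "subspace E" and u: "u \<in> E" and v: "v \<in> E"
    and le: "\<And>u. u \<in> E \<Longrightarrow> \<bar>M u u\<bar> \<le> m * B u u"
    and pos: "\<And>u. u \<in> E \<Longrightarrow> u \<noteq> 0 \<Longrightarrow> B u u > 0"
  shows "\<bar>M u v\<bar> \<le> m * (sqrt (B u u) * sqrt (B v v))"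
proof -
  have neg: "M (- u) v = - M u v" "M u (- v) = - M u v" "B (- u) v = - B u v" "B u (- v) = - B u v" for u v
    using Mb(3)[of "-1" u v] Mb(4)[of u "-1" v] Bb(3)[of "-1" u v] Bb(4)[of u "-1" v] by auto
  have *: "\<bar>M u v\<bar> \<le> m / 2 * (B u u + B v v)" if "u \<in> E" "v \<in> E" for u v
  proof -
    have "4 * M u v = M (u + v) (u + v) - M (u + - v) (u + - v)"
      by (simp add: Mb(1,2) neg Mb(5)[of v u] del: add_uminus_conv_diff)
    moreover have "\<bar>M (u + v) (u + v)\<bar> \<le> m * B (u + v) (u + v)"
      using that E by (intro le subspace_add)
    moreover have "\<bar>M (u + - v) (u + - v)\<bar> \<le> m * B (u + - v) (u + - v)"
      using that E by (intro le subspace_add subspace_neg)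
    moreover have "B (u + v) (u + v) + B (u + - v) (u + - v) = 2 * (B u u + B v v)"
      by (simp add: Bb(1,2) neg del: add_uminus_conv_diff)
    then have "m * B (u + v) (u + v) + m * B (u + - v) (u + - v) = 2 * (m * (B u u + B v v))"
      by (metis distrib_left mult.left_commute)
    ultimately have "2 * \<bar>M u v\<bar> \<le> m * (B u u + B v v)" by linarith
    then show ?thesis by simp
  qed
  show ?thesis
  proof (cases "u = 0 \<or> v = 0")
    case True
    moreover have "M 0 w = 0" "M w 0 = 0" "B 0 w = 0" for w
      using Mb(3)[of 0 0 w] Mb(4)[of w 0 0] Bb(3)[of 0 0 w] by auto
    ultimately show ?thesis by auto
  next
    case False
    define a b where "a = sqrt (B u u)" and "b = sqrt (B v v)"
    have ab: "a > 0" "b > 0" "a\<^sup>2 = B u u" "b\<^sup>2 = B v v"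
      unfolding a_def b_def using False pos u v by (auto simp: less_imp_le)
    have "\<bar>M ((1/a) *\<^sub>R u) ((1/b) *\<^sub>R v)\<bar>
        \<le> m / 2 * (B ((1/a) *\<^sub>R u) ((1/a) *\<^sub>R u) + B ((1/b) *\<^sub>R v) ((1/b) *\<^sub>R v))"
      using u v E by (intro * subspace_scale)
    also have "\<dots> = m"
      using ab by (simp add: Bb flip: ab(3,4)) (simp add: power2_eq_square)
    finally show ?thesis
      using ab unfolding a_def[symmetric] b_def[symmetric] by (simp add: Mb abs_mult field_simps)
  qed
qed

section \<open>Local norms and Newton's method for a self-concordant gradient field\<close>

text \<open>Only the gradient \<open>g\<close> and the Hessian \<open>H\<close> occur, no barrier
  function. Hence \<open>dikin\<close>, that unit ellipsoids stay inside \<open>D\<close>, is an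
  assumption here, to be verified piece by piece, instead of a consequence of blow-up at the
  boundary.\<close>

locale self_concordant =
  fixes E D :: "'a::euclidean_space set" and g :: "'a \<Rightarrow> 'a" and H :: "'a \<Rightarrow> 'a \<Rightarrow> 'a"
  assumes E: "subspace E"
    and D_open: "openin (top_of_set E) D"
    and g_in: "\<And>p. p \<in> D \<Longrightarrow> g p \<in> E"
    and H_in: "\<And>p h. p \<in> D \<Longrightarrow> h \<in> E \<Longrightarrow> H p h \<in> E"
    and g_deriv: "\<And>p. p \<in> D \<Longrightarrow> (g has_derivative H p) (at p)"
    and H_sym: "\<And>p u v. p \<in> D \<Longrightarrow> u \<bullet> H p v = v \<bullet> H p u"
    and H_pos: "\<And>p v. p \<in> D \<Longrightarrow> v \<noteq> 0 \<Longrightarrow> v \<bullet> H p v > 0"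
    and dikin: "\<And>p h. p \<in> D \<Longrightarrow> h \<in> E \<Longrightarrow> h \<bullet> H p h < 1 \<Longrightarrow> p + h \<in> D"
    and third: "\<And>p h v. p \<in> D \<Longrightarrow> h \<in> E \<Longrightarrow> v \<in> E \<Longrightarrow>
      \<exists>T. ((\<lambda>s. v \<bullet> H (p + s *\<^sub>R h) v) has_real_derivative T) (at 0) \<and>
        \<bar>T\<bar> \<le> 2 * sqrt (h \<bullet> H p h) * (v \<bullet> H p v)"
begin

definition nrm :: "'a \<Rightarrow> 'a \<Rightarrow> real" where "nrm p v = sqrt (v \<bullet> H p v)"

definition step :: "'a \<Rightarrow> 'a \<Rightarrow> 'a" where "step p = inv_into E (H p)"

lemma D_sub: "p \<in> D \<Longrightarrow> p \<in> E"
  using D_open openin_imp_subset by blast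

lemma H_linear: "p \<in> D \<Longrightarrow> bounded_linear (H p)"
  using g_deriv has_derivative_bounded_linear by blast

lemma H_nonneg: "p \<in> D \<Longrightarrow> v \<bullet> H p v \<ge> 0"
  using H_pos[of p v] by (cases "v = 0") auto

lemma nrm_nonneg: "p \<in> D \<Longrightarrow> nrm p v \<ge> 0"
  unfolding nrm_def using H_nonneg by simp

lemma nrm_sq: "p \<in> D \<Longrightarrow> (nrm p v)\<^sup>2 = v \<bullet> H p v"
  unfolding nrm_def using H_nonneg by simp

lemma nrm_scale: "p \<in> D \<Longrightarrow> nrm p (c *\<^sub>R v) = \<bar>c\<bar> * nrm p v"
  unfolding nrm_def using H_linear
  by (simp add: linear_simps real_sqrt_mult mult.assoc[symmetric])

lemma bij_H: "p \<in> D \<Longrightarrow> bij_betw (H p) E E"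
proof -
  assume p: "p \<in> D"
  have lin: "linear (H p)" using H_linear[OF p] by (simp add: bounded_linear.linear)
  have inj: "inj (H p)"
  proof (rule linear_injective_0[OF lin, THEN iffD2], intro allI impI)
    fix v assume "H p v = 0" then show "v = 0" using H_pos[OF p, of v] by auto
  qed
  have "H p ` E = E"
  proof (rule subspace_dim_equal)
    show "subspace (H p ` E)" using lin E by (rule linear_subspace_image)
    show "H p ` E \<subseteq> E" using H_in[OF p] by blast
    show "dim E \<le> dim (H p ` E)" using dim_image_eq[OF lin, of E] inj by (simp add: inj_on_subset)
  qed (rule E)
  then show ?thesis using inj unfolding bij_betw_def by (auto intro: inj_on_subset)
qed

lemma step_in: "p \<in> D \<Longrightarrow> y \<in> E \<Longrightarrow> step p y \<in> E"
  and H_step: "p \<in> D \<Longrightarrow> y \<in> E \<Longrightarrow> H p (step p y) = y"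
  using bij_H[of p] unfolding step_def bij_betw_def
  by (metis inv_into_into, metis f_inv_into_f)

text \<open>Let \<open>Q v t\<close> be the squared local norm of \<open>v\<close> at
  \<open>p + t h\<close>, so that its derivative is at most \<open>2 * sqrt (Q h t) * Q v t\<close>
  in absolute value. For \<open>v = h\<close> this closes up and gives
  \<open>sqrt (Q h t) \<le> r / (1 - t * r)\<close>. Inserted for general \<open>v\<close>, it makes
  \<open>Q v t\<close> times \<open>(1 - t * r)\<^sup>2\<close> nonincreasing and
  \<open>Q v t\<close> divided by it nondecreasing.\<close>

lemma nrm_along_segment:
  assumes p: "p \<in> D" and h: "h \<in> E" and v: "v \<in> E" and r: "nrm p h < 1" and s: "0 \<le> s" "s \<le> 1"
  shows "p + s *\<^sub>R h \<in> D"
    and "v \<bullet> H (p + s *\<^sub>R h) v * (1 - s * nrm p h)\<^sup>2 \<le> v \<bullet> H p v"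
    and "v \<bullet> H p v * (1 - s * nrm p h)\<^sup>2 \<le> v \<bullet> H (p + s *\<^sub>R h) v"
proof -
  define r where "r = nrm p h"
  have r01: "0 \<le> r" "r < 1" unfolding r_def using r nrm_nonneg[OF p] by auto
  have inD: "p + s *\<^sub>R h \<in> D" if "0 \<le> s" "s \<le> 1" for s
  proof (rule dikin[OF p])
    show "s *\<^sub>R h \<in> E" using E h by (rule subspace_scale)
    have "nrm p (s *\<^sub>R h) = s * r" unfolding r_def using nrm_scale[OF p] that by simp
    also have "\<dots> \<le> 1 * r" using that r01 by (intro mult_right_mono) auto
    finally have "nrm p (s *\<^sub>R h) < 1" using r01 by simp
    then show "s *\<^sub>R h \<bullet> H p (s *\<^sub>R h) < 1"
      using nrm_sq[OF p, of "s *\<^sub>R h"] nrm_nonneg[OF p, of "s *\<^sub>R h"]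
      by (metis abs_of_nonneg abs_square_less_1)
  qed
  then show "p + s *\<^sub>R h \<in> D" using s by simp
  have r1: "1 - t * r > 0" if "0 \<le> t" "t \<le> 1" for t
  proof -
    have "t * r \<le> 1 * r" using that r01 by (intro mult_right_mono) auto
    then show ?thesis using r01 by simp
  qed
  define Q where "Q v t = v \<bullet> H (p + t *\<^sub>R h) v" for v t
  have ex: "\<exists>T. (Q v has_real_derivative T) (at t) \<and> \<bar>T\<bar> \<le> 2 * sqrt (Q h t) * Q v t"
    if vt: "v \<in> E" "0 \<le> t" "t \<le> 1" for v t
  proof -
    obtain T where T: "((\<lambda>s. v \<bullet> H (p + t *\<^sub>R h + s *\<^sub>R h) v) has_real_derivative T) (at 0)"
        "\<bar>T\<bar> \<le> 2 * sqrt (Q h t) * Q v t"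
      using third[OF inD[OF vt(2,3)] h vt(1)] unfolding Q_def by blast
    have "((\<lambda>s. Q v (s + t)) has_real_derivative T) (at 0)"
      using T(1) unfolding Q_def by (simp add: scaleR_add_left add_ac)
    then have "(Q v has_real_derivative T) (at t)"
      using DERIV_shift[of "Q v" T 0 t] by simp
    then show ?thesis using T(2) by blast
  qed
  define Q' where "Q' v t = (SOME T. (Q v has_real_derivative T) (at t) \<and> \<bar>T\<bar> \<le> 2 * sqrt (Q h t) * Q v t)" for v t
  have Q': "(Q v has_real_derivative Q' v t) (at t)" "\<bar>Q' v t\<bar> \<le> 2 * sqrt (Q h t) * Q v t"
    if "v \<in> E" "0 \<le> t" "t \<le> 1" for v t
    unfolding atomize_conj Q'_def using ex[OF that] by (rule someI_ex)
  have Qpos: "Q v t \<ge> 0" if "0 \<le> t" "t \<le> 1" for v t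
    unfolding Q_def using H_nonneg[OF inD[OF that]] .
  have sqrtQ: "sqrt (Q h t) * (1 - t * r) \<le> r" if t: "0 \<le> t" "t \<le> 1" for t
  proof (cases "h = 0")
    case True
    then show ?thesis unfolding Q_def using r01 by simp
  next
    case False
    have Qh: "Q h t > 0" if "0 \<le> t" "t \<le> 1" for t
      unfolding Q_def using H_pos[OF inD[OF that] False] .
    \<comment> \<open>The derivative of \<open>1 / sqrt (Q h t)\<close> is at least -1, so this sum
      is nondecreasing.\<close>
    have "1 / sqrt (Q h 0) + 0 \<le> 1 / sqrt (Q h t) + t"
    proof (rule DERIV_nonneg_imp_nondecreasing[OF t(1)])
      fix x assume "0 \<le> x" "x \<le> t"
      then have x: "0 \<le> x" "x \<le> 1" using t by auto
      define d where "d = - (Q' h x * inverse (sqrt (Q h x)) / 2) / (sqrt (Q h x) * sqrt (Q h x)) + 1"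
      have "((\<lambda>t. 1 / sqrt (Q h t) + t) has_real_derivative d) (at x)"
        unfolding d_def using Qh[OF x] by (auto intro!: derivative_eq_intros Q'(1)[OF h x])
      moreover have "d \<ge> 0"
      proof -
        have "Q' h x * inverse (sqrt (Q h x)) / 2 \<le> (2 * sqrt (Q h x) * Q h x) * inverse (sqrt (Q h x)) / 2"
          using Q'(2)[OF h x] Qh[OF x] by (intro divide_right_mono mult_right_mono) auto
        also have "\<dots> = sqrt (Q h x) * sqrt (Q h x)" using Qh[OF x] by simp
        finally show ?thesis unfolding d_def using Qh[OF x] by (simp add: field_simps)
      qed
      ultimately show "\<exists>y. ((\<lambda>t. 1 / sqrt (Q h t) + t) has_real_derivative y) (at x) \<and> 0 \<le> y" by blast
    qed
    moreover have "sqrt (Q h 0) = r" unfolding Q_def r_def nrm_def by simp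
    moreover have "r > 0" using Qh[of 0] \<open>sqrt (Q h 0) = r\<close> by auto
    ultimately show ?thesis using Qh[OF t] by (simp add: field_simps)
  qed
  have lin: "((\<lambda>t. (1 - t * r)\<^sup>2) has_real_derivative - 2 * r * (1 - t * r)) (at t)" for t
    by (auto intro!: derivative_eq_intros)
  have key: "\<bar>Q' v t\<bar> * (1 - t * r) \<le> 2 * r * Q v t" if t: "0 \<le> t" "t \<le> 1" for t
  proof -
    have "\<bar>Q' v t\<bar> * (1 - t * r) \<le> (2 * sqrt (Q h t) * Q v t) * (1 - t * r)"
      using Q'(2)[OF v t] r1[OF t] by (intro mult_right_mono) auto
    also have "\<dots> = 2 * (sqrt (Q h t) * (1 - t * r)) * Q v t" by simp
    also have "\<dots> \<le> 2 * r * Q v t"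
      using sqrtQ[OF t] Qpos[OF t] by (intro mult_right_mono mult_left_mono) auto
    finally show ?thesis .
  qed
  have "Q v s * (1 - s * r)\<^sup>2 \<le> Q v 0 * (1 - 0 * r)\<^sup>2"
  proof (rule DERIV_nonpos_imp_nonincreasing[OF s(1)])
    fix x assume "0 \<le> x" "x \<le> s"
    then have x: "0 \<le> x" "x \<le> 1" using s by auto
    have "((\<lambda>t. Q v t * (1 - t * r)\<^sup>2) has_real_derivative
        (Q' v x * (1 - x * r) - 2 * r * Q v x) * (1 - x * r)) (at x)"
      using DERIV_mult[OF Q'(1)[OF v x] lin[of x]] by (simp add: algebra_simps power2_eq_square)
    moreover have "(Q' v x * (1 - x * r) - 2 * r * Q v x) * (1 - x * r) \<le> 0"
    proof (rule mult_nonpos_nonneg)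
      have "Q' v x * (1 - x * r) \<le> \<bar>Q' v x\<bar> * (1 - x * r)" using r1[OF x] by (intro mult_right_mono) auto
      then show "Q' v x * (1 - x * r) - 2 * r * Q v x \<le> 0" using key[OF x] by simp
    qed (use r1[OF x] in simp)
    ultimately show "\<exists>y. ((\<lambda>t. Q v t * (1 - t * r)\<^sup>2) has_real_derivative y) (at x) \<and> y \<le> 0" by blast
  qed
  then show "v \<bullet> H (p + s *\<^sub>R h) v * (1 - s * nrm p h)\<^sup>2 \<le> v \<bullet> H p v"
    unfolding Q_def r_def by simp
  have "Q v 0 / (1 - 0 * r)\<^sup>2 \<le> Q v s / (1 - s * r)\<^sup>2"
  proof (rule DERIV_nonneg_imp_nondecreasing[OF s(1)])
    fix x assume "0 \<le> x" "x \<le> s"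
    then have x: "0 \<le> x" "x \<le> 1" using s by auto
    define d where "d = (Q' v x * (1 - x * r)\<^sup>2 - Q v x * (- 2 * r * (1 - x * r))) / ((1 - x * r)\<^sup>2 * (1 - x * r)\<^sup>2)"
    have "((\<lambda>t. Q v t / (1 - t * r)\<^sup>2) has_real_derivative d) (at x)"
      unfolding d_def using r1[OF x] by (intro DERIV_divide Q'(1)[OF v x] lin) auto
    moreover have "d \<ge> 0"
    proof -
      have "- (Q' v x * (1 - x * r)) \<le> \<bar>Q' v x\<bar> * (1 - x * r)"
        using mult_right_mono[of "- Q' v x" "\<bar>Q' v x\<bar>" "1 - x * r"] r1[OF x] by simp
      then have "Q' v x * (1 - x * r) + 2 * r * Q v x \<ge> 0" using key[OF x] by simp
      then have "(Q' v x * (1 - x * r) + 2 * r * Q v x) * (1 - x * r) \<ge> 0" using r1[OF x] by simp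
      moreover have "Q' v x * (1 - x * r)\<^sup>2 - Q v x * (- 2 * r * (1 - x * r))
          = (Q' v x * (1 - x * r) + 2 * r * Q v x) * (1 - x * r)"
        by (simp add: algebra_simps power2_eq_square)
      ultimately show ?thesis unfolding d_def by simp
    qed
    ultimately show "\<exists>y. ((\<lambda>t. Q v t / (1 - t * r)\<^sup>2) has_real_derivative y) (at x) \<and> 0 \<le> y" by blast
  qed
  then show "v \<bullet> H p v * (1 - s * nrm p h)\<^sup>2 \<le> v \<bullet> H (p + s *\<^sub>R h) v"
    unfolding Q_def r_def[symmetric] using r1[OF s] by (simp add: field_simps)
qed

text \<open>The dual local norm of \<open>y\<close> is at most \<open>C\<close>. Stated as a bound
  on a functional over \<open>E\<close>, it adds and scales without any inverse Hessian; one sign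
  suffices because \<open>E\<close> is symmetric.\<close>

definition dual_le :: "'a \<Rightarrow> 'a \<Rightarrow> real \<Rightarrow> bool" where
  "dual_le p y C \<longleftrightarrow> (\<forall>v\<in>E. y \<bullet> v \<le> C * nrm p v)"

lemma dual_le_add: "dual_le p y C \<Longrightarrow> dual_le p y' C' \<Longrightarrow> dual_le p (y + y') (C + C')"
  unfolding dual_le_def by (simp add: inner_add_left distrib_right add_mono)

lemma dual_le_scale: "dual_le p y C \<Longrightarrow> c \<ge> 0 \<Longrightarrow> dual_le p (c *\<^sub>R y) (c * C)"
  unfolding dual_le_def by (simp add: mult_left_mono mult.assoc)

lemma dual_le_mono: "p \<in> D \<Longrightarrow> dual_le p y C \<Longrightarrow> C \<le> C' \<Longrightarrow> dual_le p y C'"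
  unfolding dual_le_def by (meson mult_right_mono nrm_nonneg order_trans)

lemma dual_le_minus: "p \<in> D \<Longrightarrow> dual_le p y C \<Longrightarrow> dual_le p (- y) C"
  unfolding dual_le_def
proof (intro ballI)
  fix v assume p: "p \<in> D" and *: "\<forall>v\<in>E. y \<bullet> v \<le> C * nrm p v" and v: "v \<in> E"
  have "y \<bullet> (- v) \<le> C * nrm p (- v)" using * v E subspace_neg by blast
  also have "nrm p (- v) = nrm p v" using nrm_scale[OF p, of "-1" v] by simp
  finally show "- y \<bullet> v \<le> C * nrm p v" by simp
qed

lemma dual_le_abs: "p \<in> D \<Longrightarrow> dual_le p y C \<Longrightarrow> v \<in> E \<Longrightarrow> \<bar>y \<bullet> v\<bar> \<le> C * nrm p v"
  using dual_le_minus[of p y C] unfolding dual_le_def by (auto simp: abs_if)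

lemma H_cauchy_schwarz:
  assumes p: "p \<in> D" and u: "u \<in> E" and v: "v \<in> E"
  shows "\<bar>u \<bullet> H p v\<bar> \<le> nrm p u * nrm p v"
proof -
  have lin: "bounded_linear (H p)" using p by (rule H_linear)
  have "\<bar>u \<bullet> H p v\<bar> \<le> 1 * (sqrt (u \<bullet> H p u) * sqrt (v \<bullet> H p v))"
    using lin H_sym[OF p] H_pos[OF p] H_nonneg[OF p] E u v
    by (intro symmetric_form_bound[where B = "\<lambda>u v. u \<bullet> H p v" and M = "\<lambda>u v. u \<bullet> H p v" and E = E])
      (auto simp: linear_simps inner_add_left inner_add_right)
  then show ?thesis unfolding nrm_def by simp
qed

text \<open>Cauchy-Schwarz in the local inner product gives one direction, testing with
  \<open>v = step p y\<close> the other. It links \<open>dual_le\<close> to the norm that the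
  algorithm measures in its loop condition and in \<open>eta0\<close>.\<close>

lemma dual_le_iff_step:
  assumes p: "p \<in> D" and y: "y \<in> E" and C: "C \<ge> 0"
  shows "dual_le p y C \<longleftrightarrow> nrm p (step p y) \<le> C"
proof
  assume *: "nrm p (step p y) \<le> C"
  show "dual_le p y C" unfolding dual_le_def
  proof
    fix v assume v: "v \<in> E"
    have "y \<bullet> v = v \<bullet> H p (step p y)" using H_step[OF p y] by (simp add: inner_commute)
    also have "\<dots> \<le> nrm p v * nrm p (step p y)" using H_cauchy_schwarz[OF p v step_in[OF p y]] by simp
    also have "\<dots> \<le> nrm p v * C" using * nrm_nonneg[OF p] by (intro mult_left_mono)
    finally show "y \<bullet> v \<le> C * nrm p v" by (simp add: mult.commute)
  qed
next
  assume *: "dual_le p y C"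
  define n where "n = step p y"
  have "nrm p n * nrm p n = n \<bullet> H p n" using nrm_sq[OF p, of n] by (simp add: power2_eq_square)
  also have "\<dots> = y \<bullet> n" unfolding n_def using H_step[OF p y] by (simp add: inner_commute)
  also have "\<dots> \<le> C * nrm p n" using * step_in[OF p y] unfolding dual_le_def n_def by blast
  finally have le: "nrm p n * nrm p n \<le> C * nrm p n" .
  show "nrm p n \<le> C"
  proof (cases "nrm p n = 0")
    case True
    then show ?thesis using C by simp
  next
    case False
    then show ?thesis using le nrm_nonneg[OF p, of n] by (simp add: mult_le_cancel_right)
  qed
qed

text \<open>\<open>L\<close> is the gradient of an added linear term. At the new point the
  linearized gradient vanishes, so what remains is the integral along the step of the change of the
  Hessian, which is at most \<open>1 / (1 - s * \<rho>)\<^sup>2 - 1\<close> relative to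
  \<open>H p\<close>. Integration gives \<open>\<rho>\<^sup>2 / (1 - \<rho>)\<close> in the norm at
  \<open>p\<close>; passing to the norm at \<open>p'\<close> costs another
  \<open>1 / (1 - \<rho>)\<close>.\<close>

lemma newton_contraction:
  assumes p: "p \<in> D" and L: "L \<in> E" and r: "dual_le p (L + g p) r" "0 \<le> r" "r < 1"
  defines "p' \<equiv> p - step p (L + g p)"
  shows "p' \<in> D" and "dual_le p' (L + g p') ((r / (1 - r))\<^sup>2)"
proof -
  define n where "n = - step p (L + g p)"
  have y: "L + g p \<in> E" using L g_in[OF p] E by (auto intro: subspace_add)
  have n: "n \<in> E" unfolding n_def using step_in[OF p y] E by (auto intro: subspace_neg)
  have Hn: "H p n = - (L + g p)" unfolding n_def using H_step[OF p y] H_linear[OF p] by (simp add: linear_simps)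
  define \<rho> where "\<rho> = nrm p n"
  have "\<rho> = nrm p (step p (L + g p))"
    unfolding \<rho>_def n_def using nrm_scale[OF p, of "-1"] by simp
  then have \<rho>: "0 \<le> \<rho>" "\<rho> \<le> r" "\<rho> < 1"
    using dual_le_iff_step[OF p y r(2)] r nrm_nonneg[OF p] unfolding \<rho>_def by auto
  have p'n: "p' = p + 1 *\<^sub>R n" unfolding p'_def n_def by simp
  note seg = nrm_along_segment[OF p n _ \<rho>(3)[unfolded \<rho>_def], folded \<rho>_def]
  show p'D: "p' \<in> D" unfolding p'n using seg(1)[OF n, of 1] by simp
  have r1: "1 - s * \<rho> > 0" if "0 \<le> s" "s \<le> 1" for s
  proof -
    have "s * \<rho> \<le> 1 * \<rho>" using that \<rho> by (intro mult_right_mono) auto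
    then show ?thesis using \<rho> by simp
  qed
  have form: "v \<bullet> H (p + s *\<^sub>R n) n - v \<bullet> H p n \<le> (1 / (1 - s * \<rho>)\<^sup>2 - 1) * (nrm p v * \<rho>)"
    if v: "v \<in> E" and s: "0 \<le> s" "s \<le> 1" for v s
  proof -
    define m where "m = 1 / (1 - s * \<rho>)\<^sup>2 - 1"
    define M where "M u v = u \<bullet> H (p + s *\<^sub>R n) v - u \<bullet> H p v" for u v
    have q: "p + s *\<^sub>R n \<in> D" using seg(1)[OF n s] .
    have lin: "bounded_linear (H p)" "bounded_linear (H (p + s *\<^sub>R n))" using p q H_linear by auto
    have b: "\<bar>M u u\<bar> \<le> m * (u \<bullet> H p u)" if u: "u \<in> E" for u
    proof -
      define a where "a = (1 - s * \<rho>)\<^sup>2"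
      have "s * \<rho> \<ge> 0" using s \<rho> by simp
      then have a: "0 < a" "a \<le> 1" unfolding a_def using r1[OF s] by (auto simp: abs_square_le_1)
      have 1: "u \<bullet> H (p + s *\<^sub>R n) u * a \<le> u \<bullet> H p u" and 2: "u \<bullet> H p u * a \<le> u \<bullet> H (p + s *\<^sub>R n) u"
        unfolding a_def using seg(2,3)[OF u s] by auto
      \<comment> \<open>The lower deviation of the Hessian is no larger than the upper one, so a
        single factor \<open>m\<close> serves both signs.\<close>
      have "1 - a \<le> 1 / a - 1"
      proof -
        have "(1 - a)\<^sup>2 \<ge> 0" by simp
        then have "2 * a \<le> 1 + a * a" by (simp add: power2_eq_square algebra_simps)
        then show ?thesis using a by (simp add: field_simps)
      qed
      then have "(1 - a) * (u \<bullet> H p u) \<le> m * (u \<bullet> H p u)"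
        unfolding m_def a_def[symmetric] using H_nonneg[OF p] by (intro mult_right_mono)
      moreover have "u \<bullet> H (p + s *\<^sub>R n) u \<le> 1 / a * (u \<bullet> H p u)"
        using 1 a by (simp add: field_simps)
      ultimately show ?thesis
        using 2 unfolding M_def m_def a_def[symmetric] by (auto simp: abs_if algebra_simps)
    qed
    have "\<bar>M v n\<bar> \<le> m * (sqrt (v \<bullet> H p v) * sqrt (n \<bullet> H p n))"
      using lin H_sym[OF p] H_sym[OF q] H_pos[OF p] E v n b
      by (intro symmetric_form_bound[where B = "\<lambda>u v. u \<bullet> H p v" and M = M and E = E])
        (auto simp: M_def linear_simps inner_add_left inner_add_right algebra_simps)
    then show ?thesis unfolding M_def m_def nrm_def \<rho>_def by (simp add: abs_if split: if_splits)
  qed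
  have main: "(L + g p') \<bullet> v \<le> \<rho>\<^sup>2 / (1 - \<rho>) * nrm p v" if v: "v \<in> E" for v
  proof -
    \<comment> \<open>Monotonicity of \<psi> replaces the integration: the last term is an
      antiderivative of the bound in \<open>form\<close>.\<close>
    define \<psi> where "\<psi> s = g (p + s *\<^sub>R n) \<bullet> v - s * (v \<bullet> H p n) - nrm p v * (1 / (1 - s * \<rho>) - s * \<rho>)" for s
    have "\<psi> 1 \<le> \<psi> 0"
    proof (rule DERIV_nonpos_imp_nonincreasing[of 0 1 \<psi>])
      fix s :: real assume s: "0 \<le> s" "s \<le> 1"
      have q: "p + s *\<^sub>R n \<in> D" using seg(1)[OF n s] .
      have "((\<lambda>t. g (p + t *\<^sub>R n)) has_vector_derivative H (p + s *\<^sub>R n) n) (at s)"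
        using has_derivative_line[OF E D_sub[OF p] n] g_deriv[OF q] has_derivative_at_withinI by blast
      then have "((\<lambda>t. g (p + t *\<^sub>R n) \<bullet> v) has_vector_derivative H (p + s *\<^sub>R n) n \<bullet> v) (at s)"
        by (rule bounded_linear.has_vector_derivative[OF bounded_linear_inner_left])
      then have d1: "((\<lambda>t. g (p + t *\<^sub>R n) \<bullet> v) has_real_derivative v \<bullet> H (p + s *\<^sub>R n) n) (at s)"
        by (simp add: has_real_derivative_iff_has_vector_derivative inner_commute)
      have d2: "((\<lambda>t. nrm p v * (1 / (1 - t * \<rho>) - t * \<rho>)) has_real_derivative
          nrm p v * (\<rho> / (1 - s * \<rho>)\<^sup>2 - \<rho>)) (at s)"
        using r1[OF s] by (auto intro!: derivative_eq_intros simp: power2_eq_square)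
      have "(\<psi> has_real_derivative v \<bullet> H (p + s *\<^sub>R n) n - v \<bullet> H p n - nrm p v * (\<rho> / (1 - s * \<rho>)\<^sup>2 - \<rho>)) (at s)"
        unfolding \<psi>_def by (intro DERIV_diff d1 d2) (auto intro!: derivative_eq_intros)
      moreover have "v \<bullet> H (p + s *\<^sub>R n) n - v \<bullet> H p n - nrm p v * (\<rho> / (1 - s * \<rho>)\<^sup>2 - \<rho>) \<le> 0"
        using form[OF v s] by (simp add: algebra_simps)
      ultimately show "\<exists>y. (\<psi> has_real_derivative y) (at s) \<and> y \<le> 0" by blast
    qed simp
    then have "g p' \<bullet> v - v \<bullet> H p n - nrm p v * (1 / (1 - \<rho>) - \<rho>) \<le> g p \<bullet> v - nrm p v"
      unfolding \<psi>_def p'n by simp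
    moreover have "v \<bullet> H p n = - (L \<bullet> v) - g p \<bullet> v"
      unfolding Hn by (simp add: inner_diff_right inner_commute[of v])
    ultimately have "(L + g p') \<bullet> v \<le> nrm p v * (1 / (1 - \<rho>) - \<rho> - 1)"
      by (simp add: inner_add_left algebra_simps)
    also have "1 / (1 - \<rho>) - \<rho> - 1 = \<rho>\<^sup>2 / (1 - \<rho>)"
      using \<rho> by (simp add: field_simps power2_eq_square)
    finally show ?thesis by (simp add: mult.commute)
  qed
  show "dual_le p' (L + g p') ((r / (1 - r))\<^sup>2)"
    unfolding dual_le_def
  proof
    fix v assume v: "v \<in> E"
    have "(nrm p v * (1 - \<rho>))\<^sup>2 \<le> (nrm p' v)\<^sup>2"
      using seg(3)[OF v, of 1] unfolding p'n power_mult_distrib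
      by (simp add: nrm_sq[OF p] nrm_sq[OF p'D, unfolded p'n, simplified])
    then have "nrm p v * (1 - \<rho>) \<le> nrm p' v"
      using nrm_nonneg[OF p'D] by (rule power2_le_imp_le)
    then have le: "nrm p v \<le> nrm p' v / (1 - \<rho>)" using \<rho> by (simp add: field_simps)
    have "(L + g p') \<bullet> v \<le> \<rho>\<^sup>2 / (1 - \<rho>) * nrm p v" using main[OF v] .
    also have "\<dots> \<le> \<rho>\<^sup>2 / (1 - \<rho>) * (nrm p' v / (1 - \<rho>))"
      using le \<rho> by (intro mult_left_mono) auto
    also have "\<dots> = (\<rho> / (1 - \<rho>))\<^sup>2 * nrm p' v"
      by (simp add: power2_eq_square)
    also have "\<dots> \<le> (r / (1 - r))\<^sup>2 * nrm p' v"
      using \<rho> r nrm_nonneg[OF p'D] by (intro mult_right_mono power_mono frac_le) auto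
    finally show "(L + g p') \<bullet> v \<le> (r / (1 - r))\<^sup>2 * nrm p' v" .
  qed
qed

text \<open>For \<open>v\<close> in the open unit ball \<open>p + v\<close> stays in
  \<open>D\<close> by \<open>dikin\<close>, so a bound that uses only boundedness of the domain
  becomes a dual norm bound.\<close>

lemma dual_leI_unit_ball:
  assumes p: "p \<in> D" and le: "\<And>v. v \<in> E \<Longrightarrow> nrm p v < 1 \<Longrightarrow> y \<bullet> v \<le> C"
  shows "dual_le p y C"
  unfolding dual_le_def
proof
  fix v assume v: "v \<in> E"
  show "y \<bullet> v \<le> C * nrm p v"
  proof (cases "v = 0")
    case False
    then have pos: "nrm p v > 0" unfolding nrm_def using H_pos[OF p] by simp
    have "(y \<bullet> v) / nrm p v \<le> C"
    proof (rule field_le_mult_one_interval)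
      fix z :: real assume z: "0 < z" "z < 1"
      have "y \<bullet> ((z / nrm p v) *\<^sub>R v) \<le> C"
        using z pos nrm_scale[OF p] v E by (intro le subspace_scale) auto
      then show "z * ((y \<bullet> v) / nrm p v) \<le> C" by simp
    qed
    then show ?thesis using pos by (simp add: field_simps)
  qed (simp add: nrm_def)
qed

text \<open>The dual norm grows from \<open>1/9\<close> to at most \<open>1/4\<close> when the parameter
  changes, and the Newton step brings it back to \<open>(1/4 / (3/4))\<^sup>2 = 1/9\<close>.\<close>

lemma path_following_step:
  assumes p: "p \<in> D" and L: "L \<in> E" and near: "dual_le p (L + g p) (1 / 9)"
    and g: "dual_le p (g p) (sqrt \<nu>)" and \<nu>: "1 \<le> \<nu>" and \<kappa>: "\<bar>\<kappa>\<bar> = 1 / (8 * sqrt \<nu>)"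
    and L': "L' = (1 + \<kappa>) *\<^sub>R L"
  shows "p - step p (L' + g p) \<in> D"
    and "dual_le (p - step p (L' + g p)) (L' + g (p - step p (L' + g p))) (1 / 9)"
proof -
  have s: "sqrt \<nu> \<ge> 1" using \<nu> by simp
  then have \<kappa>8: "\<bar>\<kappa>\<bar> \<le> 1 / 8" unfolding \<kappa> by (simp add: field_simps)
  have L'E: "L' \<in> E" unfolding L' using E L by (rule subspace_scale)
  \<comment> \<open>\<open>L' + g p\<close> is
    \<open>(1 + \<kappa>) *\<^sub>R (L + g p) - \<kappa> *\<^sub>R g p\<close>. The first part is at
    most 9/8 * 1/9 = 1/8, and the second is 1/8 because the gradient is bounded by
    \<open>sqrt \<nu>\<close>.\<close>
  have "dual_le p ((- \<kappa>) *\<^sub>R g p) (\<bar>\<kappa>\<bar> * sqrt \<nu>)"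
  proof (cases "\<kappa> \<ge> 0")
    case True
    then show ?thesis using dual_le_scale[OF dual_le_minus[OF p g], of \<kappa>] by simp
  next
    case False
    then show ?thesis using dual_le_scale[OF g, of "- \<kappa>"] by simp
  qed
  moreover have "\<bar>\<kappa>\<bar> * sqrt \<nu> = 1 / 8" unfolding \<kappa> using s by simp
  ultimately have "dual_le p ((1 + \<kappa>) *\<^sub>R (L + g p) + (- \<kappa>) *\<^sub>R g p) ((1 + \<kappa>) * (1 / 9) + 1 / 8)"
    using near \<kappa>8 by (intro dual_le_add dual_le_scale) auto
  moreover have "(1 + \<kappa>) *\<^sub>R (L + g p) + (- \<kappa>) *\<^sub>R g p = L' + g p"
    unfolding L' by (simp add: algebra_simps)
  moreover have "(1 + \<kappa>) * (1 / 9) + 1 / 8 \<le> 1 / 4"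
    using \<kappa>8 by (simp add: abs_le_iff field_simps)
  ultimately have "dual_le p (L' + g p) (1 / 4)"
    using dual_le_mono[OF p] by metis
  from newton_contraction[OF p L'E this]
  show "p - step p (L' + g p) \<in> D"
    and "dual_le (p - step p (L' + g p)) (L' + g (p - step p (L' + g p))) (1 / 9)"
    by (auto simp: power2_eq_square)
qed

section \<open>Abstract steps as Newton steps of a barrier plus a linear term\<close>

context
  fixes f :: "'a \<Rightarrow> real" and L :: 'a
  assumes L: "L \<in> E" and f: "\<And>p. p \<in> D \<Longrightarrow> (f has_derivative (\<lambda>h. (L + g p) \<bullet> h)) (at p)"
begin

lemma gradient_on_eq: "p \<in> D \<Longrightarrow> gradient_on E f p = L + g p"
  using E D_sub g_in L f by (intro gradient_on_eqI) (auto intro: subspace_add has_derivative_at_withinI)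

lemma hessian_on_eq_H: "p \<in> D \<Longrightarrow> h \<in> E \<Longrightarrow> hessian_on E f p h = H p h"
proof (rule hessian_on_eq[OF E D_open])
  fix p assume p: "p \<in> D"
  show "gradient_on E f p = L + g p" using gradient_on_eq[OF p] .
  show "((\<lambda>p. L + g p) has_derivative H p) (at p within E)"
    using has_derivative_add[OF has_derivative_const has_derivative_at_withinI[OF g_deriv[OF p]]] by simp
qed

text \<open>A linear term does not change the Hessian, so one map \<open>step\<close> serves every
  function on either path. The equation holds for every \<open>y\<close>, since
  \<open>inv_into\<close> depends only on the preimages of \<open>y\<close> in \<open>E\<close>,
  which are the same for both maps.\<close>

lemma hessian_inv_on_eq_step:
  assumes p: "p \<in> D"
  shows "hessian_inv_on E f p y = step p y"
proof -
  have "(\<lambda>x. x \<in> E \<and> hessian_on E f p x = y) = (\<lambda>x. x \<in> E \<and> H p x = y)"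
    using hessian_on_eq_H[OF p] by auto
  then show ?thesis
    unfolding hessian_inv_on_def step_def inv_into_def by simp
qed

lemma newton_step_eq: "p \<in> D \<Longrightarrow> newton_step E f p = p - step p (L + g p)"
  unfolding newton_step_def by (simp add: gradient_on_eq hessian_inv_on_eq_step)

lemma bij_hessian_on: "p \<in> D \<Longrightarrow> bij_betw (hessian_on E f p) E E"
  using bij_H hessian_on_eq_H by (simp cong: bij_betw_cong)

end

end

section \<open>The pieces of the barrier\<close>

text \<open>As a quadratic form in \<open>(A2, C2)\<close> the difference of the two sides has nonnegative determinant; this
  follows from the Cauchy-Schwarz inequality for \<open>(\<kappa>, \<sigma>/2 + \<sigma>\<^sup>2/4)\<close> and \<open>(A1, C1)\<close>.\<close>

lemma trilinear_form_le:
  fixes A1 A2 C1 C2 \<sigma> \<kappa> :: real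
  assumes \<sigma>: "0 \<le> \<sigma>" "\<sigma> \<le> 1" and \<kappa>: "\<kappa>\<^sup>2 = 1 - \<sigma>"
  shows "\<kappa> * A1 * A2\<^sup>2 + \<sigma> * (C1 * A2\<^sup>2 / 2 + A1 * A2 * C2) + C1 * C2\<^sup>2
    \<le> sqrt (A1\<^sup>2 + C1\<^sup>2) * (A2\<^sup>2 + C2\<^sup>2)"
proof -
  define \<rho> where "\<rho> = sqrt (A1\<^sup>2 + C1\<^sup>2)"
  have \<rho>: "\<rho>\<^sup>2 = A1\<^sup>2 + C1\<^sup>2" "\<rho> \<ge> 0" unfolding \<rho>_def by auto
  have "C1 \<le> \<rho>" "- C1 \<le> \<rho>"
    using \<rho> by (auto intro!: power2_le_imp_le[of "\<bar>C1\<bar>" \<rho>, THEN order_trans[rotated]])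
  \<comment> \<open>\<open>P\<close> and \<open>R\<close> are the coefficients of
    \<open>A2\<^sup>2\<close> and \<open>C2\<^sup>2\<close> in right side minus left side; the mixed
    coefficient is \<open>- \<sigma> * A1\<close>.\<close>
  define P where "P = \<rho> - \<kappa> * A1 - \<sigma> * C1 / 2"
  define R where "R = \<rho> - C1"
  have R0: "R \<ge> 0" unfolding R_def using \<open>C1 \<le> \<rho>\<close> by simp
  \<comment> \<open>Chosen so that \<open>\<kappa> * A1 + b * C1 \<le> d * \<rho>\<close> says
    exactly \<open>\<sigma>\<^sup>2 / 4 * (\<rho> + C1) \<le> P\<close>. Multiplying by
    \<open>R = \<rho> - C1\<close> turns the left side into
    \<open>\<sigma>\<^sup>2 / 4 * A1\<^sup>2\<close>, the determinant condition.\<close>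
  define b d where "b = \<sigma> / 2 + \<sigma>\<^sup>2 / 4" and "d = 1 - \<sigma>\<^sup>2 / 4"
  have s2: "\<sigma>\<^sup>2 \<le> 1" using \<sigma> by (simp add: power_le_one)
  have d0: "d \<ge> 0" unfolding d_def using s2 by simp
  have bd: "\<kappa>\<^sup>2 + b\<^sup>2 \<le> d\<^sup>2"
  proof -
    have "\<sigma> * (3 / 4 * \<sigma> + \<sigma>\<^sup>2 / 4) \<le> \<sigma> * 1" using \<sigma> s2 by (intro mult_left_mono) auto
    then show ?thesis unfolding \<kappa> b_def d_def by (simp add: power2_eq_square algebra_simps)
  qed
  have "\<kappa> * A1 + b * C1 \<le> d * \<rho>"
  proof (rule power2_le_imp_le)
    have "(\<kappa> * A1 + b * C1)\<^sup>2 + (\<kappa> * C1 - b * A1)\<^sup>2 = (\<kappa>\<^sup>2 + b\<^sup>2) * \<rho>\<^sup>2"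
      unfolding \<rho> by (simp add: power2_eq_square algebra_simps)
    then have "(\<kappa> * A1 + b * C1)\<^sup>2 \<le> (\<kappa>\<^sup>2 + b\<^sup>2) * \<rho>\<^sup>2" by (metis add_increasing2 order_refl zero_le_power2)
    also have "\<dots> \<le> d\<^sup>2 * \<rho>\<^sup>2" using bd by (intro mult_right_mono) auto
    finally show "(\<kappa> * A1 + b * C1)\<^sup>2 \<le> (d * \<rho>)\<^sup>2" by (simp add: power_mult_distrib)
  qed (use d0 \<rho> in auto)
  then have P: "\<sigma>\<^sup>2 / 4 * (\<rho> + C1) \<le> P"
    unfolding P_def b_def d_def by (simp add: algebra_simps add_divide_distrib)
  moreover have "0 \<le> \<sigma>\<^sup>2 / 4 * (\<rho> + C1)" using \<open>- C1 \<le> \<rho>\<close> by simp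
  ultimately have P0: "P \<ge> 0" by linarith
  have "\<sigma>\<^sup>2 / 4 * (\<rho> + C1) * R \<le> P * R" using P R0 by (intro mult_right_mono)
  moreover have "(\<rho> + C1) * R = A1\<^sup>2"
    unfolding R_def using \<rho>(1) by (simp add: power2_eq_square algebra_simps)
  ultimately have PR: "\<sigma>\<^sup>2 * A1\<^sup>2 \<le> 4 * (P * R)" by (simp add: mult.assoc)
  have "P * A2\<^sup>2 - \<sigma> * A1 * A2 * C2 + R * C2\<^sup>2 \<ge> 0"
  proof (cases "P = 0")
    case True
    then have "(\<sigma> * A1)\<^sup>2 \<le> 0" using PR by (simp add: power_mult_distrib)
    then have "\<sigma> * A1 = 0" by simp
    then show ?thesis using True R0 by auto
  next
    case False
    have "4 * P * (P * A2\<^sup>2 - \<sigma> * A1 * A2 * C2 + R * C2\<^sup>2)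
        = (2 * P * A2 - \<sigma> * A1 * C2)\<^sup>2 + (4 * (P * R) - \<sigma>\<^sup>2 * A1\<^sup>2) * C2\<^sup>2"
      by (simp add: power2_eq_square algebra_simps)
    also have "\<dots> \<ge> 0" using PR by simp
    finally show ?thesis using False P0 by (simp add: zero_le_mult_iff)
  qed
  then show ?thesis
    unfolding P_def R_def \<rho>_def[symmetric] by (simp add: algebra_simps)
qed

lemma trilinear_form_abs_le:
  fixes A1 A2 C1 C2 \<sigma> \<kappa> :: real
  assumes "0 \<le> \<sigma>" "\<sigma> \<le> 1" "\<kappa>\<^sup>2 = 1 - \<sigma>"
  shows "\<bar>\<kappa> * A1 * A2\<^sup>2 + \<sigma> * (C1 * A2\<^sup>2 / 2 + A1 * A2 * C2) + C1 * C2\<^sup>2\<bar>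
    \<le> sqrt (A1\<^sup>2 + C1\<^sup>2) * (A2\<^sup>2 + C2\<^sup>2)"
proof -
  have "\<kappa> * A1 * A2\<^sup>2 + \<sigma> * (C1 * A2\<^sup>2 / 2 + A1 * A2 * C2) + C1 * C2\<^sup>2
      \<le> sqrt (A1\<^sup>2 + C1\<^sup>2) * (A2\<^sup>2 + C2\<^sup>2)"
    using assms by (rule trilinear_form_le)
  moreover have "- (\<kappa> * A1 * A2\<^sup>2 + \<sigma> * (C1 * A2\<^sup>2 / 2 + A1 * A2 * C2) + C1 * C2\<^sup>2)
      \<le> sqrt (A1\<^sup>2 + C1\<^sup>2) * (A2\<^sup>2 + C2\<^sup>2)"
    using trilinear_form_le[OF assms, of "- A1" A2 "- C1" C2] by (simp add: algebra_simps)
  ultimately show ?thesis by (simp add: abs_le_iff)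
qed

text \<open>The third derivative of \<open>- ln z - ln (ln z + u)\<close>, where \<open>a = dz / z\<close>, \<open>w = ln z + u\<close> and
  \<open>c = dw / w\<close>.\<close>

lemma exp_barrier_third_derivative:
  fixes a c a' c' w :: real
  assumes w: "w > 0"
  shows "\<bar>2 * a' * (- (a' * a)) * (1 + 1 / w) - a'\<^sup>2 * (c / w) + 2 * c' * (- (a' * a / w) - c' * c)\<bar>
    \<le> 2 * sqrt (a\<^sup>2 * (1 + 1 / w) + c\<^sup>2) * (a'\<^sup>2 * (1 + 1 / w) + c'\<^sup>2)"
proof -
  \<comment> \<open>Scaling \<open>a\<close> and \<open>a'\<close> by \<open>k\<close> makes the
    local norm Euclidean. In the new variables \<sigma> is 1 / (1 + w) and \<kappa> is 1 /
    k.\<close>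
  define k where "k = sqrt (1 + 1 / w)"
  have k: "k > 0" "k\<^sup>2 = 1 + 1 / w" unfolding k_def using w by (auto intro: add_pos_pos)
  define \<sigma> where "\<sigma> = 1 - (1 / k)\<^sup>2"
  have k1: "k\<^sup>2 \<ge> 1" unfolding k using w by simp
  have \<sigma>: "0 \<le> \<sigma>" "\<sigma> \<le> 1" "(1 / k)\<^sup>2 = 1 - \<sigma>"
    unfolding \<sigma>_def using k1 k(1) by (auto simp: power_divide divide_le_eq)
  have s: "\<sigma> * k\<^sup>2 = 1 / w"
  proof -
    have "\<sigma> * k\<^sup>2 = k\<^sup>2 - 1" unfolding \<sigma>_def using k(1) by (simp add: power_divide left_diff_distrib)
    then show ?thesis using k(2) by simp
  qed
  have "2 * a' * (- (a' * a)) * (1 + 1 / w) - a'\<^sup>2 * (c / w) + 2 * c' * (- (a' * a / w) - c' * c)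
      = - 2 * (a * a'\<^sup>2 * k\<^sup>2 + (1 / w) * (c * a'\<^sup>2 / 2 + a * a' * c') + c * c'\<^sup>2)"
    unfolding k by (simp add: power2_eq_square algebra_simps)
  also have "\<dots> = - 2 * ((1 / k) * (a * k) * (a' * k)\<^sup>2 + \<sigma> * (c * (a' * k)\<^sup>2 / 2 + (a * k) * (a' * k) * c') + c * c'\<^sup>2)"
    unfolding s[symmetric] using k(1) by (simp add: power2_eq_square algebra_simps)
  also have "\<bar>\<dots>\<bar> \<le> 2 * (sqrt ((a * k)\<^sup>2 + c\<^sup>2) * ((a' * k)\<^sup>2 + c'\<^sup>2))"
    using trilinear_form_abs_le[OF \<sigma>, of "a * k" "a' * k" c c'] by (simp add: abs_mult)
  finally show ?thesis by (simp add: power_mult_distrib k mult.assoc)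
qed

text \<open>The third derivative of \<open>- ln (r\<^sup>2 - |x|\<^sup>2)\<close>, with \<open>s = r\<^sup>2 - |x|\<^sup>2\<close> and \<open>c = 2 \<langle>x, h\<rangle> / s\<close>.\<close>

lemma ball_barrier_third_derivative:
  fixes h v :: "'a::real_inner" and c c' s :: real
  assumes s: "s > 0"
  shows "\<bar>2 * (v \<bullet> v) / s * c + 2 * c' * (2 * (h \<bullet> v) / s + c' * c)\<bar>
    \<le> 2 * sqrt (2 * (h \<bullet> h) / s + c\<^sup>2) * (2 * (v \<bullet> v) / s + c'\<^sup>2)"
proof -
  define A where "A = sqrt (2 * (h \<bullet> h) / s)"
  define A' where "A' = sqrt (2 * (v \<bullet> v) / s)"
  have A: "A\<^sup>2 = 2 * (h \<bullet> h) / s" "A'\<^sup>2 = 2 * (v \<bullet> v) / s"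
    unfolding A_def A'_def using s by auto
  have "\<bar>2 * (h \<bullet> v) / s\<bar> \<le> A * A'"
  proof -
    have eq: "sqrt (2 * (z \<bullet> z) / s) = sqrt (2 / s) * norm z" for z :: 'a
      unfolding norm_eq_sqrt_inner by (simp flip: real_sqrt_mult)
    have "sqrt (2 / s) * sqrt (2 / s) = 2 / s" using s by simp
    then have "A * A' = 2 / s * (norm h * norm v)"
      unfolding A_def A'_def eq by (metis mult.assoc mult.left_commute)
    moreover have "\<bar>2 * (h \<bullet> v) / s\<bar> = 2 / s * \<bar>h \<bullet> v\<bar>" using s by (simp add: abs_mult)
    ultimately show ?thesis
      using Cauchy_Schwarz_ineq2[of h v] s by (simp only:) (intro mult_left_mono, auto)
  qed
  then have "\<bar>2 * c' * (2 * (h \<bullet> v) / s)\<bar> \<le> 2 * \<bar>c'\<bar> * (A * A')"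
    unfolding abs_mult[of "2 * c'"] abs_mult[of 2 c'] abs_numeral by (intro mult_left_mono) auto
  then have "\<bar>2 * (v \<bullet> v) / s * c + 2 * c' * (2 * (h \<bullet> v) / s + c' * c)\<bar>
      \<le> A'\<^sup>2 * \<bar>c\<bar> + 2 * \<bar>c'\<bar> * (A * A') + 2 * c'\<^sup>2 * \<bar>c\<bar>"
  proof -
    have "2 * (v \<bullet> v) / s * c + 2 * c' * (2 * (h \<bullet> v) / s + c' * c)
        = A'\<^sup>2 * c + 2 * c' * (2 * (h \<bullet> v) / s) + 2 * c'\<^sup>2 * c"
      unfolding A by (simp add: power2_eq_square algebra_simps)
    moreover have "\<bar>A'\<^sup>2 * c\<bar> = A'\<^sup>2 * \<bar>c\<bar>" "\<bar>2 * c'\<^sup>2 * c\<bar> = 2 * c'\<^sup>2 * \<bar>c\<bar>" by (auto simp: abs_mult)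
    moreover have "\<bar>x + y + z\<bar> \<le> X + Y + Z" if "\<bar>x\<bar> = X" "\<bar>y\<bar> \<le> Y" "\<bar>z\<bar> = Z" for x y z X Y Z :: real
      using that by linarith
    ultimately show ?thesis
      using \<open>\<bar>2 * c' * (2 * (h \<bullet> v) / s)\<bar> \<le> 2 * \<bar>c'\<bar> * (A * A')\<close> by (simp only:)
  qed
  \<comment> \<open>The ball piece is the extreme case \<sigma> = 1, \<kappa> = 0 of the same
    trilinear inequality.\<close>
  also have "\<dots> = 2 * (0 * A * A'\<^sup>2 + 1 * (\<bar>c\<bar> * A'\<^sup>2 / 2 + A * A' * \<bar>c'\<bar>) + \<bar>c\<bar> * \<bar>c'\<bar>\<^sup>2)"
    by (simp add: power2_eq_square algebra_simps)
  also have "\<dots> \<le> 2 * (sqrt (A\<^sup>2 + \<bar>c\<bar>\<^sup>2) * (A'\<^sup>2 + \<bar>c'\<bar>\<^sup>2))"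
    using trilinear_form_le[of 1 0 A A' "\<bar>c\<bar>" "\<bar>c'\<bar>"] by simp
  finally show ?thesis unfolding A by (simp add: mult.assoc)
qed

section \<open>Dikin ellipsoids and separation for the single pieces\<close>

lemma ln_le_half_diff_inverse:
  fixes u :: real
  assumes "u \<ge> 1"
  shows "ln u \<le> (u - 1 / u) / 2"
proof -
  have "(1 - 1 / 1) / 2 - ln 1 \<le> (u - 1 / u) / 2 - ln u"
  proof (rule DERIV_nonneg_imp_nondecreasing[OF assms])
    fix x :: real assume x: "1 \<le> x" "x \<le> u"
    have "((\<lambda>u. (u - 1 / u) / 2 - ln u) has_real_derivative (1 + 1 / (x * x)) / 2 - 1 / x) (at x)"
      using x by (auto intro!: derivative_eq_intros)
    moreover have "(1 + 1 / (x * x)) / 2 - 1 / x = (1 - 1 / x)\<^sup>2 / 2"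
      by (simp add: power2_eq_square algebra_simps)
    ultimately show "\<exists>y. ((\<lambda>u. (u - 1 / u) / 2 - ln u) has_real_derivative y) (at x) \<and> 0 \<le> y"
      by (intro exI[of _ "(1 - 1 / x)\<^sup>2 / 2"]) auto
  qed
  then show ?thesis by simp
qed

lemma ln_one_plus_upper:
  fixes a :: real
  assumes "a > - 1"
  shows "ln (1 + a) \<le> a - a\<^sup>2 / (2 * (1 + max a 0))"
proof (cases "a \<ge> 0")
  case True
  have "(1 + a - 1 / (1 + a)) / 2 = a - a\<^sup>2 / (2 * (1 + a))"
    using True by (simp add: field_simps power2_eq_square)
  then have "ln (1 + a) \<le> a - a\<^sup>2 / (2 * (1 + a))"
    using ln_le_half_diff_inverse[of "1 + a"] True by linarith
  then show ?thesis using True by (simp add: max_def)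
next
  case False
  then have "a \<le> 0" by simp
  have "(0::real) - 0\<^sup>2 / 2 - ln (1 + 0) \<le> a - a\<^sup>2 / 2 - ln (1 + a)"
  proof (rule DERIV_nonpos_imp_nonincreasing[OF \<open>a \<le> 0\<close>])
    fix x :: real assume x: "a \<le> x" "x \<le> 0"
    then have x1: "1 + x > 0" using assms by simp
    have "((\<lambda>a. a - a\<^sup>2 / 2 - ln (1 + a)) has_real_derivative - (x\<^sup>2 / (1 + x))) (at x)"
      using x1 by (auto intro!: derivative_eq_intros simp: field_simps power2_eq_square)
    then show "\<exists>y. ((\<lambda>a. a - a\<^sup>2 / 2 - ln (1 + a)) has_real_derivative y) (at x) \<and> y \<le> 0"
      using x1 by (intro exI[of _ "- (x\<^sup>2 / (1 + x))"]) auto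
  qed
  then show ?thesis using False by (simp add: max_def)
qed

lemma ln_one_plus_lower:
  fixes a :: real
  assumes "\<bar>a\<bar> < 1"
  shows "a - a\<^sup>2 / (2 * (1 - \<bar>a\<bar>)) \<le> ln (1 + a)"
proof (cases "a \<ge> 0")
  case True
  have "ln (1 + 0) - 0 + 0\<^sup>2 / (2::real) \<le> ln (1 + a) - a + a\<^sup>2 / 2"
  proof (rule DERIV_nonneg_imp_nondecreasing[OF True])
    fix x :: real assume x: "0 \<le> x" "x \<le> a"
    have "((\<lambda>a. ln (1 + a) - a + a\<^sup>2 / 2) has_real_derivative x\<^sup>2 / (1 + x)) (at x)"
      using x by (auto intro!: derivative_eq_intros simp: field_simps power2_eq_square)
    then show "\<exists>y. ((\<lambda>a. ln (1 + a) - a + a\<^sup>2 / 2) has_real_derivative y) (at x) \<and> 0 \<le> y"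
      using x by (intro exI[of _ "x\<^sup>2 / (1 + x)"]) auto
  qed
  moreover have "a\<^sup>2 / 2 \<le> a\<^sup>2 / (2 * (1 - \<bar>a\<bar>))"
    using assms True by (intro divide_left_mono) auto
  ultimately show ?thesis by simp
next
  case False
  define v where "v = 1 + a"
  have v: "0 < v" "v < 1" using False assms unfolding v_def by auto
  have "- ln v \<le> (1 / v - v) / 2"
    using ln_le_half_diff_inverse[of "1 / v"] v by (simp add: ln_div)
  moreover have "(1 / v - v) / 2 = (v - 1)\<^sup>2 / (2 * v) - (v - 1)"
    using v by (simp add: field_simps power2_eq_square)
  ultimately show ?thesis using False unfolding v_def by simp
qed

text \<open>The last expression is the value of \<open>w\<close> after the step. The nonlinearity
  costs at most \<open>a\<^sup>2 / (2 * (1 - \<bar>a\<bar>))\<close>; the hypothesis says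
  \<open>a\<^sup>2 < w * (1 - a\<^sup>2 - c\<^sup>2)\<close>, and the square of
  \<open>1 + c - \<bar>a\<bar>\<close> being nonnegative bounds
  \<open>1 - a\<^sup>2 - c\<^sup>2\<close> by
  \<open>2 * (1 - \<bar>a\<bar>) * (1 + c)\<close>.\<close>

lemma exp_barrier_dikin:
  fixes a c w :: real
  assumes w: "w > 0" and lt: "a\<^sup>2 * (1 + 1 / w) + c\<^sup>2 < 1"
  shows "\<bar>a\<bar> < 1" and "ln (1 + a) - a + w * (1 + c) > 0"
proof -
  have "a\<^sup>2 / w \<ge> 0" using w by simp
  then have "a\<^sup>2 + c\<^sup>2 < 1" using lt by (simp add: algebra_simps)
  then have "a\<^sup>2 < 1" "c\<^sup>2 < 1" using zero_le_power2[of a] zero_le_power2[of c] by linarith+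
  then show a1: "\<bar>a\<bar> < 1" by (simp add: abs_square_less_1)
  have c1: "\<bar>c\<bar> < 1" using \<open>c\<^sup>2 < 1\<close> by (simp add: abs_square_less_1)
  have m: "a - ln (1 + a) \<le> a\<^sup>2 / (2 * (1 - \<bar>a\<bar>))"
    using ln_one_plus_lower[OF a1] by simp
  have d: "1 - a\<^sup>2 - c\<^sup>2 > 0" using \<open>a\<^sup>2 + c\<^sup>2 < 1\<close> by simp
  have le: "1 - a\<^sup>2 - c\<^sup>2 \<le> 2 * (1 - \<bar>a\<bar>) * (1 + c)"
  proof -
    have "(1 + c - \<bar>a\<bar>)\<^sup>2 \<ge> 0" by simp
    then show ?thesis by (simp add: power2_eq_square algebra_simps)
  qed
  have wd: "a\<^sup>2 < w * (1 - a\<^sup>2 - c\<^sup>2)"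
    using lt w by (simp add: field_simps)
  have "w * (1 - a\<^sup>2 - c\<^sup>2) \<le> w * (2 * (1 - \<bar>a\<bar>) * (1 + c))"
    using le w by (intro mult_left_mono) auto
  then have "a\<^sup>2 < w * (1 + c) * (2 * (1 - \<bar>a\<bar>))" using wd by (simp add: mult_ac)
  then have "a\<^sup>2 / (2 * (1 - \<bar>a\<bar>)) < w * (1 + c)" using a1 by (simp add: pos_divide_less_eq)
  then show "ln (1 + a) - a + w * (1 + c) > 0" using m by simp
qed

text \<open>Hypothesis \<open>c\<close> says that \<open>w\<close> is nonnegative at the other end.
  The delicate part of the norm is \<open>y = \<bar>a\<bar> / sqrt w\<close>, which is unbounded for
  small \<open>w\<close>; but concavity of \<open>ln\<close> forces
  \<open>1 + c \<ge> y\<^sup>2 / (2 * k)\<close>, so a large \<open>y\<close> is paid for by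
  \<open>- c\<close>. The pieces add up to 20/9 + 1/144, below 12/5.\<close>

lemma exp_barrier_separation:
  fixes a c w :: real
  assumes w: "w > 0" and a: "a > - 1" and c: "(1 + c) * w \<ge> a - ln (1 + a)"
  shows "- a - c \<le> 2" and "- a - c + 1 / 9 * sqrt (a\<^sup>2 * (1 + 1 / w) + c\<^sup>2) \<le> 6 / 5 * 2"
proof -
  define k where "k = 1 + max a 0"
  have k: "k \<ge> 1" unfolding k_def by simp
  have m: "a - ln (1 + a) \<ge> a\<^sup>2 / (2 * k)" using ln_one_plus_upper[OF a] unfolding k_def by simp
  have "a\<^sup>2 / (2 * k) \<ge> 0" using k by simp
  then have c1: "c \<ge> - 1" using c m w by (smt (verit) mult_neg_pos)
  then show "- a - c \<le> 2" using a by simp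
  define y where "y = sqrt (a\<^sup>2 / w)"
  have y: "y\<^sup>2 = a\<^sup>2 / w" "y \<ge> 0" unfolding y_def using w by auto
  have cy: "1 + c \<ge> y\<^sup>2 / (2 * k)"
  proof -
    have "a\<^sup>2 / (2 * k) \<le> (1 + c) * w" using c m by linarith
    then have "a\<^sup>2 / (2 * k) / w \<le> 1 + c" using w by (simp only: pos_divide_le_eq)
    then show ?thesis unfolding y by (simp add: field_simps)
  qed
  have "sqrt (a\<^sup>2 * (1 + 1 / w) + c\<^sup>2) \<le> \<bar>a\<bar> + y + \<bar>c\<bar>"
  proof (rule real_le_lsqrt)
    have "a\<^sup>2 * (1 + 1 / w) + c\<^sup>2 = \<bar>a\<bar>\<^sup>2 + y\<^sup>2 + \<bar>c\<bar>\<^sup>2" unfolding y by (simp add: algebra_simps)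
    also have "\<dots> \<le> (\<bar>a\<bar> + y + \<bar>c\<bar>)\<^sup>2"
      using y(2) by (simp add: power2_sum algebra_simps)
    finally show "a\<^sup>2 * (1 + 1 / w) + c\<^sup>2 \<le> (\<bar>a\<bar> + y + \<bar>c\<bar>)\<^sup>2" .
  qed (use y in auto)
  moreover have "- c + \<bar>c\<bar> / 9 \<le> 10 / 9 - 8 / 9 * (y\<^sup>2 / (2 * k))"
  proof -
    have "- c + \<bar>c\<bar> / 9 \<le> 10 / 9 - 8 / 9 * (1 + c)" using c1 by (auto simp: abs_if field_simps)
    moreover have "8 / 9 * (y\<^sup>2 / (2 * k)) \<le> 8 / 9 * (1 + c)" using cy by (intro mult_left_mono) auto
    ultimately show ?thesis by linarith
  qed
  \<comment> \<open>Weighted arithmetic-geometric mean, balanced at \<open>k = 8 * y\<close> so that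
    the quadratic term matches the gain from \<open>- c\<close>.\<close>
  moreover have "y / 9 \<le> 8 / 9 * (y\<^sup>2 / (2 * k)) + k / 144"
  proof -
    have "(8 * y - k)\<^sup>2 \<ge> 0" by simp
    then have "16 * (y * k) \<le> 64 * y\<^sup>2 + k\<^sup>2" by (simp add: power2_eq_square algebra_simps)
    then show ?thesis using k by (simp add: field_simps power2_eq_square)
  qed
  moreover have "- a + \<bar>a\<bar> / 9 + k / 144 \<le> 10 / 9 + 1 / 144"
    unfolding k_def using a by (auto simp: abs_if max_def field_simps)
  ultimately show "- a - c + 1 / 9 * sqrt (a\<^sup>2 * (1 + 1 / w) + c\<^sup>2) \<le> 6 / 5 * 2" by linarith
qed

text \<open>The hypothesis is \<open>h \<bullet> h < s * (1 - c\<^sup>2) / 2\<close> and the claim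
  is \<open>s * c + h \<bullet> h < s\<close>; between them lies only the square of
  \<open>1 - c\<close>.\<close>

lemma ball_barrier_dikin:
  fixes x h :: "'a::real_inner" and r :: real
  defines "s \<equiv> r\<^sup>2 - x \<bullet> x"
  assumes s: "s > 0" and lt: "2 * (h \<bullet> h) / s + (2 * (x \<bullet> h) / s)\<^sup>2 < 1"
  shows "(x + h) \<bullet> (x + h) < r\<^sup>2"
proof -
  define c where "c = 2 * (x \<bullet> h) / s"
  have "h \<bullet> h = s * (2 * (h \<bullet> h) / s) / 2" using s by simp
  also have "\<dots> < s * (1 - c\<^sup>2) / 2"
    using lt s unfolding c_def by (intro divide_strict_right_mono mult_strict_left_mono) linarith+
  finally have "h \<bullet> h < s * (1 - c\<^sup>2) / 2" .
  moreover have "2 * (x \<bullet> h) = s * c" unfolding c_def using s by simp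
  moreover have "s * (1 - c\<^sup>2) / 2 + s * c \<le> s"
  proof -
    have "s * (1 - c)\<^sup>2 \<ge> 0" using s by simp
    then show ?thesis by (simp add: power2_eq_square field_simps)
  qed
  moreover have "(x + h) \<bullet> (x + h) = x \<bullet> x + 2 * (x \<bullet> h) + h \<bullet> h"
    unfolding inner_add_left inner_add_right using inner_commute[of h x] by linarith
  moreover have "r\<^sup>2 = s + x \<bullet> x" unfolding s_def by simp
  ultimately show ?thesis by linarith
qed

text \<open>With \<open>b\<close> the squared distance divided by \<open>s\<close>, feasibility of
  \<open>y\<close> reads \<open>c + b \<le> 1\<close>. The squared norm
  \<open>2 * b + c\<^sup>2\<close> is then at most \<open>(2 - c)\<^sup>2\<close>, and
  \<open>c + (2 - c) / 9\<close> is at most 10/9.\<close>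

lemma ball_barrier_separation:
  fixes x y :: "'a::real_inner" and r :: real
  defines "s \<equiv> r\<^sup>2 - x \<bullet> x"
  assumes s: "s > 0" and y: "y \<bullet> y \<le> r\<^sup>2"
  defines "c \<equiv> 2 * (x \<bullet> (y - x)) / s"
  shows "c \<le> 1" and "c + 1 / 9 * sqrt (2 * ((y - x) \<bullet> (y - x)) / s + c\<^sup>2) \<le> 6 / 5"
proof -
  define b where "b = ((y - x) \<bullet> (y - x)) / s"
  have b0: "b \<ge> 0" unfolding b_def using s by simp
  have "2 * (x \<bullet> (y - x)) + (y - x) \<bullet> (y - x) \<le> s"
    unfolding s_def using y by (simp add: inner_diff_left inner_diff_right inner_commute[of y x])
  then have "(2 * (x \<bullet> (y - x)) + (y - x) \<bullet> (y - x)) / s \<le> 1" using s by simp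
  then have cb: "c + b \<le> 1" unfolding c_def b_def by (simp add: add_divide_distrib)
  then show c1: "c \<le> 1" using b0 by simp
  have "sqrt (2 * ((y - x) \<bullet> (y - x)) / s + c\<^sup>2) \<le> 2 - c"
  proof (rule real_le_lsqrt)
    have "2 * ((y - x) \<bullet> (y - x)) / s + c\<^sup>2 = 2 * b + c\<^sup>2" unfolding b_def by simp
    also have "\<dots> \<le> 2 * (1 - c) + c\<^sup>2" using cb by simp
    also have "\<dots> \<le> (2 - c)\<^sup>2" using c1 by (simp add: power2_eq_square algebra_simps)
    finally show "2 * ((y - x) \<bullet> (y - x)) / s + c\<^sup>2 \<le> (2 - c)\<^sup>2" .
  qed (use c1 in auto)
  then show "c + 1 / 9 * sqrt (2 * ((y - x) \<bullet> (y - x)) / s + c\<^sup>2) \<le> 6 / 5" using c1 by simp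
qed

lemma sqrt_sum_le_sum_sqrt:
  assumes "\<And>i. i \<in> I \<Longrightarrow> f i \<ge> 0"
  shows "sqrt (\<Sum>i\<in>I. f i) \<le> (\<Sum>i\<in>I. sqrt (f i))"
  using assms
proof (induction I rule: infinite_finite_induct)
  case (insert i I)
  have "sqrt (f i + (\<Sum>i\<in>I. f i)) \<le> sqrt (f i) + sqrt (\<Sum>i\<in>I. f i)"
    using insert.prems by (intro sqrt_add_le_add_sqrt sum_nonneg) auto
  also have "\<dots> \<le> sqrt (f i) + (\<Sum>i\<in>I. sqrt (f i))"
    using insert by simp
  finally show ?case using insert.hyps by simp
qed auto

section \<open>The barrier of the program\<close>

locale geometric_program =
  fixes \<omega> :: "'k::finite \<Rightarrow> real ^ 'n::finite" and q :: "real ^ 'k"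
    and \<theta> :: "real ^ 'n" and \<delta> \<phi>\<^sub>0 :: real
  assumes two: "card (range \<omega>) \<ge> 2"
    and \<theta>: "\<theta> \<in> convex hull (range \<omega>)"
    and q: "\<forall>i. q $ i > 0"
    and \<delta>: "0 < \<delta>" "\<delta> < 1"
    and \<phi>: "0 < \<phi>\<^sub>0" "\<phi>\<^sub>0 \<le> facet_gap (range \<omega>)"
begin

abbreviation "E \<equiv> E_space \<omega> \<theta>"
abbreviation "\<Psi> \<equiv> barrier \<omega> q \<theta> \<delta> \<phi>\<^sub>0"
definition "R = radius TYPE('n) q \<delta> \<phi>\<^sub>0"
definition "\<nu> = nu TYPE('k)"

abbreviation X :: "('n, 'k) point \<Rightarrow> real ^ 'n" where "X p \<equiv> fst p"
abbreviation Z :: "('n, 'k) point \<Rightarrow> 'k \<Rightarrow> real" where "Z p i \<equiv> fst (snd p) $ i"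
abbreviation T :: "('n, 'k) point \<Rightarrow> real" where "T p \<equiv> snd (snd p)"

definition w :: "'k \<Rightarrow> ('n, 'k) point \<Rightarrow> real" where
  "w i p = ln (Z p i) - (\<omega> i - \<theta>) \<bullet> X p + T p - ln (q $ i)"
definition slack_t :: "('n, 'k) point \<Rightarrow> real" where "slack_t p = t_max q - T p"
definition slack_z :: "('n, 'k) point \<Rightarrow> real" where "slack_z p = 1 - (\<Sum>i\<in>UNIV. Z p i)"
definition slack_x :: "('n, 'k) point \<Rightarrow> real" where "slack_x p = R\<^sup>2 - X p \<bullet> X p"

text \<open>The derivatives of \<open>z\<^sub>i\<close>, \<open>w\<^sub>i\<close> and the slacks in direction \<open>h\<close>, relative to their values (for a
  slack, up to sign).  All derivatives of the barrier are polynomials in these and \<open>1/w\<^sub>i\<close>.\<close>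

definition \<alpha> :: "'k \<Rightarrow> ('n, 'k) point \<Rightarrow> ('n, 'k) point \<Rightarrow> real" where
  "\<alpha> i p h = Z h i / Z p i"
definition \<gamma> :: "'k \<Rightarrow> ('n, 'k) point \<Rightarrow> ('n, 'k) point \<Rightarrow> real" where
  "\<gamma> i p h = (\<alpha> i p h - (\<omega> i - \<theta>) \<bullet> X h + T h) / w i p"
definition \<tau> :: "('n, 'k) point \<Rightarrow> ('n, 'k) point \<Rightarrow> real" where
  "\<tau> p h = T h / slack_t p"
definition \<zeta> :: "('n, 'k) point \<Rightarrow> ('n, 'k) point \<Rightarrow> real" where
  "\<zeta> p h = (\<Sum>i\<in>UNIV. Z h i) / slack_z p"
definition \<xi> :: "('n, 'k) point \<Rightarrow> ('n, 'k) point \<Rightarrow> real" where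
  "\<xi> p h = 2 * (X p \<bullet> X h) / slack_x p"

definition pos :: "('n, 'k) point \<Rightarrow> bool" where
  "pos p \<longleftrightarrow> (\<forall>i. Z p i > 0 \<and> w i p > 0) \<and> slack_t p > 0 \<and> slack_z p > 0 \<and> slack_x p > 0"

text \<open>\<open>D1 p v\<close> and \<open>D2 p h v\<close> are the first and second derivatives
  of the barrier as forms, and \<open>D3 p v h\<close> is the third with \<open>v\<close> twice and
  \<open>h\<close> once. \<open>G\<close> and \<open>Hop\<close> represent the first two through the
  ambient inner product.\<close>

definition D1 :: "('n, 'k) point \<Rightarrow> ('n, 'k) point \<Rightarrow> real" where
  "D1 p v = (\<Sum>i\<in>UNIV. - \<alpha> i p v - \<gamma> i p v) + \<tau> p v + \<zeta> p v + \<xi> p v"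

definition D2 :: "('n, 'k) point \<Rightarrow> ('n, 'k) point \<Rightarrow> ('n, 'k) point \<Rightarrow> real" where
  "D2 p h v = (\<Sum>i\<in>UNIV. \<alpha> i p v * \<alpha> i p h * (1 + 1 / w i p) + \<gamma> i p v * \<gamma> i p h)
     + \<tau> p v * \<tau> p h + \<zeta> p v * \<zeta> p h + (2 * (X v \<bullet> X h) / slack_x p + \<xi> p v * \<xi> p h)"

definition D3 :: "('n, 'k) point \<Rightarrow> ('n, 'k) point \<Rightarrow> ('n, 'k) point \<Rightarrow> real" where
  "D3 p v h = (\<Sum>i\<in>UNIV. 2 * \<alpha> i p v * (- (\<alpha> i p v * \<alpha> i p h)) * (1 + 1 / w i p)
         - (\<alpha> i p v)\<^sup>2 * (\<gamma> i p h / w i p)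
         + 2 * \<gamma> i p v * (- (\<alpha> i p v * \<alpha> i p h / w i p) - \<gamma> i p v * \<gamma> i p h))
     + 2 * \<tau> p v * (\<tau> p v * \<tau> p h) + 2 * \<zeta> p v * (\<zeta> p v * \<zeta> p h)
     + (2 * (X v \<bullet> X v) / slack_x p * \<xi> p h
         + 2 * \<xi> p v * (2 * (X h \<bullet> X v) / slack_x p + \<xi> p v * \<xi> p h))"

definition G :: "('n, 'k) point \<Rightarrow> ('n, 'k) point" where
  "G p = ((\<Sum>i\<in>UNIV. (1 / w i p) *\<^sub>R (\<omega> i - \<theta>)) + (2 / slack_x p) *\<^sub>R X p,
     (\<chi> i. - (1 + 1 / w i p) / Z p i + 1 / slack_z p),
     - (\<Sum>i\<in>UNIV. 1 / w i p) + 1 / slack_t p)"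

definition Hop :: "('n, 'k) point \<Rightarrow> ('n, 'k) point \<Rightarrow> ('n, 'k) point" where
  "Hop p h = (- (\<Sum>i\<in>UNIV. (\<gamma> i p h / w i p) *\<^sub>R (\<omega> i - \<theta>)) + (2 / slack_x p) *\<^sub>R X h
       + (2 * \<xi> p h / slack_x p) *\<^sub>R X p,
     (\<chi> i. (\<alpha> i p h * (1 + 1 / w i p) + \<gamma> i p h / w i p) / Z p i + \<zeta> p h / slack_z p),
     (\<Sum>i\<in>UNIV. \<gamma> i p h / w i p) + \<tau> p h / slack_t p)"

lemma inner_point: "p \<bullet> v = X p \<bullet> X v + (\<Sum>i\<in>UNIV. Z p i * Z v i) + T p * T v"
  for p v :: "('n, 'k) point"
  by (simp add: inner_prod_def inner_vec_def)

lemma inner_G: "G p \<bullet> v = D1 p v"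
proof -
  have "G p \<bullet> v = (\<Sum>i\<in>UNIV. (1 / w i p) * ((\<omega> i - \<theta>) \<bullet> X v)) + \<xi> p v
     + (\<Sum>i\<in>UNIV. - (1 + 1 / w i p) / Z p i * Z v i) + (\<Sum>i\<in>UNIV. Z v i) / slack_z p
     + - (\<Sum>i\<in>UNIV. 1 / w i p * T v) + T v / slack_t p"
    unfolding inner_point G_def \<xi>_def
    by (simp add: inner_add_left inner_sum_left distrib_right sum.distrib sum_distrib_right sum_divide_distrib left_diff_distrib)
  also have "\<dots> = (\<Sum>i\<in>UNIV. (1 / w i p) * ((\<omega> i - \<theta>) \<bullet> X v) + - (1 + 1 / w i p) / Z p i * Z v i - 1 / w i p * T v)
     + \<tau> p v + \<zeta> p v + \<xi> p v"
    unfolding \<tau>_def \<zeta>_def by (simp add: sum.distrib sum_subtractf)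
  also have "(\<Sum>i\<in>UNIV. (1 / w i p) * ((\<omega> i - \<theta>) \<bullet> X v) + - (1 + 1 / w i p) / Z p i * Z v i - 1 / w i p * T v)
      = (\<Sum>i\<in>UNIV. - \<alpha> i p v - \<gamma> i p v)"
    unfolding \<gamma>_def \<alpha>_def by (intro sum.cong) (auto simp: add_divide_distrib diff_divide_distrib algebra_simps)
  finally show ?thesis unfolding D1_def by simp
qed

lemma inner_Hop: "Hop p h \<bullet> v = D2 p h v"
proof -
  have "Hop p h \<bullet> v = - (\<Sum>i\<in>UNIV. \<gamma> i p h / w i p * ((\<omega> i - \<theta>) \<bullet> X v)) + (2 / slack_x p) * (X h \<bullet> X v)
     + \<xi> p h * \<xi> p v
     + (\<Sum>i\<in>UNIV. (\<alpha> i p h * (1 + 1 / w i p) + \<gamma> i p h / w i p) / Z p i * Z v i) + \<zeta> p h * \<zeta> p v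
     + (\<Sum>i\<in>UNIV. \<gamma> i p h / w i p * T v) + \<tau> p h * \<tau> p v"
    unfolding inner_point Hop_def \<xi>_def[of p v] \<zeta>_def[of p v] \<tau>_def[of p v]
    by (simp add: inner_add_left inner_diff_left inner_sum_left distrib_right sum.distrib sum_distrib_right sum_divide_distrib sum_distrib_left)
  also have "\<dots> = (\<Sum>i\<in>UNIV. - (\<gamma> i p h / w i p * ((\<omega> i - \<theta>) \<bullet> X v))
        + (\<alpha> i p h * (1 + 1 / w i p) + \<gamma> i p h / w i p) / Z p i * Z v i + \<gamma> i p h / w i p * T v)
     + (2 / slack_x p) * (X h \<bullet> X v) + \<xi> p h * \<xi> p v + \<zeta> p h * \<zeta> p v + \<tau> p h * \<tau> p v"
    by (simp add: sum.distrib sum_negf sum_subtractf)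
  also have "(\<Sum>i\<in>UNIV. - (\<gamma> i p h / w i p * ((\<omega> i - \<theta>) \<bullet> X v))
        + (\<alpha> i p h * (1 + 1 / w i p) + \<gamma> i p h / w i p) / Z p i * Z v i + \<gamma> i p h / w i p * T v)
     = (\<Sum>i\<in>UNIV. \<alpha> i p v * \<alpha> i p h * (1 + 1 / w i p) + \<gamma> i p v * \<gamma> i p h)"
    unfolding \<gamma>_def[of _ p v] \<alpha>_def[of _ p v]
    by (intro sum.cong) (auto simp: add_divide_distrib diff_divide_distrib algebra_simps)
  finally show ?thesis unfolding D2_def by (simp add: inner_commute[of "X v" "X h"] mult.commute)
qed

lemma D2_sym: "D2 p h v = D2 p v h"
  unfolding D2_def by (simp add: inner_commute mult.commute mult.left_commute)

section \<open>Derivatives at a strictly feasible point\<close>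

context
  fixes p :: "('n, 'k) point"
  assumes p: "pos p"
begin

lemma pos_simps: "Z p i > 0" "w i p > 0" "slack_t p > 0" "slack_z p > 0" "slack_x p > 0"
  using p unfolding pos_def by auto

lemma Z_deriv: "((\<lambda>p. Z p i) has_derivative (\<lambda>h. Z h i)) (at p)"
  by (intro bounded_linear_imp_has_derivative bounded_linear_compose[OF bounded_linear_vec_nth]
      bounded_linear_compose[OF bounded_linear_fst bounded_linear_snd])

lemma T_deriv: "((\<lambda>p. T p) has_derivative (\<lambda>h. T h)) (at p)"
  by (intro bounded_linear_imp_has_derivative bounded_linear_compose[OF bounded_linear_snd bounded_linear_snd])

lemma X_deriv: "((\<lambda>p. X p) has_derivative (\<lambda>h. X h)) (at p)"
  by (intro bounded_linear_imp_has_derivative bounded_linear_fst)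

lemma aX_deriv: "((\<lambda>p. v \<bullet> X p) has_derivative (\<lambda>h. v \<bullet> X h)) (at p)"
  by (intro bounded_linear_imp_has_derivative bounded_linear_compose[OF bounded_linear_inner_right bounded_linear_fst])

lemma w_deriv: "((\<lambda>p. w i p) has_derivative (\<lambda>h. w i p * \<gamma> i p h)) (at p)"
proof -
  have "((\<lambda>p. ln (Z p i)) has_derivative (\<lambda>h. Z h i * (1 / Z p i))) (at p)"
    by (rule DERIV_compose_FDERIV[OF DERIV_ln_divide Z_deriv]) (rule pos_simps)
  then have "((\<lambda>p. w i p) has_derivative (\<lambda>h. Z h i * (1 / Z p i) - (\<omega> i - \<theta>) \<bullet> X h + T h - 0)) (at p)"
    unfolding w_def by (intro has_derivative_diff has_derivative_add aX_deriv T_deriv has_derivative_const)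
  moreover have "Z h i * (1 / Z p i) - (\<omega> i - \<theta>) \<bullet> X h + T h - 0 = w i p * \<gamma> i p h" for h
    unfolding \<gamma>_def \<alpha>_def using pos_simps(2)[of i] by simp
  ultimately show ?thesis by simp
qed

lemma inv_w_deriv: "((\<lambda>p. 1 / w i p) has_derivative (\<lambda>h. - (\<gamma> i p h / w i p))) (at p)"
proof -
  have "((\<lambda>x. 1 / x) has_real_derivative - (1 / (w i p)\<^sup>2)) (at (w i p))"
    using pos_simps(2)[of i] by (auto intro!: derivative_eq_intros simp: power2_eq_square)
  from DERIV_compose_FDERIV[OF this w_deriv] show ?thesis
    using pos_simps(2)[of i] by (simp add: power2_eq_square)
qed

lemma \<alpha>_deriv: "((\<lambda>p. \<alpha> i p v) has_derivative (\<lambda>h. - (\<alpha> i p v * \<alpha> i p h))) (at p)"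
proof -
  have "((\<lambda>x. Z v i / x) has_real_derivative - (Z v i / (Z p i)\<^sup>2)) (at (Z p i))"
    using pos_simps(1)[of i] by (auto intro!: derivative_eq_intros simp: power2_eq_square)
  from DERIV_compose_FDERIV[OF this Z_deriv] show ?thesis
    unfolding \<alpha>_def by (simp add: power2_eq_square mult.commute)
qed

lemma \<gamma>_deriv: "((\<lambda>p. \<gamma> i p v) has_derivative (\<lambda>h. - (\<alpha> i p v * \<alpha> i p h / w i p) - \<gamma> i p v * \<gamma> i p h)) (at p)"
proof -
  define c where "c = - ((\<omega> i - \<theta>) \<bullet> X v) + T v"
  have eq: "\<gamma> i p v = (\<alpha> i p v + c) * (1 / w i p)" for p
    unfolding \<gamma>_def c_def by simp
  have "((\<lambda>p. (\<alpha> i p v + c) * (1 / w i p)) has_derivative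
      (\<lambda>h. (\<alpha> i p v + c) * (- (\<gamma> i p h / w i p)) + (- (\<alpha> i p v * \<alpha> i p h) + 0) * (1 / w i p))) (at p)"
    by (intro has_derivative_mult has_derivative_add has_derivative_const \<alpha>_deriv inv_w_deriv)
  then show ?thesis unfolding eq[symmetric]
    by (rule has_derivative_eq_rhs) (simp add: eq[of p] fun_eq_iff)
qed

lemma slack_t_deriv: "(slack_t has_derivative (\<lambda>h. - T h)) (at p)"
  unfolding slack_t_def using has_derivative_diff[OF has_derivative_const T_deriv] by simp

lemma slack_z_deriv: "(slack_z has_derivative (\<lambda>h. - (\<Sum>i\<in>UNIV. Z h i))) (at p)"
  unfolding slack_z_def using has_derivative_diff[OF has_derivative_const has_derivative_sum[OF Z_deriv]] by simp

lemma slack_x_deriv: "(slack_x has_derivative (\<lambda>h. - (2 * (X p \<bullet> X h)))) (at p)"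
  unfolding slack_x_def
  using has_derivative_diff[OF has_derivative_const has_derivative_inner[OF X_deriv X_deriv]]
  by (rule has_derivative_eq_rhs) (simp add: inner_commute)

lemma divide_deriv:
  fixes s :: "('n, 'k) point \<Rightarrow> real" and c :: real
  assumes "(s has_derivative s') (at p)" "s p > 0"
  shows "((\<lambda>p. c / s p) has_derivative (\<lambda>h. c / s p * (- s' h / s p))) (at p)"
proof -
  have "((\<lambda>x. c / x) has_real_derivative - (c / (s p)\<^sup>2)) (at (s p))"
    using assms(2) by (auto intro!: derivative_eq_intros simp: power2_eq_square)
  from DERIV_compose_FDERIV[OF this assms(1)] show ?thesis
    by (rule has_derivative_eq_rhs) (simp add: power2_eq_square fun_eq_iff)
qed

lemma \<tau>_deriv: "((\<lambda>p. \<tau> p v) has_derivative (\<lambda>h. \<tau> p v * \<tau> p h)) (at p)"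
  using divide_deriv[OF slack_t_deriv pos_simps(3)] unfolding \<tau>_def by simp

lemma \<zeta>_deriv: "((\<lambda>p. \<zeta> p v) has_derivative (\<lambda>h. \<zeta> p v * \<zeta> p h)) (at p)"
  using divide_deriv[OF slack_z_deriv pos_simps(4)] unfolding \<zeta>_def by simp

lemma inv_slack_x_deriv: "((\<lambda>p. c / slack_x p) has_derivative (\<lambda>h. c / slack_x p * \<xi> p h)) (at p)"
  using divide_deriv[OF slack_x_deriv pos_simps(5)] unfolding \<xi>_def by simp

lemma \<xi>_deriv: "((\<lambda>p. \<xi> p v) has_derivative (\<lambda>h. 2 * (X h \<bullet> X v) / slack_x p + \<xi> p v * \<xi> p h)) (at p)"
proof -
  have eq: "\<xi> p v = (X v \<bullet> X p) * (2 / slack_x p)" for p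
    unfolding \<xi>_def by (simp add: inner_commute)
  have "((\<lambda>p. (X v \<bullet> X p) * (2 / slack_x p)) has_derivative
      (\<lambda>h. (X v \<bullet> X p) * (2 / slack_x p * \<xi> p h) + (X v \<bullet> X h) * (2 / slack_x p))) (at p)"
    by (intro has_derivative_mult aX_deriv inv_slack_x_deriv)
  then show ?thesis unfolding eq[symmetric]
    by (rule has_derivative_eq_rhs) (simp add: eq[of p] fun_eq_iff inner_commute mult.commute mult.left_commute)
qed

lemma ln_deriv:
  fixes s :: "('n, 'k) point \<Rightarrow> real"
  assumes "(s has_derivative s') (at p)" "s p > 0"
  shows "((\<lambda>p. ln (s p)) has_derivative (\<lambda>h. s' h / s p)) (at p)"
  using DERIV_compose_FDERIV[OF DERIV_ln_divide[OF assms(2)] assms(1)] by simp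

lemma barrier_eq:
  "\<Psi> = (\<lambda>p. - (\<Sum>i\<in>UNIV. ln (Z p i)) - (\<Sum>i\<in>UNIV. ln (w i p)) - ln (slack_t p) - ln (slack_z p) - ln (slack_x p))"
  unfolding barrier_def w_def slack_t_def slack_z_def slack_x_def R_def
  by (simp add: fun_eq_iff split_def power2_norm_eq_inner)

lemma barrier_deriv: "(\<Psi> has_derivative (\<lambda>h. G p \<bullet> h)) (at p)"
proof -
  have "(\<Psi> has_derivative (\<lambda>h. - (\<Sum>i\<in>UNIV. Z h i / Z p i) - (\<Sum>i\<in>UNIV. w i p * \<gamma> i p h / w i p)
      - (- T h) / slack_t p - (- (\<Sum>i\<in>UNIV. Z h i)) / slack_z p - (- (2 * (X p \<bullet> X h))) / slack_x p)) (at p)"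
    unfolding barrier_eq
    by (intro has_derivative_diff has_derivative_minus has_derivative_sum ln_deriv Z_deriv w_deriv
        slack_t_deriv slack_z_deriv slack_x_deriv pos_simps)
  then show ?thesis
    unfolding inner_G D1_def
    by (rule has_derivative_eq_rhs)
      (use pos_simps in \<open>simp add: fun_eq_iff \<alpha>_def \<tau>_def \<zeta>_def \<xi>_def sum_subtractf sum_negf less_imp_neq[OF pos_simps(2), symmetric]\<close>)
qed

lemma D1_deriv: "((\<lambda>p. D1 p v) has_derivative (\<lambda>h. D2 p h v)) (at p)"
proof -
  have "((\<lambda>p. D1 p v) has_derivative (\<lambda>h. (\<Sum>i\<in>UNIV. - (- (\<alpha> i p v * \<alpha> i p h))
      - (- (\<alpha> i p v * \<alpha> i p h / w i p) - \<gamma> i p v * \<gamma> i p h))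
      + \<tau> p v * \<tau> p h + \<zeta> p v * \<zeta> p h + (2 * (X h \<bullet> X v) / slack_x p + \<xi> p v * \<xi> p h))) (at p)"
    unfolding D1_def
    by (intro has_derivative_add has_derivative_diff has_derivative_minus has_derivative_sum
        \<alpha>_deriv \<gamma>_deriv \<tau>_deriv \<zeta>_deriv \<xi>_deriv)
  then show ?thesis
    unfolding D2_def by (rule has_derivative_eq_rhs) (simp add: fun_eq_iff inner_commute algebra_simps)
qed

text \<open>Paired with a basis vector, \<open>G\<close> is \<open>D1\<close> in that direction, so
  the vector-valued claim reduces to \<open>D1_deriv\<close>.\<close>

lemma G_deriv: "(G has_derivative Hop p) (at p)"
proof -
  have "\<forall>b\<in>Basis. ((\<lambda>p. G p \<bullet> b) has_derivative (\<lambda>h. Hop p h \<bullet> b)) (at p)"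
    unfolding inner_G inner_Hop using D1_deriv by blast
  then show ?thesis using has_derivative_componentwise_within by blast
qed

lemma D2_deriv: "((\<lambda>p. D2 p v v) has_derivative (\<lambda>h. D3 p v h)) (at p)"
proof -
  have "((\<lambda>p. D2 p v v) has_derivative (\<lambda>h. (\<Sum>i\<in>UNIV.
      ((\<alpha> i p v * \<alpha> i p v) * (0 + - (\<gamma> i p h / w i p))
        + (\<alpha> i p v * (- (\<alpha> i p v * \<alpha> i p h)) + (- (\<alpha> i p v * \<alpha> i p h)) * \<alpha> i p v) * (1 + 1 / w i p))
      + (\<gamma> i p v * (- (\<alpha> i p v * \<alpha> i p h / w i p) - \<gamma> i p v * \<gamma> i p h)
        + (- (\<alpha> i p v * \<alpha> i p h / w i p) - \<gamma> i p v * \<gamma> i p h) * \<gamma> i p v))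
      + (\<tau> p v * (\<tau> p v * \<tau> p h) + (\<tau> p v * \<tau> p h) * \<tau> p v)
      + (\<zeta> p v * (\<zeta> p v * \<zeta> p h) + (\<zeta> p v * \<zeta> p h) * \<zeta> p v)
      + (2 * (X v \<bullet> X v) / slack_x p * \<xi> p h
        + (\<xi> p v * (2 * (X h \<bullet> X v) / slack_x p + \<xi> p v * \<xi> p h)
          + (2 * (X h \<bullet> X v) / slack_x p + \<xi> p v * \<xi> p h) * \<xi> p v)))) (at p)"
    unfolding D2_def
    by (intro has_derivative_add has_derivative_mult has_derivative_sum has_derivative_const
        \<alpha>_deriv \<gamma>_deriv \<tau>_deriv \<zeta>_deriv \<xi>_deriv inv_w_deriv inv_slack_x_deriv)
  then show ?thesis
    unfolding D3_def by (rule has_derivative_eq_rhs) (simp add: fun_eq_iff power2_eq_square algebra_simps)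
qed

end

section \<open>Domain, definiteness and self-concordance of the whole barrier\<close>

definition D :: "('n, 'k) point set" where "D = {p \<in> E. pos p}"

text \<open>Nonstrict slacks admit the comparison point for optimality, at which every
  \<open>w i\<close> and \<open>slack_z\<close> vanish; \<open>Z y i > 0\<close> stays strict so
  that the logarithm in \<open>w\<close> is meaningful.\<close>

abbreviation feasible :: "('n, 'k) point \<Rightarrow> bool" where
  "feasible y \<equiv> (\<forall>i. Z y i > 0 \<and> w i y \<ge> 0) \<and> slack_t y \<ge> 0 \<and> slack_z y \<ge> 0 \<and> slack_x y \<ge> 0"

lemma beta_ge_card: "beta q \<ge> real CARD('k)"
  using beta_ge(2)[OF q] .

lemma card_ge_1: "real CARD('k) \<ge> 1" "real CARD('n) \<ge> 1"
proof -
  have "CARD('k) > 0" "CARD('n) > 0" by (rule zero_less_card_finite)+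
  then show "real CARD('k) \<ge> 1" "real CARD('n) \<ge> 1" by linarith+
qed

lemma R_pos: "R > 0"
proof -
  have "2 * beta q / (\<delta> / 2) > 1"
  proof -
    have "\<delta> < beta q * 4" using beta_ge_card card_ge_1(1) \<delta> by linarith
    then show ?thesis using \<delta> by (simp add: field_simps)
  qed
  then show ?thesis
    unfolding R_def radius_def using \<phi> card_ge_1 by (intro mult_pos_pos divide_pos_pos) auto
qed

lemma norm1_pos: "norm1 q > 0"
  unfolding norm1_pos_weights[OF q] using q by (intro sum_pos) auto

lemma w_exp: "Z p i > 0 \<Longrightarrow> w i p > 0 \<longleftrightarrow> q $ i * exp ((\<omega> i - \<theta>) \<bullet> X p) < Z p i * exp (T p)"
proof -
  assume z: "Z p i > 0"
  have "w i p > 0 \<longleftrightarrow> ln (q $ i * exp ((\<omega> i - \<theta>) \<bullet> X p)) < ln (Z p i * exp (T p))"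
    unfolding w_def using z q[rule_format, of i] by (subst (1 2) ln_mult) auto
  also have "\<dots> \<longleftrightarrow> q $ i * exp ((\<omega> i - \<theta>) \<bullet> X p) < Z p i * exp (T p)"
    using z q[rule_format, of i] by (intro ln_less_cancel_iff) auto
  finally show ?thesis .
qed

text \<open>The exponential form contains \<open>Z p i > 0\<close> and involves only functions
  continuous on the whole space, so openness and membership in \<open>domain_D\<close> can be read
  off.\<close>

lemma pos_iff_exp: "pos p \<longleftrightarrow> (\<forall>i. q $ i * exp ((\<omega> i - \<theta>) \<bullet> X p) < Z p i * exp (T p)) \<and>
    slack_t p > 0 \<and> slack_z p > 0 \<and> slack_x p > 0"
proof -
  have "Z p i > 0" if "q $ i * exp ((\<omega> i - \<theta>) \<bullet> X p) < Z p i * exp (T p)" for i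
  proof -
    have "0 < q $ i * exp ((\<omega> i - \<theta>) \<bullet> X p)" using q by simp
    with that have "0 < Z p i * exp (T p)" by linarith
    then show ?thesis by (simp add: zero_less_mult_iff)
  qed
  then show ?thesis unfolding pos_def using w_exp by blast
qed

lemma open_pos: "open {p. pos p}"
proof -
  have eq: "{p. pos p} = (\<Inter>i. {p. q $ i * exp ((\<omega> i - \<theta>) \<bullet> X p) < Z p i * exp (T p)})
      \<inter> {p. 0 < slack_t p} \<inter> {p. 0 < slack_z p} \<inter> {p. 0 < slack_x p}"
    using pos_iff_exp by auto
  show ?thesis
    unfolding eq slack_t_def slack_z_def slack_x_def
    by (intro open_Int open_INT finite ballI open_Collect_less continuous_intros)
qed

lemma subspace_E: "subspace E"
proof -
  have W: "subspace (W_space \<omega> \<theta>)" unfolding W_space_def by (rule subspace_span)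
  show ?thesis
    unfolding subspace_def E_space_def
    using subspace_0[OF W] subspace_add[OF W] subspace_scale[OF W] by (auto simp: zero_prod_def)
qed

lemma mem_E: "p \<in> E \<longleftrightarrow> X p \<in> W_space \<omega> \<theta>"
  unfolding E_space_def by (cases p) auto

lemma diff_in_W: "\<omega> i - \<theta> \<in> W_space \<omega> \<theta>"
  unfolding W_space_def by (intro span_base) auto

lemma openin_D: "openin (top_of_set E) D"
proof -
  have "D = E \<inter> {p. pos p}" unfolding D_def by auto
  then show ?thesis using open_pos by (auto intro: openin_open_Int)
qed

lemma D_subset_interior_D: "D \<subseteq> interior_D \<omega> q \<theta> \<delta> \<phi>\<^sub>0"
  unfolding interior_D_def
proof (rule interior_of_maximal[OF _ openin_D])
  show "D \<subseteq> domain_D \<omega> q \<theta> \<delta> \<phi>\<^sub>0"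
  proof
    fix p assume p: "p \<in> D"
    obtain x z t where xzt: "p = (x, z, t)" by (cases p) auto
    have "x \<bullet> x < R\<^sup>2" using p unfolding D_def pos_def slack_x_def xzt by auto
    then have "(norm x)\<^sup>2 < R\<^sup>2" by (simp add: power2_norm_eq_inner)
    then have "norm x \<le> R" using R_pos by (metis less_eq_real_def power2_less_imp_less)
    then show "p \<in> domain_D \<omega> q \<theta> \<delta> \<phi>\<^sub>0"
      using p unfolding D_def pos_iff_exp xzt domain_D_def slack_t_def slack_z_def R_def
      by (auto simp: less_imp_le)
  qed
qed

lemma span_diff_comb:
  "(\<Sum>i\<in>UNIV. c i *\<^sub>R (\<omega> i - \<theta>)) \<in> W_space \<omega> \<theta>"
  using diff_in_W unfolding W_space_def by (intro span_sum span_scale) auto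

text \<open>The x-component of the ambient gradient combines the vectors
  \<open>\<omega> i - \<theta>\<close> with \<open>X p\<close>. So \<open>G\<close>, and likewise
  \<open>Hop\<close>, needs no projection to be the gradient and Hessian on the subspace.\<close>

lemma G_in_E: "p \<in> E \<Longrightarrow> G p \<in> E"
  unfolding mem_E G_def using span_diff_comb[of "\<lambda>i. 1 / w i p"]
  by (auto simp: W_space_def intro: span_add span_scale)

lemma Hop_in_E: "p \<in> E \<Longrightarrow> h \<in> E \<Longrightarrow> Hop p h \<in> E"
  unfolding mem_E Hop_def using span_diff_comb[of "\<lambda>i. \<gamma> i p h / w i p"]
  by (auto simp: W_space_def intro!: span_add span_diff span_neg span_scale)

lemma D2_self: "D2 p v v = (\<Sum>i\<in>UNIV. (\<alpha> i p v)\<^sup>2 * (1 + 1 / w i p) + (\<gamma> i p v)\<^sup>2)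
     + (\<tau> p v)\<^sup>2 + (\<zeta> p v)\<^sup>2 + (2 * (X v \<bullet> X v) / slack_x p + (\<xi> p v)\<^sup>2)"
  unfolding D2_def by (simp add: power2_eq_square)

lemma D2_pieces:
  assumes p: "pos p"
  shows "0 \<le> (\<alpha> i p v)\<^sup>2 * (1 + 1 / w i p) + (\<gamma> i p v)\<^sup>2"
    and "(\<alpha> i p v)\<^sup>2 * (1 + 1 / w i p) + (\<gamma> i p v)\<^sup>2 \<le> D2 p v v"
    and "(\<tau> p v)\<^sup>2 \<le> D2 p v v" and "(\<zeta> p v)\<^sup>2 \<le> D2 p v v"
    and "0 \<le> 2 * (X v \<bullet> X v) / slack_x p + (\<xi> p v)\<^sup>2"
    and "2 * (X v \<bullet> X v) / slack_x p + (\<xi> p v)\<^sup>2 \<le> D2 p v v"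
proof -
  have e: "0 \<le> (\<alpha> i p v)\<^sup>2 * (1 + 1 / w i p) + (\<gamma> i p v)\<^sup>2" for i
    using pos_simps(2)[OF p, of i] by (intro add_nonneg_nonneg mult_nonneg_nonneg) auto
  have b: "0 \<le> 2 * (X v \<bullet> X v) / slack_x p + (\<xi> p v)\<^sup>2"
    using pos_simps(5)[OF p] by (intro add_nonneg_nonneg divide_nonneg_pos) auto
  have s: "(\<alpha> i p v)\<^sup>2 * (1 + 1 / w i p) + (\<gamma> i p v)\<^sup>2
      \<le> (\<Sum>i\<in>UNIV. (\<alpha> i p v)\<^sup>2 * (1 + 1 / w i p) + (\<gamma> i p v)\<^sup>2)"
    using e by (intro member_le_sum) auto
  show "0 \<le> (\<alpha> i p v)\<^sup>2 * (1 + 1 / w i p) + (\<gamma> i p v)\<^sup>2"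
    "0 \<le> 2 * (X v \<bullet> X v) / slack_x p + (\<xi> p v)\<^sup>2" using e b by auto
  have S: "(\<Sum>i\<in>UNIV. (\<alpha> i p v)\<^sup>2 * (1 + 1 / w i p) + (\<gamma> i p v)\<^sup>2) \<ge> 0"
    using e by (intro sum_nonneg) auto
  have sq: "(\<tau> p v)\<^sup>2 \<ge> 0" "(\<zeta> p v)\<^sup>2 \<ge> 0" by auto
  show "(\<alpha> i p v)\<^sup>2 * (1 + 1 / w i p) + (\<gamma> i p v)\<^sup>2 \<le> D2 p v v"
    "(\<tau> p v)\<^sup>2 \<le> D2 p v v" "(\<zeta> p v)\<^sup>2 \<le> D2 p v v"
    "2 * (X v \<bullet> X v) / slack_x p + (\<xi> p v)\<^sup>2 \<le> D2 p v v"
    unfolding D2_self using s S sq b by linarith+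
qed

text \<open>Each block of coordinates has a piece that controls it: the ball piece
  \<open>X v\<close>, the upper bound on t the number \<open>T v\<close>, and the logarithms of z
  the numbers \<open>Z v i\<close>.\<close>

lemma D2_pos:
  assumes p: "pos p" and v: "v \<noteq> 0"
  shows "D2 p v v > 0"
proof (rule ccontr)
  assume "\<not> ?thesis"
  then have D: "D2 p v v \<le> 0" by simp
  note P = pos_simps[OF p]
  have "2 * (X v \<bullet> X v) / slack_x p + (\<xi> p v)\<^sup>2 \<le> 0" using D2_pieces(6)[OF p, of v] D by linarith
  moreover have "0 \<le> 2 * (X v \<bullet> X v) / slack_x p" using P(5) by (intro divide_nonneg_pos) auto
  ultimately have "2 * (X v \<bullet> X v) / slack_x p = 0" using zero_le_power2[of "\<xi> p v"] by linarith
  then have x: "X v = 0" using P(5) by simp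
  have "(\<tau> p v)\<^sup>2 \<le> 0" using D2_pieces(3)[OF p, of v] D by linarith
  then have "\<tau> p v = 0" by simp
  then have t: "T v = 0" unfolding \<tau>_def using P(3) by simp
  have "Z v i = 0" for i
  proof -
    have "(\<alpha> i p v)\<^sup>2 * (1 + 1 / w i p) + (\<gamma> i p v)\<^sup>2 \<le> 0"
      using D2_pieces(2)[OF p, where i = i and v = v] D by linarith
    moreover have "(\<alpha> i p v)\<^sup>2 * (1 + 1 / w i p) \<ge> (\<alpha> i p v)\<^sup>2 * 1"
      using P(2)[of i] by (intro mult_left_mono) auto
    ultimately have "(\<alpha> i p v)\<^sup>2 \<le> 0" using zero_le_power2[of "\<gamma> i p v"] by linarith
    then show ?thesis unfolding \<alpha>_def using P(1)[of i] by simp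
  qed
  then have "v = 0" using x t by (simp add: prod_eq_iff vec_eq_iff)
  then show False using v by simp
qed

lemma scaled_third_le:
  assumes "\<bar>c\<bar> \<le> 2 * sqrt a * b" "0 \<le> a" "a \<le> A" "0 \<le> b"
  shows "\<bar>c\<bar> \<le> 2 * sqrt A * b"
proof -
  have "2 * sqrt a * b \<le> 2 * sqrt A * b" using assms by (intro mult_right_mono) auto
  then show ?thesis using assms(1) by linarith
qed

text \<open>Every piece is bounded by its own norm of \<open>h\<close> times its own squared norm of
  \<open>v\<close>. Replacing the former by the full local norm gives a common factor, and the
  squared norms of \<open>v\<close> add up to \<open>D2 p v v\<close>.\<close>

lemma D3_le:
  assumes p: "pos p"
  shows "\<bar>D3 p v h\<bar> \<le> 2 * sqrt (D2 p h h) * D2 p v v"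
proof -
  note P = pos_simps[OF p]
  define S where "S = 2 * sqrt (D2 p h h)"
  define e where "e i = 2 * \<alpha> i p v * (- (\<alpha> i p v * \<alpha> i p h)) * (1 + 1 / w i p)
         - (\<alpha> i p v)\<^sup>2 * (\<gamma> i p h / w i p)
         + 2 * \<gamma> i p v * (- (\<alpha> i p v * \<alpha> i p h / w i p) - \<gamma> i p v * \<gamma> i p h)" for i
  define b where "b = 2 * (X v \<bullet> X v) / slack_x p * \<xi> p h
         + 2 * \<xi> p v * (2 * (X h \<bullet> X v) / slack_x p + \<xi> p v * \<xi> p h)"
  have e: "\<bar>e i\<bar> \<le> S * ((\<alpha> i p v)\<^sup>2 * (1 + 1 / w i p) + (\<gamma> i p v)\<^sup>2)" for i
    unfolding e_def S_def
    by (intro scaled_third_le[OF exp_barrier_third_derivative[OF P(2)]] D2_pieces p)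
  have b: "\<bar>b\<bar> \<le> S * (2 * (X v \<bullet> X v) / slack_x p + (\<xi> p v)\<^sup>2)"
    unfolding b_def S_def
    by (intro scaled_third_le[OF ball_barrier_third_derivative[OF P(5)]] D2_pieces p)
  have lin: "\<bar>2 * c * (c * d)\<bar> \<le> S * c\<^sup>2" if "d\<^sup>2 \<le> D2 p h h" for c d :: real
  proof -
    have "\<bar>2 * c * (c * d)\<bar> = 2 * sqrt (d\<^sup>2) * c\<^sup>2" by (simp add: abs_mult power2_eq_square)
    then have "\<bar>2 * c * (c * d)\<bar> \<le> 2 * sqrt (d\<^sup>2) * c\<^sup>2" by simp
    from scaled_third_le[OF this zero_le_power2 that zero_le_power2] show ?thesis unfolding S_def .
  qed
  have t: "\<bar>2 * \<tau> p v * (\<tau> p v * \<tau> p h)\<bar> \<le> S * (\<tau> p v)\<^sup>2" and z: "\<bar>2 * \<zeta> p v * (\<zeta> p v * \<zeta> p h)\<bar> \<le> S * (\<zeta> p v)\<^sup>2"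
    using D2_pieces(3,4)[OF p] by (intro lin; blast)+
  have "\<bar>\<Sum>i\<in>UNIV. e i\<bar> \<le> (\<Sum>i\<in>UNIV. S * ((\<alpha> i p v)\<^sup>2 * (1 + 1 / w i p) + (\<gamma> i p v)\<^sup>2))"
    using e by (intro order_trans[OF sum_abs] sum_mono)
  then have "\<bar>D3 p v h\<bar> \<le> (\<Sum>i\<in>UNIV. S * ((\<alpha> i p v)\<^sup>2 * (1 + 1 / w i p) + (\<gamma> i p v)\<^sup>2))
      + S * (\<tau> p v)\<^sup>2 + S * (\<zeta> p v)\<^sup>2 + S * (2 * (X v \<bullet> X v) / slack_x p + (\<xi> p v)\<^sup>2)"
    unfolding D3_def e_def[symmetric] b_def[symmetric] using t z b by linarith
  also have "\<dots> = S * D2 p v v"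
    unfolding D2_self by (simp add: sum_distrib_left distrib_left)
  finally show ?thesis unfolding S_def .
qed

text \<open>Exact, not a linearization: \<open>w\<close> is affine except for
  \<open>ln (Z p i)\<close>, whose increment is \<open>ln (1 + \<alpha> i p h)\<close> instead of
  \<open>\<alpha> i p h\<close>.\<close>

lemma w_add:
  assumes p: "pos p" and \<alpha>: "\<alpha> i p h > - 1"
  shows "w i (p + h) = ln (1 + \<alpha> i p h) - \<alpha> i p h + w i p * (1 + \<gamma> i p h)"
    and "Z (p + h) i = Z p i * (1 + \<alpha> i p h)"
proof -
  note P = pos_simps[OF p]
  show Z: "Z (p + h) i = Z p i * (1 + \<alpha> i p h)"
    unfolding \<alpha>_def using P(1)[of i] by (simp add: field_simps)
  have "ln (Z (p + h) i) = ln (Z p i) + ln (1 + \<alpha> i p h)"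
    unfolding Z using P(1)[of i] \<alpha> by (simp add: ln_mult)
  moreover have "w i p * \<gamma> i p h = \<alpha> i p h - (\<omega> i - \<theta>) \<bullet> X h + T h"
    unfolding \<gamma>_def using P(2)[of i] by simp
  ultimately show "w i (p + h) = ln (1 + \<alpha> i p h) - \<alpha> i p h + w i p * (1 + \<gamma> i p h)"
    unfolding w_def[of i "p + h"] distrib_left by (simp add: w_def inner_add_right)
qed

lemma pos_add:
  assumes p: "pos p" and h: "D2 p h h < 1"
  shows "pos (p + h)"
proof -
  note P = pos_simps[OF p]
  have "Z (p + h) i > 0" "w i (p + h) > 0" for i
  proof -
    have lt: "(\<alpha> i p h)\<^sup>2 * (1 + 1 / w i p) + (\<gamma> i p h)\<^sup>2 < 1"
      using D2_pieces(2)[OF p, where i = i and v = h] h by linarith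
    note d = exp_barrier_dikin[OF P(2) lt]
    have a: "\<alpha> i p h > - 1" using d(1) by linarith
    show "Z (p + h) i > 0" "w i (p + h) > 0"
      unfolding w_add[OF p a] using d P(1)[of i] a by auto
  qed
  moreover have "slack_t (p + h) > 0"
  proof -
    have "(\<tau> p h)\<^sup>2 < 1" using D2_pieces(3)[OF p, of h] h by linarith
    then have "\<tau> p h < 1" by (simp add: abs_square_less_1)
    then show ?thesis unfolding \<tau>_def slack_t_def using P(3) unfolding slack_t_def by (simp add: field_simps)
  qed
  moreover have "slack_z (p + h) > 0"
  proof -
    have "(\<zeta> p h)\<^sup>2 < 1" using D2_pieces(4)[OF p, of h] h by linarith
    then have "\<zeta> p h < 1" by (simp add: abs_square_less_1)
    then show ?thesis
      unfolding \<zeta>_def slack_z_def using P(4) unfolding slack_z_def by (simp add: field_simps sum.distrib)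
  qed
  moreover have "slack_x (p + h) > 0"
  proof -
    have "2 * (X h \<bullet> X h) / slack_x p + (2 * (X p \<bullet> X h) / slack_x p)\<^sup>2 < 1"
      using D2_pieces(6)[OF p, of h] h unfolding \<xi>_def by linarith
    then show ?thesis
      using ball_barrier_dikin[where r = R and x = "X p" and h = "X h"] P(5) unfolding slack_x_def by simp
  qed
  ultimately show ?thesis unfolding pos_def by blast
qed

lemma \<nu>_eq: "\<nu> = 2 * real CARD('k) + 3"
  unfolding \<nu>_def nu_def by simp

text \<open>The pieces contribute 2 for each index and 1 for each of the three remaining terms,
  adding up to \<nu>. For the second claim the norm is first split by subadditivity of the square
  root, so that each piece pays for its own share within 6/5 of its parameter. The first claim
  bounds the start gradient, the second the final gap.\<close>

lemma separation:
  assumes p: "pos p" and y: "feasible y"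
  shows "G p \<bullet> (y - p) \<le> \<nu>"
    and "G p \<bullet> (y - p) + 1 / 9 * sqrt (D2 p (y - p) (y - p)) \<le> 6 / 5 * \<nu>"
proof -
  note P = pos_simps[OF p]
  define h where "h = y - p"
  have ye: "y = p + h" unfolding h_def by simp
  define e where "e i = (\<alpha> i p h)\<^sup>2 * (1 + 1 / w i p) + (\<gamma> i p h)\<^sup>2" for i
  define b where "b = 2 * (X h \<bullet> X h) / slack_x p + (\<xi> p h)\<^sup>2"
  have exp: "- \<alpha> i p h - \<gamma> i p h \<le> 2 \<and> - \<alpha> i p h - \<gamma> i p h + 1 / 9 * sqrt (e i) \<le> 6 / 5 * 2" for i
  proof -
    have "1 + \<alpha> i p h = Z y i / Z p i"
      unfolding \<alpha>_def h_def using P(1)[of i] by (simp add: field_simps)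
    moreover have "Z y i / Z p i > 0" using P(1)[of i] y by simp
    ultimately have a: "\<alpha> i p h > - 1" by linarith
    have "w i y \<ge> 0" using y by blast
    then have "(1 + \<gamma> i p h) * w i p \<ge> \<alpha> i p h - ln (1 + \<alpha> i p h)"
      using w_add(1)[OF p a] unfolding ye[symmetric] by (simp add: mult.commute)
    then show ?thesis
      unfolding e_def using exp_barrier_separation[OF P(2) a] by blast
  qed
  have t: "\<tau> p h \<le> 1"
    unfolding \<tau>_def h_def using P(3) y unfolding slack_t_def by (simp add: field_simps)
  have z: "\<zeta> p h \<le> 1"
    unfolding \<zeta>_def h_def using P(4) y unfolding slack_z_def by (simp add: field_simps sum_subtractf)
  have x: "\<xi> p h \<le> 1" "\<xi> p h + 1 / 9 * sqrt b \<le> 6 / 5"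
    unfolding b_def \<xi>_def h_def
    using ball_barrier_separation[where r = R and x = "X p" and y = "X y"] P(5) y unfolding slack_x_def by auto
  have "(\<Sum>i\<in>UNIV. - \<alpha> i p h - \<gamma> i p h) \<le> (\<Sum>i\<in>(UNIV::'k set). 2)"
    using exp by (intro sum_mono) auto
  then show "G p \<bullet> (y - p) \<le> \<nu>"
    unfolding inner_G D1_def h_def[symmetric] \<nu>_eq using t z x(1) by simp
  have lin: "c + 1 / 9 * sqrt (c\<^sup>2) \<le> 6 / 5" if "c \<le> 1" for c :: real
    using that by (auto simp: abs_if)
  have "D2 p h h = (\<Sum>i\<in>UNIV. e i) + (\<tau> p h)\<^sup>2 + (\<zeta> p h)\<^sup>2 + b"
    unfolding D2_self e_def b_def by simp
  moreover have e0: "e i \<ge> 0" for i unfolding e_def using D2_pieces(1)[OF p] .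
  moreover have b0: "b \<ge> 0" unfolding b_def using D2_pieces(5)[OF p] .
  moreover have s3: "sqrt (a + b + c + d) \<le> sqrt a + sqrt b + sqrt c + sqrt d"
    if "a \<ge> 0" "b \<ge> 0" "c \<ge> 0" "d \<ge> 0" for a b c d :: real
    using sqrt_add_le_add_sqrt[of "a + b + c" d] sqrt_add_le_add_sqrt[of "a + b" c] sqrt_add_le_add_sqrt[of a b] that
    by linarith
  ultimately have "sqrt (D2 p h h) \<le> sqrt (\<Sum>i\<in>UNIV. e i) + sqrt ((\<tau> p h)\<^sup>2) + sqrt ((\<zeta> p h)\<^sup>2) + sqrt b"
    by (simp only:) (intro s3 sum_nonneg zero_le_power2, auto)
  also have "\<dots> \<le> (\<Sum>i\<in>UNIV. sqrt (e i)) + sqrt ((\<tau> p h)\<^sup>2) + sqrt ((\<zeta> p h)\<^sup>2) + sqrt b"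
    using sqrt_sum_le_sum_sqrt[of UNIV e] e0 by simp
  finally have sq: "sqrt (D2 p h h) \<le> (\<Sum>i\<in>UNIV. sqrt (e i)) + sqrt ((\<tau> p h)\<^sup>2) + sqrt ((\<zeta> p h)\<^sup>2) + sqrt b" .
  have "(\<Sum>i\<in>UNIV. - \<alpha> i p h - \<gamma> i p h) + 1 / 9 * (\<Sum>i\<in>UNIV. sqrt (e i))
      = (\<Sum>i\<in>UNIV. - \<alpha> i p h - \<gamma> i p h + 1 / 9 * sqrt (e i))"
    by (simp add: sum.distrib sum_distrib_left)
  also have "\<dots> \<le> (\<Sum>i\<in>(UNIV::'k set). 6 / 5 * 2)"
    using exp by (intro sum_mono) blast
  also have "\<dots> = 6 / 5 * (2 * real CARD('k))" by simp
  finally have A: "(\<Sum>i\<in>UNIV. - \<alpha> i p h - \<gamma> i p h) + 1 / 9 * (\<Sum>i\<in>UNIV. sqrt (e i))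
      \<le> 6 / 5 * (2 * real CARD('k))" .
  have add: "A + t + z + x + 1 / 9 * d \<le> 6 / 5 * (2 * k + 3)"
    if "A + 1 / 9 * S \<le> 6 / 5 * (2 * k)" "t + 1 / 9 * t' \<le> 6 / 5" "z + 1 / 9 * z' \<le> 6 / 5"
      "x + 1 / 9 * x' \<le> 6 / 5" "d \<le> S + t' + z' + x'" for A S t z x t' z' x' d k :: real
    using that by (simp add: field_simps)
  show "G p \<bullet> (y - p) + 1 / 9 * sqrt (D2 p (y - p) (y - p)) \<le> 6 / 5 * \<nu>"
    unfolding inner_G D1_def h_def[symmetric] \<nu>_eq by (rule add[OF A lin[OF t] lin[OF z] x(2) sq])
qed

text \<open>Cauchy-Schwarz over the \<nu> = 2k + 3 squares, carried out as a weighted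
  arithmetic-geometric mean: with \<open>l = sqrt (Q / \<nu>)\<close> the sum
  \<open>(\<nu> * l + Q / l) / 2\<close> is exactly \<open>sqrt \<nu> * sqrt Q\<close>.\<close>

lemma G_le:
  assumes p: "pos p"
  shows "G p \<bullet> v \<le> sqrt \<nu> * sqrt (D2 p v v)"
proof (cases "v = 0")
  case False
  define Q where "Q = D2 p v v"
  have Q: "Q > 0" unfolding Q_def using D2_pos[OF p False] .
  have \<nu>: "\<nu> > 0" unfolding \<nu>_eq by simp
  note P = pos_simps[OF p]
  define l where "l = sqrt (Q / \<nu>)"
  have l: "l > 0" unfolding l_def using Q \<nu> by simp
  have amgm: "c \<le> (l + c\<^sup>2 / l) / 2" for c :: real
  proof -
    have "(c - l)\<^sup>2 / l \<ge> 0" using l by simp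
    moreover have "(c - l)\<^sup>2 / l = c\<^sup>2 / l - 2 * c + l" using l by (simp add: power2_eq_square field_simps)
    ultimately show ?thesis by simp
  qed
  have e: "- \<alpha> i p v - \<gamma> i p v \<le> (2 * l + ((\<alpha> i p v)\<^sup>2 * (1 + 1 / w i p) + (\<gamma> i p v)\<^sup>2) / l) / 2" for i
  proof -
    have "(\<alpha> i p v)\<^sup>2 * 1 \<le> (\<alpha> i p v)\<^sup>2 * (1 + 1 / w i p)"
      using P(2)[of i] by (intro mult_left_mono) auto
    then have "(\<alpha> i p v)\<^sup>2 / l + (\<gamma> i p v)\<^sup>2 / l \<le> ((\<alpha> i p v)\<^sup>2 * (1 + 1 / w i p) + (\<gamma> i p v)\<^sup>2) / l"
      unfolding add_divide_distrib[symmetric] using l by (intro divide_right_mono) auto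
    then show ?thesis using amgm[of "- \<alpha> i p v"] amgm[of "- \<gamma> i p v"] by simp
  qed
  have x: "\<xi> p v \<le> (l + (2 * (X v \<bullet> X v) / slack_x p + (\<xi> p v)\<^sup>2) / l) / 2"
  proof -
    have "0 \<le> 2 * (X v \<bullet> X v) / slack_x p" using P(5) by (intro divide_nonneg_pos) auto
    then have "(\<xi> p v)\<^sup>2 / l \<le> (2 * (X v \<bullet> X v) / slack_x p + (\<xi> p v)\<^sup>2) / l"
      using l by (intro divide_right_mono) auto
    then show ?thesis using amgm[of "\<xi> p v"] by simp
  qed
  define e where "e i = (\<alpha> i p v)\<^sup>2 * (1 + 1 / w i p) + (\<gamma> i p v)\<^sup>2" for i
  define b where "b = 2 * (X v \<bullet> X v) / slack_x p + (\<xi> p v)\<^sup>2"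
  have "D1 p v \<le> (\<Sum>i\<in>UNIV. (2 * l + e i / l) / 2) + (l + (\<tau> p v)\<^sup>2 / l) / 2 + (l + (\<zeta> p v)\<^sup>2 / l) / 2 + (l + b / l) / 2"
    unfolding D1_def e_def b_def using x by (intro add_mono sum_mono e amgm)
  also have "(\<Sum>i\<in>UNIV. (2 * l + e i / l) / 2) = real CARD('k) * l + (\<Sum>i\<in>UNIV. e i) / l / 2"
    by (simp only: sum_divide_distrib[symmetric] sum.distrib) (simp add: add_divide_distrib)
  also have "real CARD('k) * l + (\<Sum>i\<in>UNIV. e i) / l / 2 + (l + (\<tau> p v)\<^sup>2 / l) / 2 + (l + (\<zeta> p v)\<^sup>2 / l) / 2 + (l + b / l) / 2
      = (\<nu> * l + Q / l) / 2"
    unfolding Q_def D2_self \<nu>_eq e_def[symmetric] b_def[symmetric]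
    by (simp add: add_divide_distrib algebra_simps)
  also have "\<dots> = sqrt \<nu> * sqrt Q"
  proof -
    have ab: "(a\<^sup>2 * (b / a) + b\<^sup>2 / (b / a)) / 2 = a * b" if "a > 0" "b > 0" for a b :: real
      using that by (simp add: field_simps power2_eq_square)
    show ?thesis
      using ab[of "sqrt \<nu>" "sqrt Q"] Q \<nu> unfolding l_def real_sqrt_divide by simp
  qed
  finally show ?thesis unfolding inner_G Q_def .
qed (simp add: D2_def \<alpha>_def \<gamma>_def \<tau>_def \<zeta>_def \<xi>_def)

end

sublocale geometric_program \<subseteq> sc: self_concordant E D G Hop
proof
  have DE: "\<And>p. p \<in> D \<Longrightarrow> p \<in> E" "\<And>p. p \<in> D \<Longrightarrow> pos p" unfolding D_def by auto
  have ip: "u \<bullet> Hop p v = D2 p v u" for u v p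
    using inner_Hop by (simp add: inner_commute)
  show "subspace E" by (rule subspace_E)
  show "openin (top_of_set E) D" by (rule openin_D)
  fix p assume p: "p \<in> D"
  show "G p \<in> E" using G_in_E DE p by blast
  show "(G has_derivative Hop p) (at p)" using G_deriv DE p by blast
  show "u \<bullet> Hop p v = v \<bullet> Hop p u" for u v unfolding ip by (rule D2_sym)
  show "v \<bullet> Hop p v > 0" if "v \<noteq> 0" for v unfolding ip using D2_pos DE p that by blast
  fix h assume h: "h \<in> E"
  show "Hop p h \<in> E" using Hop_in_E DE p h by blast
  show "p + h \<in> D" if "h \<bullet> Hop p h < 1"
    using that pos_add[OF DE(2)[OF p]] subspace_add[OF subspace_E DE(1)[OF p] h] unfolding ip D_def by blast
  fix v assume v: "v \<in> E"
  have "((\<lambda>s. D2 (p + s *\<^sub>R h) v v) has_vector_derivative D3 p v h) (at 0)"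
    using has_derivative_line[OF subspace_UNIV UNIV_I UNIV_I, of "\<lambda>p. D2 p v v" "D3 p v" p 0 h] D2_deriv[OF DE(2)[OF p]]
    by simp
  then show "\<exists>T. ((\<lambda>s. v \<bullet> Hop (p + s *\<^sub>R h) v) has_real_derivative T) (at 0) \<and>
        \<bar>T\<bar> \<le> 2 * sqrt (h \<bullet> Hop p h) * (v \<bullet> Hop p v)"
    unfolding ip has_real_derivative_iff_has_vector_derivative using D3_le[OF DE(2)[OF p]] by blast
qed

section \<open>Analysis of the algorithm\<close>

context geometric_program
begin

abbreviation "N \<equiv> max_dist \<omega>"

section \<open>Bounds from the data of the instance\<close>

lemma two_le_card: "CARD('k) \<ge> 2"
  using two card_image_le[of UNIV \<omega>] by simp

lemma dist_le_max_dist: "dist (\<omega> i) (\<omega> j) \<le> N" and max_dist_ge: "\<phi>\<^sub>0 \<le> N"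
proof -
  have "finite {norm (\<omega> i - \<omega> j) | i j. i \<noteq> j}"
    by (rule finite_subset[of _ "(\<lambda>(i, j). norm (\<omega> i - \<omega> j)) ` UNIV"]) auto
  then have le: "dist (\<omega> i) (\<omega> j) \<le> N" if "i \<noteq> j" for i j
    unfolding max_dist_def dist_norm using that by (intro Max_ge) auto
  have "\<exists>w1 w2. w1 \<in> range \<omega> \<and> w2 \<in> range \<omega> \<and> w1 \<noteq> w2"
    using two card_le_Suc0_iff_eq[of "range \<omega>"] by fastforce
  then obtain u v where uv: "u \<in> range \<omega>" "v \<in> range \<omega>" "u \<noteq> v" "facet_gap (range \<omega>) \<le> dist u v"
    using facet_gap_le_dist[of "range \<omega>"] by (metis finite finite_imageI)
  then obtain a b where "u = \<omega> a" "v = \<omega> b" by blast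
  then show ge: "\<phi>\<^sub>0 \<le> N" using uv le[of a b] \<phi> by force
  show "dist (\<omega> i) (\<omega> j) \<le> N"
    using le[of i j] ge \<phi> by (cases "i = j") auto
qed

lemma norm_shift_le: "norm (\<omega> i - \<theta>) \<le> N"
proof -
  have "convex hull (range \<omega>) \<subseteq> cball (\<omega> i) N"
    using dist_le_max_dist by (intro hull_minimal convex_cball) auto
  then show ?thesis using \<theta> by (auto simp: dist_norm)
qed

lemma feasible_D: "p \<in> D \<Longrightarrow> feasible p"
  unfolding D_def pos_def by (auto simp: less_imp_le)

text \<open>Adding up the exponential constraints and using that the z-coordinates sum to at most 1
  shows that t is an epigraph variable for the objective.\<close>

lemma F_obj_le_T: assumes p: "p \<in> D" shows "F_obj \<omega> q \<theta> (X p) \<le> T p"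
proof -
  have P: "q $ i * exp ((\<omega> i - \<theta>) \<bullet> X p) \<le> Z p i * exp (T p)" for i
    using p unfolding D_def pos_iff_exp by (auto simp: less_imp_le)
  have "(\<Sum>i\<in>UNIV. q $ i * exp ((\<omega> i - \<theta>) \<bullet> X p)) \<le> (\<Sum>i\<in>UNIV. Z p i) * exp (T p)"
    unfolding sum_distrib_right using P by (intro sum_mono)
  also have "\<dots> \<le> 1 * exp (T p)"
    using feasible_D[OF p] unfolding slack_z_def by (intro mult_right_mono) auto
  finally have le: "(\<Sum>i\<in>UNIV. q $ i * exp ((\<omega> i - \<theta>) \<bullet> X p)) \<le> exp (T p)" by simp
  have "(\<Sum>i\<in>UNIV. q $ i * exp ((\<omega> i - \<theta>) \<bullet> X p)) > 0"
    using q by (intro sum_pos) auto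
  then have "F_obj \<omega> q \<theta> (X p) \<le> ln (exp (T p))"
    unfolding F_obj_def using le by (subst ln_le_cancel_iff) auto
  then show ?thesis by simp
qed

lemma T_bounds:
  assumes p: "p \<in> D" shows "ln (norm1 q / beta q) \<le> T p" and "T p < t_max q"
  using F_obj_lower_bound[OF \<theta> q, of "X p"] F_obj_le_T[OF p] p
  unfolding D_def pos_def slack_t_def by auto

abbreviation "c \<equiv> (cost :: ('n, 'k) point)"
abbreviation "p\<^sub>0 \<equiv> (start q :: ('n, 'k) point)"

lemma c_in_E: "c \<in> E"
  unfolding mem_E cost_def W_space_def by (simp add: span_zero)

lemma inner_c: "c \<bullet> v = T v"
  unfolding inner_point cost_def by simp

lemma nrm_eq: "sc.nrm p v = sqrt (D2 p v v)"
  unfolding sc.nrm_def using inner_Hop[of p v v] by (simp add: inner_commute)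

lemma dual_le_G: "p \<in> D \<Longrightarrow> sc.dual_le p (G p) (sqrt \<nu>)"
  unfolding sc.dual_le_def nrm_eq using G_le D_def by auto

section \<open>The starting point and dual norm bounds valid on the whole domain\<close>

lemma start_coords: "X p\<^sub>0 = 0" "Z p\<^sub>0 i = 1 / (2 * real CARD('k))" "T p\<^sub>0 = ln (4 * real CARD('k) * norm1 q)"
  unfolding start_def by auto

lemma beta_pos: "beta q > 0"
  using card_ge_1 beta_ge_card by linarith

lemma ln_norm1_q: "ln (q $ i) \<le> ln (norm1 q)"
proof -
  have "q $ i \<le> norm1 q"
    unfolding norm1_pos_weights[OF q] using q by (intro member_le_sum) (auto simp: less_imp_le)
  then show ?thesis using q norm1_pos by (simp add: ln_le_cancel_iff)
qed

text \<open>At the start \<open>Z\<close> times the exponential of \<open>T\<close> equals twice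
  \<open>norm1 q\<close>, while every weight is at most \<open>norm1 q\<close>.\<close>

lemma w_start: "w i p\<^sub>0 \<ge> ln 2"
proof -
  have "ln (1 / (2 * real CARD('k))) + ln (4 * real CARD('k) * norm1 q) = ln 2 + ln (norm1 q)"
  proof -
    have "ln (1 / (2 * real CARD('k))) + ln (4 * real CARD('k) * norm1 q)
        = ln ((1 / (2 * real CARD('k))) * (4 * real CARD('k) * norm1 q))"
      using card_ge_1 norm1_pos by (subst ln_mult) auto
    also have "(1 / (2 * real CARD('k))) * (4 * real CARD('k) * norm1 q) = 2 * norm1 q"
      using card_ge_1 by simp
    also have "ln (2 * norm1 q) = ln 2 + ln (norm1 q)"
      using norm1_pos by (subst ln_mult) auto
    finally show ?thesis .
  qed
  then show ?thesis unfolding w_def start_coords using ln_norm1_q[of i] by simp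
qed

lemma slack_start: "slack_t p\<^sub>0 = ln (5 / 4)" "slack_z p\<^sub>0 = 1 / 2" "slack_x p\<^sub>0 = R\<^sup>2"
proof -
  have "slack_t p\<^sub>0 = ln (5 * real CARD('k) * norm1 q) - ln (4 * real CARD('k) * norm1 q)"
    unfolding slack_t_def start_coords t_max_def by simp
  also have "\<dots> = ln ((5 * real CARD('k) * norm1 q) / (4 * real CARD('k) * norm1 q))"
    using card_ge_1 norm1_pos by (subst ln_div) auto
  also have "(5 * real CARD('k) * norm1 q) / (4 * real CARD('k) * norm1 q) = 5 / 4"
    using card_ge_1 norm1_pos by simp
  finally show "slack_t p\<^sub>0 = ln (5 / 4)" .
  show "slack_z p\<^sub>0 = 1 / 2" "slack_x p\<^sub>0 = R\<^sup>2"
    unfolding slack_z_def slack_x_def start_coords using card_ge_1 by auto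
qed

lemma start_in_D: "p\<^sub>0 \<in> D"
proof -
  have "w i p\<^sub>0 > 0" for i using w_start[of i] ln_gt_zero[of "2::real"] by linarith
  then show ?thesis
    unfolding D_def using card_ge_1 R_pos
    by (simp add: mem_E pos_def slack_start start_coords W_space_def span_zero)
qed

lemma ln_2_ge: "ln 2 \<ge> (2 / 3 :: real)"
proof -
  have "exp 2 \<le> (8 :: real)"
  proof -
    have "exp (1::real) \<le> 2.72" using e_less_272 by simp
    then have "exp (1::real) * exp 1 \<le> 2.72 * 2.72" by (intro mult_mono) auto
    then show ?thesis by (simp flip: exp_add)
  qed
  then have "2 \<le> ln (8 :: real)" by (subst ln_ge_iff) auto
  also have "ln (8 :: real) = 3 * ln 2" using ln_realpow[of 2 3] by simp
  finally show ?thesis by simp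
qed

lemma ln_5_4: "ln (5 / 4) \<ge> (1 / 5 :: real)" "ln (5 / 4) \<le> (1 :: real)"
proof -
  have "1 / 4 - (1 / 4)\<^sup>2 / (2 * (1 - \<bar>1 / 4\<bar>)) \<le> ln (1 + 1 / 4 :: real)"
    by (rule ln_one_plus_lower) simp
  then show "ln (5 / 4) \<ge> (1 / 5 :: real)" by (simp add: power2_eq_square)
  show "ln (5 / 4) \<le> (1 :: real)" using ln_le_minus_one[of "5 / 4 :: real"] by simp
qed

text \<open>A bound for the dual norm of the start gradient at any point. The factor 3/2 comes from
  \<open>w\<close> being at least ln 2, hence 2/3, at the start, and 5 from
  \<open>ln (5 / 4) \<ge> 1 / 5\<close>. The terms \<open>6 * real CARD('k) + 4\<close> collect
  \<nu> from \<open>separation\<close> and 4k + 1 from \<open>G_start_lower\<close>.\<close>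

definition K :: real where "K = 6 * real CARD('k) + 4 + 3 / 2 * real CARD('k) * (N * R) + 5 * ln (4 * real CARD('k) * beta q)"

lemma ln_4kb: "ln (4 * real CARD('k) * beta q) \<ge> 0"
proof -
  have "1 * 1 * 1 \<le> 4 * real CARD('k) * beta q" using card_ge_1 beta_ge_card by (intro mult_mono) linarith+
  then show ?thesis by simp
qed

lemma G_start_lower:
  assumes p: "p \<in> D"
  shows "G p\<^sub>0 \<bullet> (p\<^sub>0 - p) \<le> 4 * real CARD('k) + 3 / 2 * real CARD('k) * (N * R) + 5 * ln (4 * real CARD('k) * beta q) + 1"
proof -
  define h where "h = p - p\<^sub>0"
  have P: "Z p i > 0" "slack_t p > 0" "slack_z p > 0" "slack_x p > 0" for i
    using p unfolding D_def pos_def by auto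
  have k0: "real CARD('k) > 0" using card_ge_1 by simp
  have NR: "0 \<le> N * R" using R_pos max_dist_ge \<phi> by simp
  have sZ: "(\<Sum>i\<in>UNIV. Z p i) \<le> 1" "(\<Sum>i\<in>UNIV. Z p i) \<ge> 0"
    using P unfolding slack_z_def by (auto intro!: sum_nonneg simp: less_imp_le)
  have a: "\<alpha> i p\<^sub>0 h = 2 * real CARD('k) * Z p i - 1" for i
    unfolding \<alpha>_def h_def using k0 by (simp add: start_coords field_simps)
  have Tp: "T h \<le> 1"
  proof -
    have "T h < t_max q - T p\<^sub>0" using T_bounds[OF p] unfolding h_def by simp
    then show ?thesis using slack_start(1) ln_5_4 unfolding slack_t_def by linarith
  qed
  have g: "\<gamma> i p\<^sub>0 h \<le> 3 / 2 * (2 * real CARD('k) * Z p i + N * R)" for i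
  proof -
    have "- ((\<omega> i - \<theta>) \<bullet> X h) \<le> norm (\<omega> i - \<theta>) * norm (X p)"
      using Cauchy_Schwarz_ineq2[of "\<omega> i - \<theta>" "X p"] unfolding h_def by (simp add: start_coords)
    also have "\<dots> \<le> N * R"
    proof (intro mult_mono norm_shift_le)
      have "(norm (X p))\<^sup>2 \<le> R\<^sup>2" using P unfolding slack_x_def by (simp add: power2_norm_eq_inner)
      then show "norm (X p) \<le> R" by (rule power2_le_imp_le) (use R_pos in simp)
    qed (use max_dist_ge \<phi> in auto)
    \<comment> \<open>The constant -1 in \<open>\<alpha>\<close> absorbs
      \<open>T h \<le> 1\<close>.\<close>
    finally have "\<alpha> i p\<^sub>0 h - (\<omega> i - \<theta>) \<bullet> X h + T h \<le> 2 * real CARD('k) * Z p i + N * R"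
      unfolding a using Tp by linarith
    moreover have M: "0 \<le> 2 * real CARD('k) * Z p i + N * R" using P(1)[of i] k0 NR by simp
    moreover have w: "w i p\<^sub>0 \<ge> 2 / 3" using w_start[of i] ln_2_ge by linarith
    ultimately have "\<gamma> i p\<^sub>0 h \<le> (2 * real CARD('k) * Z p i + N * R) / w i p\<^sub>0"
      unfolding \<gamma>_def by (intro divide_right_mono) auto
    also have "\<dots> \<le> (2 * real CARD('k) * Z p i + N * R) / (2 / 3)"
      using M w by (intro divide_left_mono) auto
    finally show ?thesis by simp
  qed
  have t: "- \<tau> p\<^sub>0 h \<le> 5 * ln (4 * real CARD('k) * beta q)"
  proof -
    have "ln (4 * real CARD('k) * norm1 q) - ln (norm1 q / beta q) = ln ((4 * real CARD('k) * norm1 q) / (norm1 q / beta q))"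
      using k0 norm1_pos beta_pos by (subst ln_div) auto
    also have "(4 * real CARD('k) * norm1 q) / (norm1 q / beta q) = 4 * real CARD('k) * beta q"
      using norm1_pos by simp
    finally have "- T h \<le> ln (4 * real CARD('k) * beta q)"
      using T_bounds(1)[OF p] unfolding h_def by (simp add: start_coords)
    then have "- T h / ln (5 / 4) \<le> ln (4 * real CARD('k) * beta q) / ln (5 / 4)"
      using ln_5_4 by (intro divide_right_mono) auto
    also have "\<dots> \<le> ln (4 * real CARD('k) * beta q) / (1 / 5)"
      using ln_5_4 ln_4kb by (intro divide_left_mono) auto
    finally show ?thesis unfolding \<tau>_def slack_start by simp
  qed
  have z: "- \<zeta> p\<^sub>0 h \<le> 1"
  proof -
    have "(\<Sum>i\<in>UNIV. Z h i) = (\<Sum>i\<in>UNIV. Z p i) - 1 / 2"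
      unfolding h_def using slack_start(2) unfolding slack_z_def by (simp add: sum_subtractf)
    then show ?thesis unfolding \<zeta>_def slack_start using sZ by simp
  qed
  have x: "\<xi> p\<^sub>0 h = 0" unfolding \<xi>_def by (simp add: start_coords)
  \<comment> \<open>The termwise bound keeps \<open>Z p i\<close>, so the total weight 1 enters once
    and the sum is linear in k; bounding each \<open>Z p i\<close> by 1 would give a quadratic
    term.\<close>
  have "(\<Sum>i\<in>UNIV. \<alpha> i p\<^sub>0 h + \<gamma> i p\<^sub>0 h) \<le> (\<Sum>i\<in>(UNIV :: 'k set). (2 * real CARD('k) * Z p i - 1) + 3 / 2 * (2 * real CARD('k) * Z p i + N * R))"
    using a g by (intro sum_mono add_mono) auto
  also have "\<dots> = 5 * real CARD('k) * (\<Sum>i\<in>UNIV. Z p i) - real CARD('k) + 3 / 2 * real CARD('k) * (N * R)"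
    by (simp add: sum.distrib sum_subtractf sum_distrib_left algebra_simps)
  also have "\<dots> \<le> 5 * real CARD('k) * 1 - real CARD('k) + 3 / 2 * real CARD('k) * (N * R)"
    using sZ k0 by (intro add_right_mono diff_right_mono mult_left_mono) auto
  finally have s: "(\<Sum>i\<in>UNIV. \<alpha> i p\<^sub>0 h + \<gamma> i p\<^sub>0 h) \<le> 4 * real CARD('k) + 3 / 2 * real CARD('k) * (N * R)" by simp
  have "G p\<^sub>0 \<bullet> (p\<^sub>0 - p) = - D1 p\<^sub>0 h"
    unfolding inner_G[symmetric] h_def by (simp add: inner_diff_right)
  also have "\<dots> = (\<Sum>i\<in>UNIV. \<alpha> i p\<^sub>0 h + \<gamma> i p\<^sub>0 h) - \<tau> p\<^sub>0 h - \<zeta> p\<^sub>0 h - \<xi> p\<^sub>0 h"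
  proof -
    have "(\<Sum>i\<in>UNIV. - \<alpha> i p\<^sub>0 h - \<gamma> i p\<^sub>0 h) = - (\<Sum>i\<in>UNIV. \<alpha> i p\<^sub>0 h + \<gamma> i p\<^sub>0 h)"
      by (simp add: sum_negf[symmetric])
    then show ?thesis unfolding D1_def by simp
  qed
  finally show ?thesis using s t z x by linarith
qed

text \<open>For \<open>v\<close> in the unit ball at \<open>p\<close>, go from
  \<open>p\<^sub>0\<close> to \<open>p + v\<close> and back from \<open>p\<close> to
  \<open>p\<^sub>0\<close>: \<open>separation\<close> bounds the former by \<nu>,
  \<open>G_start_lower\<close> the latter.\<close>

lemma dual_le_G_start:
  assumes p: "p \<in> D" shows "sc.dual_le p (G p\<^sub>0) K"
proof (rule sc.dual_leI_unit_ball[OF p])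
  fix v assume v: "v \<in> E" "sc.nrm p v < 1"
  have "v \<bullet> Hop p v < 1"
    using v(2) sc.nrm_sq[OF p, of v] sc.nrm_nonneg[OF p, of v] by (metis abs_of_nonneg abs_square_less_1)
  then have "p + v \<in> D" using sc.dikin[OF p v(1)] by blast
  then have "G p\<^sub>0 \<bullet> (p + v - p\<^sub>0) \<le> \<nu>"
    using separation(1)[of p\<^sub>0 "p + v"] start_in_D feasible_D unfolding D_def by blast
  moreover have "G p\<^sub>0 \<bullet> v = G p\<^sub>0 \<bullet> (p + v - p\<^sub>0) + G p\<^sub>0 \<bullet> (p\<^sub>0 - p)"
    by (simp add: inner_diff_right inner_add_right)
  ultimately show "G p\<^sub>0 \<bullet> v \<le> K"
    using G_start_lower[OF p] unfolding K_def \<nu>_eq by simp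
qed

text \<open>The length of the interval to which \<open>T_bounds\<close> confines t.\<close>

definition V :: real where "V = ln (5 * real CARD('k) * beta q)"

text \<open>Both \<open>p + v\<close> and \<open>p - v\<close> lie in the domain, and their
  t-coordinates differ by \<open>2 * T v\<close>, hence the factor 1/2.\<close>

lemma dual_le_c:
  assumes p: "p \<in> D" shows "sc.dual_le p c (V / 2)"
proof (rule sc.dual_leI_unit_ball[OF p])
  fix v assume v: "v \<in> E" "sc.nrm p v < 1"
  have d: "v \<bullet> Hop p v < 1"
    using v(2) sc.nrm_sq[OF p, of v] sc.nrm_nonneg[OF p, of v] by (metis abs_of_nonneg abs_square_less_1)
  then have 1: "p + v \<in> D" using sc.dikin[OF p v(1)] by blast
  have "- v \<in> E" using v(1) subspace_E by (rule subspace_neg[rotated])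
  moreover have "(- v) \<bullet> Hop p (- v) < 1" using d sc.H_linear[OF p] by (simp add: linear_simps)
  ultimately have 2: "p + (- v) \<in> D" using sc.dikin[OF p] by blast
  have "T (p + v) - T (p + (- v)) \<le> t_max q - ln (norm1 q / beta q)"
    using T_bounds[OF 1] T_bounds[OF 2] by linarith
  also have "\<dots> = V"
  proof -
    have "t_max q - ln (norm1 q / beta q) = ln ((5 * real CARD('k) * norm1 q) / (norm1 q / beta q))"
      unfolding t_max_def using card_ge_1 norm1_pos beta_pos by (subst ln_div) auto
    then show ?thesis unfolding V_def using norm1_pos by (simp add: mult.assoc)
  qed
  finally show "c \<bullet> v \<le> V / 2" unfolding inner_c by simp
qed

lemma \<Psi>_deriv: "p \<in> D \<Longrightarrow> (\<Psi> has_derivative (\<lambda>h. (0 + G p) \<bullet> h)) (at p)"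
  using barrier_deriv unfolding D_def by simp

lemma zero_in_E: "0 \<in> E"
  using subspace_E by (rule subspace_0)

lemma grad_eq: "p \<in> D \<Longrightarrow> grad \<omega> q \<theta> \<delta> \<phi>\<^sub>0 p = G p"
  unfolding grad_def using sc.gradient_on_eq[OF zero_in_E \<Psi>_deriv] by simp

lemma hess_inv_eq: "p \<in> D \<Longrightarrow> hess_inv \<omega> q \<theta> \<delta> \<phi>\<^sub>0 p y = sc.step p y"
  unfolding hess_inv_def using sc.hessian_inv_on_eq_step[OF zero_in_E \<Psi>_deriv] .

lemma local_norm_eq: "p \<in> D \<Longrightarrow> v \<in> E \<Longrightarrow> local_norm \<omega> q \<theta> \<delta> \<phi>\<^sub>0 p v = sc.nrm p v"
  unfolding local_norm_def sc.nrm_def hess_def using sc.hessian_on_eq_H[OF zero_in_E \<Psi>_deriv] by simp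

lemma bij_hess: "p \<in> D \<Longrightarrow> bij_betw (hess \<omega> q \<theta> \<delta> \<phi>\<^sub>0 p) E E"
  unfolding hess_def using sc.bij_hessian_on[OF zero_in_E \<Psi>_deriv] by simp

section \<open>The preliminary stage\<close>

abbreviation "pre \<equiv> pre_iter \<omega> q \<theta> \<delta> \<phi>\<^sub>0"
abbreviation "exits \<equiv> pre_exit \<omega> q \<theta> \<delta> \<phi>\<^sub>0"
abbreviation "npre \<equiv> pre_count \<omega> q \<theta> \<delta> \<phi>\<^sub>0"
abbreviation "\<eta>\<^sub>0 \<equiv> eta0 \<omega> q \<theta> \<delta> \<phi>\<^sub>0"
abbreviation "\<eta> \<equiv> eta \<omega> q \<theta> \<delta> \<phi>\<^sub>0"
abbreviation "mn \<equiv> main_iter \<omega> q \<theta> \<delta> \<phi>\<^sub>0"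
abbreviation "nmain \<equiv> main_count \<omega> q \<theta> \<delta> \<phi>\<^sub>0"
definition \<mu> :: "nat \<Rightarrow> real" where "\<mu> = mu TYPE('k)"

lemma \<mu>_simps: "\<mu> 0 = 1" "\<mu> (Suc i) = (1 - 1 / (8 * sqrt \<nu>)) * \<mu> i"
  unfolding \<mu>_def \<nu>_def by auto

lemma \<nu>_ge: "\<nu> \<ge> 1" "\<nu> > 0" "sqrt \<nu> \<ge> 1"
  unfolding \<nu>_eq by auto

lemma G_start_in_E: "G p\<^sub>0 \<in> E"
  using sc.g_in start_in_D by blast

lemma pre_Suc:
  assumes "pre i \<in> D"
  shows "pre (Suc i) = pre i - sc.step (pre i) (- (\<mu> (Suc i) *\<^sub>R G p\<^sub>0) + G (pre i))"
  using assms by (simp add: hess_inv_eq grad_eq start_in_D \<mu>_def)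

text \<open>With \<open>\<mu> 0 = 1\<close> the functional at the start is zero, so the start lies
  exactly on its path; each later iterate is a path-following step with negative \<kappa>.\<close>

lemma pre_near_path: "pre i \<in> D \<and> sc.dual_le (pre i) (- (\<mu> i *\<^sub>R G p\<^sub>0) + G (pre i)) (1 / 9)"
proof (induction i)
  case 0
  have "sc.dual_le p\<^sub>0 0 (1 / 9)"
    unfolding sc.dual_le_def using sc.nrm_nonneg[OF start_in_D] by simp
  then show ?case using start_in_D by (simp add: \<mu>_simps)
next
  case (Suc i)
  then have D: "pre i \<in> D" and n: "sc.dual_le (pre i) (- (\<mu> i *\<^sub>R G p\<^sub>0) + G (pre i)) (1 / 9)" by auto
  have E: "- (\<mu> i *\<^sub>R G p\<^sub>0) \<in> E"
    using subspace_E G_start_in_E by (intro subspace_neg subspace_scale)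
  have L': "- (\<mu> (Suc i) *\<^sub>R G p\<^sub>0) = (1 + - (1 / (8 * sqrt \<nu>))) *\<^sub>R (- (\<mu> i *\<^sub>R G p\<^sub>0))"
    by (simp add: \<mu>_simps)
  have a: "\<bar>- (1 / (8 * sqrt \<nu>))\<bar> = 1 / (8 * sqrt \<nu>)" using \<nu>_ge by simp
  show ?case
    unfolding pre_Suc[OF D]
    using sc.path_following_step[OF D E n dual_le_G[OF D] \<nu>_ge(1) a L'] by blast
qed

lemma exit_iff: "exits i \<longleftrightarrow> sc.dual_le (pre i) (G (pre i)) (1 / 6)"
proof -
  have D: "pre i \<in> D" using pre_near_path by blast
  have "sc.step (pre i) (G (pre i)) \<in> E" using sc.step_in[OF D sc.g_in[OF D]] .
  then have "exits i \<longleftrightarrow> sc.nrm (pre i) (sc.step (pre i) (G (pre i))) \<le> 1 / 6"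
    unfolding pre_exit_def grad_eq[OF D] hess_inv_eq[OF D] using local_norm_eq[OF D] by (simp add: not_less)
  then show ?thesis using sc.dual_le_iff_step[OF D sc.g_in[OF D]] by simp
qed

lemma K_ge: "K \<ge> 1"
proof -
  have "0 \<le> N * R" using R_pos max_dist_ge \<phi> by simp
  then have "0 \<le> 3 / 2 * real CARD('k) * (N * R)" by simp
  then show ?thesis unfolding K_def using ln_4kb card_ge_1 by linarith
qed

lemma \<mu>_le_exp: "0 \<le> \<mu> i \<and> \<mu> i \<le> exp (- (real i / (8 * sqrt \<nu>)))"
proof (induction i)
  case (Suc i)
  have "1 \<le> 8 * sqrt \<nu>" using \<nu>_ge(3) by linarith
  then have s: "1 / (8 * sqrt \<nu>) \<le> 1" using \<nu>_ge(2) by (auto simp: divide_le_eq)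
  have "(1 - 1 / (8 * sqrt \<nu>)) * \<mu> i \<le> exp (- (1 / (8 * sqrt \<nu>))) * exp (- (real i / (8 * sqrt \<nu>)))"
    using Suc s exp_ge_add_one_self[of "- (1 / (8 * sqrt \<nu>))"] by (intro mult_mono) auto
  also have "\<dots> = exp (- (real (Suc i) / (8 * sqrt \<nu>)))"
    by (simp add: exp_add[symmetric] add_divide_distrib)
  finally show ?case using Suc s by (simp add: \<mu>_simps)
qed (simp add: \<mu>_simps)

text \<open>Removing the term \<open>\<mu> i *\<^sub>R G p\<^sub>0\<close> costs
  \<open>\<mu> i * K\<close>, which is then at most 1/18, the difference between the tolerance 1/9
  and the exit threshold 1/6.\<close>

lemma exit_if_large:
  assumes i: "real i \<ge> 8 * sqrt \<nu> * ln (18 * K)"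
  shows "exits i"
proof -
  have D: "pre i \<in> D" using pre_near_path by blast
  have "ln (18 * K) \<le> real i / (8 * sqrt \<nu>)"
    using i \<nu>_ge by (simp add: pos_le_divide_eq mult.commute)
  then have "exp (- (real i / (8 * sqrt \<nu>))) \<le> exp (- ln (18 * K))" by simp
  also have "\<dots> = 1 / (18 * K)" using K_ge by (simp add: exp_minus inverse_eq_divide)
  finally have "\<mu> i \<le> 1 / (18 * K)" using \<mu>_le_exp[of i] by linarith
  then have "\<mu> i * K \<le> 1 / 18" using K_ge by (simp add: field_simps)
  moreover have "sc.dual_le (pre i) ((- (\<mu> i *\<^sub>R G p\<^sub>0) + G (pre i)) + \<mu> i *\<^sub>R G p\<^sub>0) (1 / 9 + \<mu> i * K)"
    using pre_near_path[of i] \<mu>_le_exp[of i] dual_le_G_start[OF D]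
    by (intro sc.dual_le_add sc.dual_le_scale) auto
  ultimately have "sc.dual_le (pre i) ((- (\<mu> i *\<^sub>R G p\<^sub>0) + G (pre i)) + \<mu> i *\<^sub>R G p\<^sub>0) (1 / 6)"
    by (elim sc.dual_le_mono[OF D]) simp
  then show ?thesis unfolding exit_iff by simp
qed

lemma exit_exists: "\<exists>i. exits i" and npre_le: "real npre \<le> 8 * sqrt \<nu> * ln (18 * K) + 1"
proof -
  define i where "i = nat \<lceil>8 * sqrt \<nu> * ln (18 * K)\<rceil>"
  have "ln (18 * K) \<ge> 0" using K_ge by simp
  then have B: "8 * sqrt \<nu> * ln (18 * K) \<ge> 0" using \<nu>_ge by simp
  have "exits i" by (rule exit_if_large) (simp add: i_def real_nat_ceiling_ge)
  then show "\<exists>i. exits i" by blast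
  have "npre \<le> i" unfolding pre_count_def using \<open>exits i\<close> by (rule Least_le)
  moreover have "real i \<le> 8 * sqrt \<nu> * ln (18 * K) + 1" unfolding i_def using B by linarith
  ultimately show "real npre \<le> 8 * sqrt \<nu> * ln (18 * K) + 1" by linarith
qed

lemma exit_npre: "exits npre"
  unfolding pre_count_def using exit_exists by (rule LeastI_ex)

lemma V_ge: "V \<ge> 1"
proof -
  have "beta q \<ge> 1" using card_ge_1 beta_ge_card by linarith
  then have "1 * 1 \<le> real CARD('k) * beta q" using card_ge_1 by (intro mult_mono) auto
  then have "exp 1 \<le> 5 * real CARD('k) * beta q" using exp_le by linarith
  moreover from this have "0 < 5 * real CARD('k) * beta q" using exp_gt_zero[of "1::real"] by linarith
  ultimately show ?thesis unfolding V_def by (simp add: ln_ge_iff)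
qed

text \<open>By its definition \<open>\<eta>\<^sub>0 *\<^sub>R c\<close> has dual norm 1/12, which
  together with 1/6 from the exit condition makes 1/4. The lower bound on
  \<open>\<eta>\<^sub>0\<close> is \<open>dual_le_c\<close>: the dual norm of \<open>c\<close> is at
  most \<open>V / 2\<close>, and 12 times that is \<open>6 * V\<close>.\<close>

lemma \<eta>\<^sub>0_facts: "\<eta>\<^sub>0 > 0" "\<eta>\<^sub>0 \<ge> 1 / (6 * V)" "sc.dual_le (pre npre) (\<eta>\<^sub>0 *\<^sub>R c + G (pre npre)) (1 / 4)"
proof -
  define p where "p = pre npre"
  have D: "p \<in> D" unfolding p_def using pre_near_path by blast
  define r where "r = sc.nrm p (sc.step p c)"
  have \<eta>: "\<eta>\<^sub>0 = inverse (12 * r)"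
    unfolding eta0_def r_def p_def[symmetric] hess_inv_eq[OF D]
    using local_norm_eq[OF D sc.step_in[OF D c_in_E]] by simp
  have "sc.step p c \<noteq> 0"
  proof
    assume "sc.step p c = 0"
    then have "c = 0" using sc.H_step[OF D c_in_E] sc.H_linear[OF D] by (simp add: linear_simps)
    then show False using inner_c[of c] by (simp add: cost_def zero_prod_def)
  qed
  then have r: "r > 0" unfolding r_def sc.nrm_def using sc.H_pos[OF D] by simp
  have rV: "r \<le> V / 2" unfolding r_def using dual_le_c[OF D] sc.dual_le_iff_step[OF D c_in_E] V_ge by simp
  show e0: "\<eta>\<^sub>0 > 0" unfolding \<eta> using r by simp
  have "1 / (6 * V) \<le> 1 / (12 * r)" using r rV by (intro divide_left_mono) auto
  then show "\<eta>\<^sub>0 \<ge> 1 / (6 * V)" unfolding \<eta> by (simp add: inverse_eq_divide)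
  have "sc.dual_le p c r" unfolding r_def using sc.dual_le_iff_step[OF D c_in_E] sc.nrm_nonneg[OF D] by simp
  then have "sc.dual_le p (\<eta>\<^sub>0 *\<^sub>R c) (\<eta>\<^sub>0 * r)" using e0 by (intro sc.dual_le_scale) auto
  moreover have "\<eta>\<^sub>0 * r = 1 / 12" unfolding \<eta> using r by (simp add: field_simps)
  ultimately have "sc.dual_le p (\<eta>\<^sub>0 *\<^sub>R c + G p) (1 / 12 + 1 / 6)"
    using exit_npre unfolding exit_iff p_def[symmetric] by (intro sc.dual_le_add) auto
  then show "sc.dual_le (pre npre) (\<eta>\<^sub>0 *\<^sub>R c + G (pre npre)) (1 / 4)" unfolding p_def by simp
qed

section \<open>The main stage and the accuracy of its output\<close>

lemma mn_0: "mn 0 = pre npre - sc.step (pre npre) (\<eta>\<^sub>0 *\<^sub>R c + G (pre npre))"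
  using pre_near_path[of npre] by (simp add: main_start_def grad_eq hess_inv_eq)

lemma mn_Suc:
  assumes "mn i \<in> D"
  shows "mn (Suc i) = mn i - sc.step (mn i) (\<eta> (Suc i) *\<^sub>R c + G (mn i))"
  using assms by (simp add: grad_eq hess_inv_eq del: eta.simps)

lemma mn_near_path: "mn i \<in> D \<and> sc.dual_le (mn i) (\<eta> i *\<^sub>R c + G (mn i)) (1 / 9)"
proof (induction i)
  case 0
  have D: "pre npre \<in> D" using pre_near_path by blast
  have "\<eta>\<^sub>0 *\<^sub>R c \<in> E" using subspace_E c_in_E by (intro subspace_scale)
  from sc.newton_contraction[OF D this \<eta>\<^sub>0_facts(3)] show ?case
    unfolding mn_0 by (simp add: power2_eq_square)
next
  case (Suc i)
  then have D: "mn i \<in> D" and n: "sc.dual_le (mn i) (\<eta> i *\<^sub>R c + G (mn i)) (1 / 9)" by auto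
  have E: "\<eta> i *\<^sub>R c \<in> E" using subspace_E c_in_E by (intro subspace_scale)
  have L': "\<eta> (Suc i) *\<^sub>R c = (1 + 1 / (8 * sqrt \<nu>)) *\<^sub>R (\<eta> i *\<^sub>R c)"
    by (simp add: \<nu>_def)
  have a: "\<bar>1 / (8 * sqrt \<nu>)\<bar> = 1 / (8 * sqrt \<nu>)" using \<nu>_ge by simp
  show ?case
    unfolding mn_Suc[OF D]
    using sc.path_following_step[OF D E n dual_le_G[OF D] \<nu>_ge(1) a L'] by blast
qed

lemma \<eta>_eq: "\<eta> i = (1 + 1 / (8 * sqrt \<nu>)) ^ i * \<eta>\<^sub>0"
  by (induction i) (auto simp: \<nu>_def)

text \<open>For \<open>x \<le> 1 / 8\<close> one has \<open>ln (1 + x) \<ge> 4 / 5 * x\<close>, and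
  4/5 * 1/8 = 1/10 is the origin of the 10 in the number of main iterations.\<close>

lemma growth: "exp (real i / (10 * sqrt \<nu>)) \<le> (1 + 1 / (8 * sqrt \<nu>)) ^ i"
proof -
  define x where "x = 1 / (8 * sqrt \<nu>)"
  have x: "0 < x" "x \<le> 1 / 8" unfolding x_def using \<nu>_ge by (auto simp: field_simps)
  have "x\<^sup>2 / (2 * (1 - \<bar>x\<bar>)) \<le> x / 5"
  proof -
    have "x * (5 * x) \<le> x * (2 * (1 - x))" using x by (intro mult_left_mono) auto
    then show ?thesis using x by (simp add: field_simps power2_eq_square)
  qed
  then have "4 / 5 * x \<le> ln (1 + x)" using ln_one_plus_lower[of x] x by simp
  moreover have "4 / 5 * x = 1 / (10 * sqrt \<nu>)" unfolding x_def by simp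
  ultimately have "exp (1 / (10 * sqrt \<nu>)) \<le> exp (ln (1 + x))" by (simp only: exp_le_cancel_iff)
  also have "exp (ln (1 + x)) = 1 + x" using x by simp
  finally have "exp (1 / (10 * sqrt \<nu>)) \<le> 1 + x" .
  then have "exp (1 / (10 * sqrt \<nu>)) ^ i \<le> (1 + x) ^ i" by (intro power_mono) auto
  then show ?thesis unfolding x_def by (simp add: exp_of_nat_mult[symmetric])
qed

text \<open>The factor by which \<open>\<eta>\<close> has to grow from \<open>\<eta>\<^sub>0\<close>
  until the gap bound \<open>6 / 5 * \<nu> / \<eta>\<close> falls to \<delta>/2.\<close>

definition A :: real where "A = 6 / 5 * (\<nu> / (\<eta>\<^sub>0 * (\<delta> / 2)))"

lemma A_pos: "A > 0"
  unfolding A_def using \<eta>\<^sub>0_facts(1) \<nu>_ge \<delta> by simp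

lemma nmain_ge: "real nmain \<ge> 10 * sqrt \<nu> * ln A"
  unfolding main_count_def A_def \<nu>_def by (rule LeastI_ex) (rule real_arch_simple)

text \<open>A nonnegative majorant \<open>B\<close> stands in for the threshold, because the sign of
  \<open>ln A\<close> is not known and rounding up by less than 1 is valid only from 0 on.\<close>

lemma nmain_le:
  assumes "10 * sqrt \<nu> * ln A \<le> B" "B \<ge> 0"
  shows "real nmain \<le> B + 1"
proof -
  have "10 * sqrt \<nu> * ln A \<le> real (nat \<lceil>B\<rceil>)"
    using assms(1) real_nat_ceiling_ge[of B] by linarith
  then have "nmain \<le> nat \<lceil>B\<rceil>"
    unfolding main_count_def A_def \<nu>_def by (rule Least_le)
  then show ?thesis using assms(2) by linarith
qed

lemma \<eta>_final: "6 / 5 * \<nu> / \<eta> nmain \<le> \<delta> / 2"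
proof -
  have "ln A \<le> real nmain / (10 * sqrt \<nu>)"
    using nmain_ge \<nu>_ge by (simp add: pos_le_divide_eq mult.commute)
  then have "A \<le> exp (real nmain / (10 * sqrt \<nu>))" using A_pos by (metis exp_le_cancel_iff exp_ln)
  then have "A \<le> (1 + 1 / (8 * sqrt \<nu>)) ^ nmain" using growth[of nmain] by linarith
  then have "A * \<eta>\<^sub>0 \<le> \<eta> nmain" unfolding \<eta>_eq using \<eta>\<^sub>0_facts(1) by (intro mult_right_mono) auto
  moreover have "A * \<eta>\<^sub>0 = 6 / 5 * \<nu> / (\<delta> / 2)" unfolding A_def using \<eta>\<^sub>0_facts(1) by simp
  ultimately have le: "6 / 5 * \<nu> / (\<delta> / 2) \<le> \<eta> nmain" by simp
  moreover have "6 / 5 * \<nu> / (\<delta> / 2) > 0" using \<nu>_ge \<delta> by (intro divide_pos_pos) auto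
  ultimately have "\<eta> nmain > 0" by linarith
  then show ?thesis using le \<delta> by (simp add: field_simps)
qed

lemma near_path_value:
  assumes p: "p \<in> D" and n: "sc.dual_le p (e *\<^sub>R c + G p) (1 / 9)" and e: "e > 0"
    and y: "y \<in> E" "feasible y"
  shows "T p \<le> T y + 6 / 5 * \<nu> / e"
proof -
  have d: "y - p \<in> E" using subspace_E y sc.D_sub[OF p] by (intro subspace_diff)
  have "e * (T p - T y) = - ((e *\<^sub>R c + G p) \<bullet> (y - p)) + G p \<bullet> (y - p)"
    by (simp add: inner_add_left inner_c algebra_simps)
  also have "\<dots> \<le> 1 / 9 * sc.nrm p (y - p) + G p \<bullet> (y - p)"
    using sc.dual_le_abs[OF p n d] by linarith
  also have "\<dots> \<le> 6 / 5 * \<nu>"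
    using separation(2)[of p y] p y unfolding nrm_eq D_def by simp
  finally show ?thesis using e by (simp add: field_simps)
qed

text \<open>The comparison point \<open>y\<close> lifts the near-minimizer \<open>x\<close> of the
  ball: t is its objective value and z its normalized terms, so all exponential constraints and the
  constraint on the sum of z are active. The gap to \<open>y\<close> and the error of
  \<open>x\<close> are \<delta>/2 each.\<close>

lemma output_error: "F_obj \<omega> q \<theta> (x_out \<omega> q \<theta> \<delta> \<phi>\<^sub>0) \<le> F_opt \<omega> q \<theta> + \<delta>"
proof -
  obtain x where x: "x \<in> W_space \<omega> \<theta>" "norm x \<le> R" "F_obj \<omega> q \<theta> x \<le> F_opt \<omega> q \<theta> + \<delta> / 2"
    using near_minimizer_in_ball[OF \<theta> q \<phi>(2,1) \<delta>] unfolding R_def by blast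
  define s where "s = (\<Sum>i\<in>UNIV. q $ i * exp ((\<omega> i - \<theta>) \<bullet> x))"
  have s: "s > 0" unfolding s_def using q by (intro sum_pos) auto
  define y :: "('n, 'k) point" where "y = (x, (\<chi> i. q $ i * exp ((\<omega> i - \<theta>) \<bullet> x) / s), ln s)"
  have Fx: "F_obj \<omega> q \<theta> x = ln s" unfolding F_obj_def s_def by simp
  have "F_opt \<omega> q \<theta> \<le> F_obj \<omega> q \<theta> 0"
    unfolding F_opt_def using F_obj_lower_bound[OF \<theta> q] by (intro cINF_lower bdd_belowI) auto
  also have "\<dots> = ln (norm1 q)" unfolding F_obj_def norm1_pos_weights[OF q] by simp
  finally have lns: "ln s \<le> ln (norm1 q) + 1 / 2" using x(3) Fx \<delta> by simp
  \<comment> \<open>The factor 5k in \<open>t_max\<close> leaves room above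
    \<open>ln (norm1 q)\<close> for the error, here at most 1/2, so \<open>y\<close> respects the
    upper bound on t.\<close>
  have "1 \<le> ln (5 * real CARD('k))"
    using exp_le card_ge_1 by (subst ln_ge_iff) linarith+
  moreover have "t_max q = ln (5 * real CARD('k)) + ln (norm1 q)"
    unfolding t_max_def using card_ge_1 norm1_pos by (subst ln_mult) auto
  ultimately have t: "slack_t y \<ge> 0" unfolding slack_t_def y_def using lns by simp
  have qi: "q $ i > 0" for i using q by blast
  have "w i y = 0" for i
    unfolding w_def y_def using qi[of i] s by (simp add: ln_div ln_mult)
  moreover have "Z y i > 0" for i unfolding y_def using qi[of i] s by simp
  moreover have "slack_z y = 0"
    unfolding slack_z_def y_def using s by (simp add: sum_divide_distrib[symmetric] s_def[symmetric])
  moreover have "slack_x y \<ge> 0"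
    using x(2) power_mono[OF x(2), of 2] unfolding slack_x_def y_def by (simp add: power2_norm_eq_inner)
  ultimately have f: "feasible y" using t by simp
  have yE: "y \<in> E" unfolding mem_E y_def using x by simp
  have D: "mn nmain \<in> D" and n: "sc.dual_le (mn nmain) (\<eta> nmain *\<^sub>R c + G (mn nmain)) (1 / 9)"
    using mn_near_path by auto
  have \<eta>: "\<eta> nmain > 0" unfolding \<eta>_eq using \<eta>\<^sub>0_facts(1) \<nu>_ge by (intro mult_pos_pos zero_less_power add_pos_pos) auto
  have "F_obj \<omega> q \<theta> (x_out \<omega> q \<theta> \<delta> \<phi>\<^sub>0) \<le> T (mn nmain)"
    unfolding x_out_def by (rule F_obj_le_T[OF D])
  also have "\<dots> \<le> T y + 6 / 5 * \<nu> / \<eta> nmain" by (rule near_path_value[OF D n \<eta> yE f])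
  also have "\<dots> \<le> T y + \<delta> / 2" using \<eta>_final by simp
  also have "T y = F_obj \<omega> q \<theta> x" unfolding y_def Fx by simp
  finally show ?thesis using x(3) by simp
qed

section \<open>The iteration count\<close>

text \<open>Both logarithms are dominated by that of the common quantity \<open>B\<close>: with
  \<open>M = k * (P * L)\<close> one gets \<open>18 * K \<le> 216 * M\<close> and \<open>A\<close>
  at most 252/5 times \<open>k * (L / \<delta>)\<close>, each below
  \<open>B = 3600 * (M * (k * (L / \<delta>)))\<close>. The stages then need
  \<open>(8 + 10) * sqrt \<nu> * ln B\<close> steps, plus 3 for two roundings and the step between
  the stages. From k at least 2 follow \<open>\<nu> \<le> 7 / 2 * k\<close> and
  \<open>sqrt \<nu> \<le> 15 / 8 * sqrt k\<close>, so the total factor is 18 * 15/8 + 3 = 36.75,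
  within 41.\<close>

lemma iterations_le:
  "real (iterations \<omega> q \<theta> \<delta> \<phi>\<^sub>0) \<le> iter_bound (CARD('k), CARD('n), N, \<phi>\<^sub>0, \<delta>, beta q)"
proof -
  define k where "k = real CARD('k)"
  define L where "L = ln (5 * k * beta q / \<delta>)"
  define P where "P = real CARD('n) * (N / \<phi>\<^sub>0)"
  define B where "B = 3600 * k\<^sup>2 * real CARD('n) * (N / \<phi>\<^sub>0) * (1 / \<delta>) * L\<^sup>2"
  have k: "k \<ge> 2" unfolding k_def using two_le_card by simp
  have b: "beta q \<ge> k" unfolding k_def using beta_ge_card .
  have P1: "P \<ge> 1"
    unfolding P_def using card_ge_1 max_dist_ge \<phi> by (intro mult_ge1_I) (auto simp: field_simps)
  have kb: "k * beta q \<ge> 4" using mult_mono[of 2 k 2 "beta q"] k b by simp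
  have d: "x \<le> x / \<delta>" if "x \<ge> 0" for x
    using that \<delta> by (simp add: pos_le_divide_eq mult_left_le)
  have VL: "V \<le> L"
    unfolding V_def L_def k_def[symmetric] using kb d[of "5 * k * beta q"] by (subst ln_le_cancel_iff) linarith+
  have L1: "L \<ge> 1" using VL V_ge by linarith
  have L4: "ln (4 * k * beta q) \<le> L"
  proof -
    have "ln (4 * k * beta q) \<le> V" unfolding V_def k_def[symmetric] using kb by (subst ln_le_cancel_iff) auto
    then show ?thesis using VL by simp
  qed
  have NR: "N * R \<le> P * L"
  proof -
    have "4 * beta q / \<delta> \<le> 5 * k * beta q / \<delta>"
      using k b \<delta> by (intro divide_right_mono mult_right_mono) auto
    moreover have "4 * beta q / \<delta> > 0" using k b \<delta> by simp
    ultimately have "ln (4 * beta q / \<delta>) \<le> L" unfolding L_def by (subst ln_le_cancel_iff) auto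
    moreover have "N * R = P * ln (4 * beta q / \<delta>)" unfolding R_def radius_def P_def by simp
    ultimately show ?thesis using P1 by (simp add: mult_left_mono)
  qed
  define M where "M = k * (P * L)"
  have PLge: "P * L \<ge> L" using P1 L1 by (simp add: mult_le_cancel_right1)
  have PL1: "P * L \<ge> 1" using PLge L1 by linarith
  have Mk: "M \<ge> k" unfolding M_def using PL1 k by (simp add: mult_le_cancel_left1)
  have M2L: "M \<ge> 2 * L" unfolding M_def using PLge k L1 by (intro mult_mono) auto
  have "K = 6 * k + 4 + 3 / 2 * (k * (N * R)) + 5 * ln (4 * k * beta q)" unfolding K_def k_def by simp
  also have "\<dots> \<le> 6 * M + 2 * M + 3 / 2 * M + 5 / 2 * M"
  proof -
    have "k * (N * R) \<le> M" unfolding M_def using NR k by (intro mult_left_mono) auto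
    then show ?thesis using Mk M2L L4 k by linarith
  qed
  finally have K: "18 * K \<le> 216 * M" by simp
  have Be: "B = 3600 * (M * (k * (L / \<delta>)))" unfolding B_def M_def P_def by (simp add: power2_eq_square)
  have kd: "2 \<le> k * (L / \<delta>)"
    using mult_mono[of 2 k 1 "L / \<delta>"] k L1 d[of L] by simp
  have "M * 2 \<le> M * (k * (L / \<delta>))" using kd Mk k by (intro mult_left_mono) auto
  then have BM: "B \<ge> 7200 * M" unfolding Be by linarith
  have KB: "18 * K \<le> B" using K BM Mk k by linarith
  have nu: "\<nu> \<le> 7 / 2 * k" unfolding \<nu>_eq k_def[symmetric] using k by simp
  have AB: "A \<le> B"
  proof -
    have "1 / \<eta>\<^sub>0 \<le> 6 * V"
      using \<eta>\<^sub>0_facts(1,2) V_ge by (simp add: field_simps)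
    then have "1 / \<eta>\<^sub>0 \<le> 6 * L" using VL by linarith
    then have "12 / 5 * (\<nu> / \<delta>) * (1 / \<eta>\<^sub>0) \<le> 12 / 5 * ((7 / 2 * k) / \<delta>) * (6 * L)"
      using nu \<nu>_ge \<delta> \<eta>\<^sub>0_facts(1) L1 k by (intro mult_mono divide_right_mono) auto
    moreover have "A = 12 / 5 * (\<nu> / \<delta>) * (1 / \<eta>\<^sub>0)" unfolding A_def by simp
    moreover have "12 / 5 * ((7 / 2 * k) / \<delta>) * (6 * L) = 252 / 5 * (k * (L / \<delta>))" by simp
    moreover have "k * (L / \<delta>) * 1 \<le> k * (L / \<delta>) * M"
      using Mk k L1 \<delta> by (intro mult_left_mono) auto
    ultimately show ?thesis unfolding Be using kd Mk k by (simp add: mult_ac)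
  qed
  have B1: "B \<ge> exp 1" using BM Mk k exp_le by linarith
  have lB: "ln B \<ge> 1" using B1 exp_gt_zero[of 1] by (subst ln_ge_iff) linarith+
  have s: "sqrt \<nu> \<le> 15 / 8 * sqrt k"
  proof (rule real_le_lsqrt)
    show "\<nu> \<le> (15 / 8 * sqrt k)\<^sup>2" using nu k by (simp add: power_mult_distrib power2_eq_square)
  qed (use k in auto)
  have sk: "sqrt k \<ge> 1" using k by simp
  have lK: "ln (18 * K) \<le> ln B" using KB K_ge by (subst ln_le_cancel_iff) auto
  have lA: "ln A \<le> ln B" using AB A_pos by (subst ln_le_cancel_iff) auto
  have 1: "sqrt \<nu> * ln B \<le> 15 / 8 * sqrt k * ln B" using s lB by (intro mult_right_mono) auto
  have "real nmain \<le> 10 * sqrt \<nu> * ln B + 1"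
    using lA \<nu>_ge lB by (intro nmain_le mult_left_mono) auto
  moreover have "8 * sqrt \<nu> * ln (18 * K) \<le> 8 * sqrt \<nu> * ln B"
    using lK \<nu>_ge by (intro mult_left_mono) auto
  ultimately have "real (iterations \<omega> q \<theta> \<delta> \<phi>\<^sub>0) \<le> 18 * (sqrt \<nu> * ln B) + 3"
    unfolding iterations_def using npre_le by simp
  also have "\<dots> \<le> 18 * (15 / 8 * sqrt k * ln B) + 3 * (sqrt k * ln B)"
  proof -
    have "1 * 1 \<le> sqrt k * ln B" using sk lB by (intro mult_mono) auto
    then show ?thesis using 1 by simp
  qed
  also have "\<dots> \<le> 41 * (sqrt k * ln B)"
  proof -
    have "0 \<le> sqrt k * ln B" using sk lB by simp
    then show ?thesis by simp
  qed
  finally show ?thesis unfolding iter_bound_def B_def L_def k_def by simp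
qed

lemma params_in_range: "(CARD('k), CARD('n), N, \<phi>\<^sub>0, \<delta>, beta q) \<in> param_range"
  unfolding param_range_def using two_le_card max_dist_ge \<phi> \<delta> beta_ge_card card_ge_1 by auto

lemma pre_newton_step:
  "pre (Suc i) = newton_step E (pre_fun \<omega> q \<theta> \<delta> \<phi>\<^sub>0 (Suc i)) (pre i)"
proof -
  have D: "pre i \<in> D" using pre_near_path by blast
  have E: "- (\<mu> (Suc i) *\<^sub>R G p\<^sub>0) \<in> E"
    using subspace_E G_start_in_E by (intro subspace_neg subspace_scale)
  have "(pre_fun \<omega> q \<theta> \<delta> \<phi>\<^sub>0 (Suc i) has_derivative (\<lambda>h. (- (\<mu> (Suc i) *\<^sub>R G p\<^sub>0) + G p) \<bullet> h)) (at p)" if "p \<in> D" for p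
  proof -
    have "((\<lambda>p. - \<mu> (Suc i) * (G p\<^sub>0 \<bullet> p) + \<Psi> p) has_derivative (\<lambda>h. - \<mu> (Suc i) * (G p\<^sub>0 \<bullet> h) + G p \<bullet> h)) (at p)"
      using that barrier_deriv unfolding D_def
      by (intro has_derivative_add has_derivative_mult_right bounded_linear_imp_has_derivative[OF bounded_linear_inner_right]) auto
    then show ?thesis unfolding pre_fun_def grad_eq[OF start_in_D] \<mu>_def[symmetric]
      by (simp add: inner_add_left inner_diff_left)
  qed
  from sc.newton_step_eq[OF E this D] show ?thesis unfolding pre_Suc[OF D] by simp
qed

lemma main_fun_newton_step:
  assumes D: "p \<in> D"
  shows "newton_step E (main_fun \<omega> q \<theta> \<delta> \<phi>\<^sub>0 i) p = p - sc.step p (\<eta> i *\<^sub>R c + G p)"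
proof -
  have E: "\<eta> i *\<^sub>R c \<in> E" using subspace_E c_in_E by (intro subspace_scale)
  have "(main_fun \<omega> q \<theta> \<delta> \<phi>\<^sub>0 i has_derivative (\<lambda>h. (\<eta> i *\<^sub>R c + G p) \<bullet> h)) (at p)" if "p \<in> D" for p
  proof -
    have "((\<lambda>p. \<eta> i * (c \<bullet> p) + \<Psi> p) has_derivative (\<lambda>h. \<eta> i * (c \<bullet> h) + G p \<bullet> h)) (at p)"
      using that barrier_deriv unfolding D_def
      by (intro has_derivative_add has_derivative_mult_right bounded_linear_imp_has_derivative[OF bounded_linear_inner_right]) auto
    then show ?thesis unfolding main_fun_def by (simp add: inner_add_left)
  qed
  from sc.newton_step_eq[OF E this D] show ?thesis .
qed

end

text \<open>The principal filter makes this an inequality on the whole parameter range. With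
  \<open>y\<close> the argument of the logarithm in \<open>iter_rate\<close>, the one in
  \<open>iter_bound\<close> is at most \<open>32400 * y\<^sup>2\<close>; since
  \<open>y \<ge> 2\<close>, the constant is absorbed into a power of \<open>y\<close>, and the power
  17 becomes a factor in front of the logarithm.\<close>

lemma iter_bound_bigo: "iter_bound \<in> O[principal param_range](iter_rate)"
proof (rule bigoI[where c = "41 * 17"])
  have "norm (iter_bound x) \<le> 41 * 17 * norm (iter_rate x)" if x: "x \<in> param_range" for x
  proof -
    obtain k n N \<phi> \<delta> \<beta> where xe: "x = (k, n, N, \<phi>, \<delta>, \<beta>)" by (cases x) auto
    have h: "2 \<le> k" "1 \<le> n" "0 < \<phi>" "\<phi> \<le> N" "0 < \<delta>" "\<delta> < 1" "real k \<le> \<beta>"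
      using x unfolding xe param_range_def by auto
    define c where "c = N / \<phi> * (1 / \<delta>)"
    define l where "l = ln (real k * \<beta> / \<delta>)"
    define y where "y = real k * real n * (N / \<phi>) * (1 / \<delta>) * l"
    have c1: "c \<ge> 1" unfolding c_def using h by (intro mult_ge1_I) (auto simp: field_simps)
    have kb: "4 \<le> real k * \<beta>"
      using mult_mono[of 2 "real k" 2 \<beta>] h by simp
    then have kbd: "4 \<le> real k * \<beta> / \<delta>" using h by (simp add: pos_le_divide_eq)
    have ln4: "(1::real) \<le> ln 4"
    proof -
      have "exp 1 \<le> (4::real)" using exp_le by linarith
      then show ?thesis by (subst ln_ge_iff) auto
    qed
    have l1: "l \<ge> 1" using ln4 kbd unfolding l_def by (smt (verit) ln_le_cancel_iff)
    have l5: "ln (5 * real k * \<beta> / \<delta>) \<le> 3 * l"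
    proof -
      \<comment> \<open>5u is at most u^3 for u at least 4; this moves the factor 5 out of the inner
        logarithm as a factor 3.\<close>
      have "5 * real k * \<beta> / \<delta> \<le> (real k * \<beta> / \<delta>) ^ 3"
      proof -
        have "5 * 1 \<le> (real k * \<beta> / \<delta>) * (real k * \<beta> / \<delta>)"
          using mult_mono[of 4 "real k * \<beta> / \<delta>" 4 "real k * \<beta> / \<delta>"] kbd by simp
        then have "5 * (real k * \<beta> / \<delta>) \<le> (real k * \<beta> / \<delta>) * (real k * \<beta> / \<delta>) * (real k * \<beta> / \<delta>)"
          using kbd by (intro mult_right_mono) auto
        then show ?thesis by (simp add: power3_eq_cube)
      qed
      then have "ln (5 * real k * \<beta> / \<delta>) \<le> ln ((real k * \<beta> / \<delta>) ^ 3)"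
        using kbd by (subst ln_le_cancel_iff) auto
      also have "\<dots> = 3 * l" unfolding l_def using kbd by (subst ln_realpow) auto
      finally show ?thesis .
    qed
    have l50: "ln (5 * real k * \<beta> / \<delta>) \<ge> 1"
    proof -
      have "1 * (real k * \<beta> / \<delta>) \<le> 5 * (real k * \<beta> / \<delta>)" using kbd by (intro mult_right_mono) auto
      then have "real k * \<beta> / \<delta> \<le> 5 * real k * \<beta> / \<delta>" by simp
      then have "l \<le> ln (5 * real k * \<beta> / \<delta>)" unfolding l_def using kbd by (subst ln_le_cancel_iff) auto
      then show ?thesis using l1 by simp
    qed
    have kn: "real k * real n \<ge> 2" using mult_mono[of 2 "real k" 1 "real n"] h by simp
    have ye: "y = (real k * real n) * c * l" unfolding y_def c_def by simp
    have y2: "y \<ge> 2"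
    proof -
      have "2 * 1 * 1 \<le> (real k * real n) * c * l" using kn c1 l1 by (intro mult_mono) auto
      then show ?thesis unfolding ye by simp
    qed
    define B where "B = 3600 * (real k)\<^sup>2 * real n * (N / \<phi>) * (1 / \<delta>) * (ln (5 * real k * \<beta> / \<delta>))\<^sup>2"
    have Be: "B = 3600 * ((real k)\<^sup>2 * real n * c) * (ln (5 * real k * \<beta> / \<delta>))\<^sup>2"
      unfolding B_def c_def by simp
    have a1: "(real k)\<^sup>2 * real n * c \<le> (real k * real n)\<^sup>2 * c\<^sup>2"
    proof -
      have "real n * c \<le> (real n)\<^sup>2 * c\<^sup>2"
        using c1 h by (intro mult_mono) (auto simp: self_le_power)
      then show ?thesis by (simp add: power_mult_distrib mult.assoc mult_left_mono)
    qed
    have a2: "(ln (5 * real k * \<beta> / \<delta>))\<^sup>2 \<le> (3 * l)\<^sup>2"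
      using l5 l50 by (intro power_mono) auto
    have "B \<le> 3600 * ((real k * real n)\<^sup>2 * c\<^sup>2) * (3 * l)\<^sup>2"
      unfolding Be by (intro mult_mono[OF mult_left_mono[OF a1] a2]) auto
    also have "\<dots> = 32400 * y\<^sup>2" unfolding ye by (simp add: power_mult_distrib)
    \<comment> \<open>2^15 = 32768 is the smallest power of 2 above 32400 = 3600 * 9.\<close>
    also have "\<dots> \<le> y ^ 15 * y\<^sup>2"
    proof (rule mult_right_mono)
      have "(2::real) ^ 15 \<le> y ^ 15" using y2 by (intro power_mono) auto
      then show "32400 \<le> y ^ 15" by simp
    qed simp
    also have "\<dots> = y ^ 17" by (simp flip: power_add)
    finally have By: "B \<le> y ^ 17" .
    have B1: "B \<ge> 1"
    proof -
      have "1 * (1 * 1 * 1) * 1 \<le> 3600 * ((real k)\<^sup>2 * real n * c) * (ln (5 * real k * \<beta> / \<delta>))\<^sup>2"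
        using h c1 l50 by (intro mult_mono) (auto simp: one_le_power)
      then show ?thesis unfolding Be by simp
    qed
    have "ln B \<le> ln (y ^ 17)" using By B1 y2 by (subst ln_le_cancel_iff) auto
    also have "\<dots> = 17 * ln y" using y2 by (subst ln_realpow) auto
    finally have "ln B \<le> 17 * ln y" .
    then have "41 * sqrt (real k) * ln B \<le> 41 * sqrt (real k) * (17 * ln y)"
      by (intro mult_left_mono) auto
    moreover have "ln B \<ge> 0" "ln y \<ge> 0" using B1 y2 by auto
    moreover have "iter_bound x = 41 * sqrt (real k) * ln B" "iter_rate x = sqrt (real k) * ln y"
      unfolding xe iter_bound_def iter_rate_def B_def y_def l_def by simp_all
    ultimately show ?thesis by (simp add: abs_mult mult_ac)
  qed
  then show "\<forall>\<^sub>F x in principal param_range. norm (iter_bound x) \<le> 41 * 17 * norm (iter_rate x)"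
    by (simp add: eventually_principal)
qed

theorem theorem1p9:
  fixes \<omega> :: "'k::finite \<Rightarrow> real ^ 'n::finite"
    and q :: "real ^ 'k"
    and \<theta> :: "real ^ 'n"
    and \<delta> \<phi>\<^sub>0 :: real
  assumes "card (range \<omega>) \<ge> 2"
    and "\<theta> \<in> convex hull (range \<omega>)"
    and "\<forall>i. q $ i > 0"
    and "0 < \<delta>" and "\<delta> < 1"
    and "0 < \<phi>\<^sub>0" and "\<phi>\<^sub>0 \<le> facet_gap (range \<omega>)"
  shows
    \<comment> \<open>the algorithm terminates and all its steps are well-defined\<close>
    "(\<exists>i. pre_exit \<omega> q \<theta> \<delta> \<phi>\<^sub>0 i) \<and>
     (\<forall>p \<in> pre_iter \<omega> q \<theta> \<delta> \<phi>\<^sub>0 ` {..pre_count \<omega> q \<theta> \<delta> \<phi>\<^sub>0} \<union>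
           main_iter \<omega> q \<theta> \<delta> \<phi>\<^sub>0 ` {..main_count \<omega> q \<theta> \<delta> \<phi>\<^sub>0}.
        p \<in> interior_D \<omega> q \<theta> \<delta> \<phi>\<^sub>0 \<and>
        bij_betw (hess \<omega> q \<theta> \<delta> \<phi>\<^sub>0 p) (E_space \<omega> \<theta>) (E_space \<omega> \<theta>)) \<and>
     \<comment> \<open>the output is a minimizer up to the prescribed precision\<close>
     F_obj \<omega> q \<theta> (x_out \<omega> q \<theta> \<delta> \<phi>\<^sub>0) \<le> F_opt \<omega> q \<theta> + \<delta> \<and>
     \<comment> \<open>the iteration bound, and its \<open>O\<close>-form with an absolute constant\<close>
     real (iterations \<omega> q \<theta> \<delta> \<phi>\<^sub>0)
       \<le> iter_bound (CARD('k), CARD('n), max_dist \<omega>, \<phi>\<^sub>0, \<delta>, beta q) \<and>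
     (CARD('k), CARD('n), max_dist \<omega>, \<phi>\<^sub>0, \<delta>, beta q) \<in> param_range \<and>
     iter_bound \<in> O[principal param_range](iter_rate) \<and>
     \<comment> \<open>the start is explicit, and every iteration is a Newton step of a known function\<close>
     pre_iter \<omega> q \<theta> \<delta> \<phi>\<^sub>0 0 =
       (0, (\<chi> i. 1 / (2 * real CARD('k))), ln (4 * real CARD('k) * norm1 q)) \<and>
     (\<forall>i < pre_count \<omega> q \<theta> \<delta> \<phi>\<^sub>0.
        pre_iter \<omega> q \<theta> \<delta> \<phi>\<^sub>0 (Suc i) =
          newton_step (E_space \<omega> \<theta>) (pre_fun \<omega> q \<theta> \<delta> \<phi>\<^sub>0 (Suc i)) (pre_iter \<omega> q \<theta> \<delta> \<phi>\<^sub>0 i)) \<and>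
     main_iter \<omega> q \<theta> \<delta> \<phi>\<^sub>0 0 =
       newton_step (E_space \<omega> \<theta>) (main_fun \<omega> q \<theta> \<delta> \<phi>\<^sub>0 0)
         (pre_iter \<omega> q \<theta> \<delta> \<phi>\<^sub>0 (pre_count \<omega> q \<theta> \<delta> \<phi>\<^sub>0)) \<and>
     (\<forall>i < main_count \<omega> q \<theta> \<delta> \<phi>\<^sub>0.
        main_iter \<omega> q \<theta> \<delta> \<phi>\<^sub>0 (Suc i) =
          newton_step (E_space \<omega> \<theta>) (main_fun \<omega> q \<theta> \<delta> \<phi>\<^sub>0 (Suc i)) (main_iter \<omega> q \<theta> \<delta> \<phi>\<^sub>0 i))"
proof -
  interpret geometric_program \<omega> q \<theta> \<delta> \<phi>\<^sub>0
    using assms by unfold_locales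
  have D: "pre i \<in> D" "mn i \<in> D" for i
    using pre_near_path mn_near_path by blast+
  have "p \<in> interior_D \<omega> q \<theta> \<delta> \<phi>\<^sub>0 \<and> bij_betw (hess \<omega> q \<theta> \<delta> \<phi>\<^sub>0 p) E E" if "p \<in> D" for p
    using that D_subset_interior_D bij_hess by blast
  then have "\<forall>p \<in> pre ` {..npre} \<union> mn ` {..nmain}.
      p \<in> interior_D \<omega> q \<theta> \<delta> \<phi>\<^sub>0 \<and> bij_betw (hess \<omega> q \<theta> \<delta> \<phi>\<^sub>0 p) E E"
    using D by blast
  moreover have "pre 0 = (0, (\<chi> i. 1 / (2 * real CARD('k))), ln (4 * real CARD('k) * norm1 q))"
    by (simp add: start_def)
  moreover have "mn 0 = newton_step E (main_fun \<omega> q \<theta> \<delta> \<phi>\<^sub>0 0) (pre npre)"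
    unfolding main_fun_newton_step[OF D(1)] mn_0 by simp
  moreover have "mn (Suc i) = newton_step E (main_fun \<omega> q \<theta> \<delta> \<phi>\<^sub>0 (Suc i)) (mn i)" for i
    unfolding main_fun_newton_step[OF D(2)] by (rule mn_Suc[OF D(2)])
  ultimately show ?thesis
    using exit_exists output_error iterations_le params_in_range iter_bound_bigo pre_newton_step by blast
qed

end
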